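(* Let $\Omega\subset\mathbb{R}^2$ be an open, bounded, connected set with $\sigma(\Omega)=\Omega$, where $\sigma(x_1,x_2)=(x_1,-x_2)$, and let $a^-=(a^-_1,0)$, $a^+=(a^+_1,0)$ with $a^-_1<a^+_1$. Let $(\lambda_k(a^-,a^+))_{k\ge1}$, $(\lambda_k^{NDN}(a^-,a^+))_{k\ge1}$ and $(\lambda_k^{DND}(a^-,a^+))_{k\ge1}$ be the sequences of eigenvalues of the operators $H_A$, $H_{NDN}$ and $H_{DND}$ defined in the context. Then the sequence $(\lambda_k(a^-,a^+))_{k\ge1}$ is the union, counted with multiplicities, of the sequences $(\lambda_k^{NDN}(a^-,a^+))_{k\ge1}$ and $(\lambda_k^{DND}(a^-,a^+))_{k\ge1}$.
   Context: Let $\mathcal R=\{x_2=0\}\subset\mathbb{R}^2$, $\mathcal I_c=[a_1^-,a_1^+]\times\{0\}$, and let $$A(x)=-\frac12\frac{(-x_2,\,x_1-a^-_1)}{(x_1-a^-_1)^2+x_2^2}+\frac12\frac{(-x_2,\,x_1-a^+_1)}{(x_1-a^+_1)^2+x_2^2}$$ on $\mathbb{R}^2\setminus\{a^-,a^+\}$. $H_A$ is the Friedrichs extension in the complex Hilbert space $L^2(\Omega,\mathbb{C})$ of $(i\nabla+A)^2$ acting on $C^\infty_c(\Omega\setminus\{a^-,a^+\},\mathbb{C})$; its eigenvalues are counted with complex multiplicity. Let $L^2_{\mathbb{R},\sigma}(\Omega)$ be the real Hilbert space of real-valued $u\in L^2(\Omega)$ with $u\circ\sigma=u$. $H_{NDN}$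 is the operator on $L^2_{\mathbb{R},\sigma}(\Omega)$ which is the Friedrichs extension of $-\Delta$ acting on $\{u\in C^\infty_c(\Omega\setminus\mathcal I_c,\mathbb{R}):u\circ\sigma=u\}$; its domain is $\{u\in H^1_0(\Omega\setminus\mathcal I_c):u\circ\sigma=u,\ \Delta|_{\Omega\setminus\mathcal I_c}u\in L^2_{\mathbb{R},\sigma}(\Omega)\}$ (distributional Laplacian in $\Omega\setminus\mathcal I_c$). $H_{DND}$ is the operator on $L^2_{\mathbb{R},\sigma}(\Omega)$ which is the Friedrichs extension of $-\Delta$ acting on $\{u\in C^\infty_c(\Omega\setminus(\mathcal R\setminus\mathcal I_c),\mathbb{R}):u\circ\sigma=u\}$, with domain $\{u\in H^1_0(\Omega\setminus(\mathcal R\setminus\mathcal I_c)):u\circ\sigma=u,\ \Delta|_{\Omega\setminus(\mathcal R\setminus\mathcal I_c)}u\in L^2_{\mathbb{R},\sigma}(\Omega)\}$. Their eigenvalues are counted with real multiplicity. *)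

theory Defs
  imports "HOL-Analysis.Analysis"
begin

definition partial_deriv :: "'n::finite \<Rightarrow> (real ^ 'n \<Rightarrow> 'a::real_normed_vector) \<Rightarrow> real ^ 'n \<Rightarrow> 'a" where
  "partial_deriv j f x = frechet_derivative f (at x) (axis j 1)"

primrec iterated_partial ::
    "'n::finite list \<Rightarrow> (real ^ 'n \<Rightarrow> 'a::real_normed_vector) \<Rightarrow> real ^ 'n \<Rightarrow> 'a" where
  "iterated_partial [] f = f"
| "iterated_partial (j # js) f = partial_deriv j (iterated_partial js f)"

definition smooth :: "(real ^ 'n::finite \<Rightarrow> 'a::real_normed_vector) \<Rightarrow> bool" where
  "smooth f \<longleftrightarrow> (\<forall>js x. iterated_partial js f differentiable (at x))"

text \<open>The space \<open>C\<^sub>c\<^sup>\<infinity>(U)\<close>; its elements are regarded as functions on the whole space, extended by zero.\<close>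

definition test_functions :: "(real ^ 'n::finite) set \<Rightarrow> (real ^ 'n \<Rightarrow> 'a::real_normed_vector) set" where
  "test_functions U =
     {f. smooth f \<and> compact (closure {x. f x \<noteq> 0}) \<and> closure {x. f x \<noteq> 0} \<subseteq> U}"

text \<open>
  Elements of \<open>L\<^sup>2(\<Omega>)\<close> are represented by functions on the whole space. Functions that agree almost
  everywhere in \<open>\<Omega>\<close> represent the same element, and all notions below respect this identification.
  The scalar type \<open>'s\<close> is \<^typ>\<open>real\<close> or \<^typ>\<open>complex\<close>.
\<close>

definition L2 :: "(real ^ 'n::finite) set \<Rightarrow> (real ^ 'n \<Rightarrow> 's::real_normed_field) set" where
  "L2 \<Omega> = {u. u \<in> borel_measurable (lebesgue_on \<Omega>) \<and>
              integrable (lebesgue_on \<Omega>) (\<lambda>x. (norm (u x))\<^sup>2)}"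

definition L2_inner_real ::
    "(real ^ 'n::finite) set \<Rightarrow> (real ^ 'n \<Rightarrow> real) \<Rightarrow> (real ^ 'n \<Rightarrow> real) \<Rightarrow> real" where
  "L2_inner_real \<Omega> u v = (LINT x|lebesgue_on \<Omega>. u x * v x)"

definition L2_inner_complex ::
    "(real ^ 'n::finite) set \<Rightarrow> (real ^ 'n \<Rightarrow> complex) \<Rightarrow> (real ^ 'n \<Rightarrow> complex) \<Rightarrow> complex" where
  "L2_inner_complex \<Omega> u v = (LINT x|lebesgue_on \<Omega>. u x * cnj (v x))"

text \<open>
  Let \<open>S\<close> be a densely defined, symmetric, nonnegative operator with domain \<open>D\<close> in the Hilbert space
  \<open>H\<close> with inner product \<open>ip\<close>. The domain of the closure of the form \<open>(u, v) \<mapsto> ip (S u) v\<close> consists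
  of the \<open>H\<close>-limits of sequences in \<open>D\<close> that are Cauchy for the form. The Friedrichs extension of
  \<open>S\<close> is the restriction of the adjoint of \<open>S\<close> to this form domain; it is represented by its graph.
\<close>

definition form_domain ::
    "('x \<Rightarrow> 's::real_normed_field) set \<Rightarrow> (('x \<Rightarrow> 's) \<Rightarrow> ('x \<Rightarrow> 's) \<Rightarrow> 's) \<Rightarrow>
     ('x \<Rightarrow> 's) set \<Rightarrow> (('x \<Rightarrow> 's) \<Rightarrow> ('x \<Rightarrow> 's)) \<Rightarrow> ('x \<Rightarrow> 's) set" where
  "form_domain H ip D S =
     {u \<in> H. \<exists>w :: nat \<Rightarrow> 'x \<Rightarrow> 's.
        (\<forall>n. w n \<in> D) \<and>
        (\<lambda>n. ip (\<lambda>x. w n x - u x) (\<lambda>x. w n x - u x)) \<longlonglongrightarrow> 0 \<and>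
        (\<forall>e>0. \<exists>N. \<forall>m\<ge>N. \<forall>n\<ge>N.
           norm (ip (S (\<lambda>x. w m x - w n x)) (\<lambda>x. w m x - w n x)) < e)}"

definition friedrichs_extension ::
    "('x \<Rightarrow> 's::real_normed_field) set \<Rightarrow> (('x \<Rightarrow> 's) \<Rightarrow> ('x \<Rightarrow> 's) \<Rightarrow> 's) \<Rightarrow>
     ('x \<Rightarrow> 's) set \<Rightarrow> (('x \<Rightarrow> 's) \<Rightarrow> ('x \<Rightarrow> 's)) \<Rightarrow> (('x \<Rightarrow> 's) \<times> ('x \<Rightarrow> 's)) set" where
  "friedrichs_extension H ip D S =
     {(u, f). u \<in> form_domain H ip D S \<and> f \<in> H \<and> (\<forall>v\<in>D. ip u (S v) = ip f v)}"

definition eigenspace ::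
    "(('x \<Rightarrow> 's::real_normed_field) \<times> ('x \<Rightarrow> 's)) set \<Rightarrow> 's \<Rightarrow> ('x \<Rightarrow> 's) set" where
  "eigenspace T z = {u. (u, \<lambda>x. z * u x) \<in> T}"

text \<open>
  \<open>has_dimension \<Omega> E n\<close>: modulo equality almost everywhere in \<open>\<Omega>\<close>, the space \<open>E\<close> has a basis of
  \<open>n\<close> elements over the scalar field \<open>'s\<close>.
\<close>

definition has_dimension ::
    "(real ^ 'n::finite) set \<Rightarrow> (real ^ 'n \<Rightarrow> 's::real_normed_field) set \<Rightarrow> nat \<Rightarrow> bool" where
  "has_dimension \<Omega> E n \<longleftrightarrow>
     (\<exists>b :: nat \<Rightarrow> real ^ 'n \<Rightarrow> 's.
        (\<forall>i<n. b i \<in> E) \<and>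
        (\<forall>c. (AE x in lebesgue_on \<Omega>. (\<Sum>i<n. c i * b i x) = 0) \<longrightarrow> (\<forall>i<n. c i = 0)) \<and>
        (\<forall>u\<in>E. \<exists>c. AE x in lebesgue_on \<Omega>. u x = (\<Sum>i<n. c i * b i x)))"

text \<open>
  \<open>lam\<close> lists all eigenvalues of \<open>T\<close> in nondecreasing order, each repeated according to its
  (finite) multiplicity. The indices start at \<open>0\<close>, so \<open>lam k\<close> is \<open>\<lambda>\<^sub>k\<^sub>+\<^sub>1\<close>.
\<close>

definition eigenvalue_sequence ::
    "(real ^ 'n::finite) set \<Rightarrow>
     ((real ^ 'n \<Rightarrow> 's::real_normed_field) \<times> (real ^ 'n \<Rightarrow> 's)) set \<Rightarrow> (nat \<Rightarrow> real) \<Rightarrow> bool" where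
  "eigenvalue_sequence \<Omega> T lam \<longleftrightarrow>
     mono lam \<and>
     (\<forall>z. finite {k. of_real (lam k) = z} \<and>
          has_dimension \<Omega> (eigenspace T z) (card {k. of_real (lam k) = z}))"

definition union_with_multiplicities ::
    "(nat \<Rightarrow> real) \<Rightarrow> (nat \<Rightarrow> real) \<Rightarrow> (nat \<Rightarrow> real) \<Rightarrow> bool" where
  "union_with_multiplicities lam mu nu \<longleftrightarrow>
     (\<exists>h :: nat \<Rightarrow> nat + nat. bij h \<and> (\<forall>k. lam k = case_sum mu nu (h k)))"

definition \<sigma> :: "real ^ 2 \<Rightarrow> real ^ 2" where
  "\<sigma> x = vector [x $ 1, - x $ 2]"

definition axis_line :: "(real ^ 2) set" where
  "axis_line = {x. x $ 2 = 0}"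

definition pole :: "real \<Rightarrow> real ^ 2" where
  "pole a = vector [a, 0]"

definition segment_between :: "real \<Rightarrow> real \<Rightarrow> (real ^ 2) set" where
  "segment_between am ap = {x. x $ 1 \<in> {am..ap} \<and> x $ 2 = 0}"

text \<open>The junk values at the two poles are irrelevant: the potential is only multiplied with functions
  that vanish near the poles.\<close>

definition AB_potential :: "real \<Rightarrow> real \<Rightarrow> real ^ 2 \<Rightarrow> real ^ 2" where
  "AB_potential am ap x =
     - (1/2) *\<^sub>R ((1 / ((x $ 1 - am)\<^sup>2 + (x $ 2)\<^sup>2)) *\<^sub>R vector [- x $ 2, x $ 1 - am])
     + (1/2) *\<^sub>R ((1 / ((x $ 1 - ap)\<^sup>2 + (x $ 2)\<^sup>2)) *\<^sub>R vector [- x $ 2, x $ 1 - ap])"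

definition magnetic_deriv ::
    "(real ^ 2 \<Rightarrow> real ^ 2) \<Rightarrow> 2 \<Rightarrow> (real ^ 2 \<Rightarrow> complex) \<Rightarrow> real ^ 2 \<Rightarrow> complex" where
  "magnetic_deriv A j u x = \<i> * partial_deriv j u x + of_real (A x $ j) * u x"

definition magnetic_laplacian ::
    "(real ^ 2 \<Rightarrow> real ^ 2) \<Rightarrow> (real ^ 2 \<Rightarrow> complex) \<Rightarrow> real ^ 2 \<Rightarrow> complex" where
  "magnetic_laplacian A u x = (\<Sum>j\<in>UNIV. magnetic_deriv A j (magnetic_deriv A j u) x)"

definition neg_laplacian :: "(real ^ 2 \<Rightarrow> real) \<Rightarrow> real ^ 2 \<Rightarrow> real" where
  "neg_laplacian u x = - (\<Sum>j\<in>UNIV. partial_deriv j (partial_deriv j u) x)"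

definition L2_sym :: "(real ^ 2) set \<Rightarrow> (real ^ 2 \<Rightarrow> real) set" where
  "L2_sym \<Omega> = {u \<in> L2 \<Omega>. AE x in lebesgue_on \<Omega>. u (\<sigma> x) = u x}"

definition H_A ::
    "(real ^ 2) set \<Rightarrow> real \<Rightarrow> real \<Rightarrow> ((real ^ 2 \<Rightarrow> complex) \<times> (real ^ 2 \<Rightarrow> complex)) set" where
  "H_A \<Omega> am ap =
     friedrichs_extension (L2 \<Omega>) (L2_inner_complex \<Omega>)
       (test_functions (\<Omega> - {pole am, pole ap}))
       (magnetic_laplacian (AB_potential am ap))"

definition H_NDN ::
    "(real ^ 2) set \<Rightarrow> real \<Rightarrow> real \<Rightarrow> ((real ^ 2 \<Rightarrow> real) \<times> (real ^ 2 \<Rightarrow> real)) set" where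
  "H_NDN \<Omega> am ap =
     friedrichs_extension (L2_sym \<Omega>) (L2_inner_real \<Omega>)
       {u \<in> test_functions (\<Omega> - segment_between am ap). u \<circ> \<sigma> = u}
       neg_laplacian"

text \<open>
  The set \<open>\<Omega> - (axis_line - segment_between am ap)\<close> need not be open, since it can contain the two
  poles. The support condition in \<^const>\<open>test_functions\<close> is imposed literally for this set.
\<close>

definition H_DND ::
    "(real ^ 2) set \<Rightarrow> real \<Rightarrow> real \<Rightarrow> ((real ^ 2 \<Rightarrow> real) \<times> (real ^ 2 \<Rightarrow> real)) set" where
  "H_DND \<Omega> am ap =
     friedrichs_extension (L2_sym \<Omega>) (L2_inner_real \<Omega>)
       {u \<in> test_functions (\<Omega> - (axis_line - segment_between am ap)). u \<circ> \<sigma> = u}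
       neg_laplacian"

end

theory Submission
  imports Defs
begin

text \<open>
  Locally \<open>A = \<nabla>\<phi>\<close>, and \<open>W = e\<^bsup>2i\<phi>\<^esup>\<close> is single valued off the two poles. The map
  \<open>u \<mapsto> W \<cdot> (u \<circ> \<sigma>)\<close> is a unitary involution commuting with the magnetic Laplacian, and its two
  eigenspaces are trivialised by two square roots \<open>G\<close> of \<open>W\<close>: one is smooth off the segment
  between the poles, the other is smooth off the rest of the axis. Since \<open>\<partial>\<^sub>j G = i A\<^sub>j G\<close>,
  multiplication by \<open>G\<close> turns the Laplacian into the magnetic Laplacian, and a symmetric test function
  necessarily vanishes on the cut \<open>N\<close> of its gauge. Cutting off near \<open>N\<close> costs only \<open>O(1/n)\<close>
  in the form norm, so the functions \<open>G h + G' k\<close> with even test functions \<open>h\<close>, \<open>k\<close> supported off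
  the respective cuts are a form core. On this core the operator is the direct sum of the
  complexifications of the two mixed Laplacians, so the dimensions of eigenspaces add.
\<close>

section \<open>Smooth functions\<close>

text \<open>Each pole carries half a flux quantum: locally \<phi> is half the difference of the
  polar angles around the poles, so e^{i\<phi>} changes sign after one turn around a single pole. A
  single-valued square root of W therefore needs a cut. The principal root of W is cut where W is
  negative, on the segment; that of -W where W is positive on the axis, beyond the poles. The
  obstacle is that magnetic test functions vanish near the poles only. A symmetric one, divided by
  its gauge factor, is even and zero on the cut, but its support still meets the cut and it may have
  a kink there, like |x2|. It is thus not a test function of the mixed problem and has to be cut
  off. Second derivatives of the cutoff have size n^2, yet they are multiplied by a function of size
  1/n and paired with another such function, so the integrand stays bounded and dominated
  convergence suffices. The Neumann condition on the rest of the axis is not imposed anywhere: it is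
  the natural condition for even functions that are free there.\<close>

lemma partial_deriv_eqI:
  "(f has_derivative f') (at x) \<Longrightarrow> partial_deriv j f x = f' (axis j 1)"
  unfolding partial_deriv_def by (metis frechet_derivative_at)

lemma differentiable_has_frechet:
  "f differentiable (at x) \<Longrightarrow> (f has_derivative frechet_derivative f (at x)) (at x)"
  using frechet_derivative_works by blast

lemma partial_deriv_cong_open:
  assumes "open U" "x \<in> U" "\<And>y. y \<in> U \<Longrightarrow> f y = g y"
  shows "partial_deriv j f x = partial_deriv j g x"
proof -
  have "(f has_derivative D) (at x) \<longleftrightarrow> (g has_derivative D) (at x)" for D
    using has_derivative_transform_within_open[of _ _ x UNIV U] assms by metis
  then show ?thesis
    unfolding partial_deriv_def frechet_derivative_def by simp
qed

lemma partial_deriv_const [simp]: "partial_deriv j (\<lambda>x. c) x = 0"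
  by (rule trans[OF partial_deriv_eqI[of _ "\<lambda>h. 0"]]) auto

lemma partial_deriv_add:
  assumes "f differentiable (at x)" "g differentiable (at x)"
  shows "partial_deriv j (\<lambda>x. f x + g x) x = partial_deriv j f x + partial_deriv j g x"
  by (rule trans[OF partial_deriv_eqI[OF has_derivative_add[OF assms[THEN differentiable_has_frechet]]]])
    (simp add: partial_deriv_def)

lemma partial_deriv_bounded_linear:
  assumes "bounded_linear L" "f differentiable (at x)"
  shows "partial_deriv j (\<lambda>x. L (f x)) x = L (partial_deriv j f x)"
  by (rule trans[OF partial_deriv_eqI[OF bounded_linear.has_derivative[OF assms(1) differentiable_has_frechet[OF assms(2)]]]])
    (simp add: partial_deriv_def)

lemma partial_deriv_mult:
  fixes f g :: "real ^ 'n::finite \<Rightarrow> 'a::real_normed_algebra"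
  assumes "f differentiable (at x)" "g differentiable (at x)"
  shows "partial_deriv j (\<lambda>x. f x * g x) x = f x * partial_deriv j g x + partial_deriv j f x * g x"
  by (rule trans[OF partial_deriv_eqI[OF has_derivative_mult[OF assms[THEN differentiable_has_frechet]]]])
    (simp add: partial_deriv_def)

lemma partial_deriv_minus:
  assumes "f differentiable (at x)" "g differentiable (at x)"
  shows "partial_deriv j (\<lambda>x. f x - g x) x = partial_deriv j f x - partial_deriv j g x"
  by (rule trans[OF partial_deriv_eqI[OF has_derivative_diff[OF assms[THEN differentiable_has_frechet]]]])
    (simp add: partial_deriv_def)

lemma partial_deriv_inverse:
  fixes f :: "real ^ 'n::finite \<Rightarrow> 'a::real_normed_field"
  assumes "f differentiable (at x)" "f x \<noteq> 0"
  shows "partial_deriv j (\<lambda>x. inverse (f x)) x = - (partial_deriv j f x * (inverse (f x) * inverse (f x)))"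
  by (rule trans[OF partial_deriv_eqI[OF Deriv.has_derivative_inverse[OF assms(2) differentiable_has_frechet[OF assms(1)]]]])
    (simp add: partial_deriv_def)

lemma partial_deriv_comp_real:
  fixes f :: "real ^ 'n::finite \<Rightarrow> real"
  assumes "f differentiable (at x)" "(F has_real_derivative F') (at (f x))"
  shows "partial_deriv j (\<lambda>x. F (f x)) x = F' * partial_deriv j f x"
    and "(\<lambda>x. F (f x)) differentiable (at x)"
proof -
  have d: "((\<lambda>x. F (f x)) has_derivative (\<lambda>h. F' * frechet_derivative f (at x) h)) (at x)"
    using has_derivative_compose[OF differentiable_has_frechet[OF assms(1)], of F "(*) F'"] assms(2)
    by (simp add: has_field_derivative_def)
  show "partial_deriv j (\<lambda>x. F (f x)) x = F' * partial_deriv j f x"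
    using partial_deriv_eqI[OF d] by (simp add: partial_deriv_def)
  show "(\<lambda>x. F (f x)) differentiable (at x)" using d by (rule differentiableI)
qed

lemma partial_deriv_component:
  "partial_deriv j (\<lambda>x. x $ i) x = (if i = j then 1 else 0)"
  by (rule trans[OF partial_deriv_eqI[of _ "\<lambda>h. h $ i"]])
    (auto simp: axis_def intro!: bounded_linear_imp_has_derivative bounded_linear_vec_nth)

text \<open>Recursion on the order, peeling off the innermost derivative, makes the product,
  quotient and chain rules plain inductions. The set is a parameter because the gauge factors are
  smooth only off their cuts.\<close>

primrec ndiff_on :: "nat \<Rightarrow> (real ^ 'n::finite) set \<Rightarrow> (real ^ 'n \<Rightarrow> 'a::real_normed_vector) \<Rightarrow> bool" where
  "ndiff_on 0 U f \<longleftrightarrow> True"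
| "ndiff_on (Suc k) U f \<longleftrightarrow> (\<forall>x\<in>U. f differentiable (at x)) \<and> (\<forall>j. ndiff_on k U (partial_deriv j f))"

definition smooth_on :: "(real ^ 'n::finite) set \<Rightarrow> (real ^ 'n \<Rightarrow> 'a::real_normed_vector) \<Rightarrow> bool" where
  "smooth_on U f \<longleftrightarrow> (\<forall>k. ndiff_on k U f)"

lemma ndiff_on_cong:
  assumes "open U" "\<And>x. x \<in> U \<Longrightarrow> f x = g x" "ndiff_on k U f"
  shows "ndiff_on k U g"
  using assms(2,3)
proof (induction k arbitrary: f g)
  case (Suc k)
  have "g differentiable (at x)" if "x \<in> U" for x
    using Suc.prems that assms(1) unfolding differentiable_def ndiff_on.simps
    by (metis has_derivative_transform_within_open)
  moreover have "ndiff_on k U (partial_deriv j g)" for j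
    using Suc.IH[of "partial_deriv j f" "partial_deriv j g"] Suc.prems
      partial_deriv_cong_open[OF assms(1)] by (metis ndiff_on.simps(2))
  ultimately show ?case by simp
qed simp

lemma ndiff_on_Suc_imp: "ndiff_on (Suc k) U f \<Longrightarrow> ndiff_on k U f"
  by (induction k arbitrary: f) auto

lemma ndiff_on_Un: "ndiff_on k U f \<Longrightarrow> ndiff_on k V f \<Longrightarrow> ndiff_on k (U \<union> V) f"
  by (induction k arbitrary: f) auto

lemma ndiff_on_subset: "ndiff_on k U f \<Longrightarrow> V \<subseteq> U \<Longrightarrow> ndiff_on k V f"
  by (induction k arbitrary: f) auto

text \<open>Derivatives have to be identified on \<open>U\<close> only: as \<open>U\<close> is open,
  values outside it do not influence further derivatives inside.\<close>

lemma ndiff_on_SucI: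
  assumes "open U" "\<And>x. x \<in> U \<Longrightarrow> f differentiable (at x)"
    "\<And>j x. x \<in> U \<Longrightarrow> partial_deriv j f x = g j x" "\<And>j. ndiff_on k U (g j)"
  shows "ndiff_on (Suc k) U f"
  using assms ndiff_on_cong[OF assms(1), of "g _" "partial_deriv _ f" k] by auto

lemma ndiff_on_const: "open U \<Longrightarrow> ndiff_on k U (\<lambda>x. c)"
proof (induction k arbitrary: c)
  case (Suc k)
  then show ?case by (intro ndiff_on_SucI[where g = "\<lambda>_ _. 0"]) auto
qed simp

lemma ndiff_on_bounded_linear:
  assumes "bounded_linear L" "open U"
  shows "ndiff_on k U f \<Longrightarrow> ndiff_on k U (\<lambda>x. L (f x))"
proof (induction k arbitrary: f)
  case (Suc k)
  have "(\<lambda>x. L (f x)) differentiable (at x)" if "x \<in> U" for x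
    using Suc.prems that bounded_linear.has_derivative[OF assms(1)]
    unfolding differentiable_def ndiff_on.simps by blast
  then show ?case using assms Suc
    by (intro ndiff_on_SucI[where g = "\<lambda>j x. L (partial_deriv j f x)"])
       (auto intro: partial_deriv_bounded_linear)
qed simp

lemma ndiff_on_add:
  assumes "open U"
  shows "ndiff_on k U f \<Longrightarrow> ndiff_on k U g \<Longrightarrow> ndiff_on k U (\<lambda>x. f x + g x)"
proof (induction k arbitrary: f g)
  case (Suc k)
  then show ?case using assms
    by (intro ndiff_on_SucI[where g = "\<lambda>j x. partial_deriv j f x + partial_deriv j g x"])
       (auto intro: partial_deriv_add)
qed simp

lemma ndiff_on_mult:
  fixes f g :: "real ^ 'n::finite \<Rightarrow> 'a::real_normed_algebra"
  assumes "open U"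
  shows "ndiff_on k U f \<Longrightarrow> ndiff_on k U g \<Longrightarrow> ndiff_on k U (\<lambda>x. f x * g x)"
proof (induction k arbitrary: f g)
  case (Suc k)
  then have "ndiff_on k U f" "ndiff_on k U g" using ndiff_on_Suc_imp by blast+
  then show ?case using assms Suc
    by (intro ndiff_on_SucI[where g = "\<lambda>j x. f x * partial_deriv j g x + partial_deriv j f x * g x"])
       (auto intro!: partial_deriv_mult differentiable_mult ndiff_on_add)
qed simp

lemma ndiff_on_inverse:
  fixes f :: "real ^ 'n::finite \<Rightarrow> 'a::real_normed_field"
  assumes "open U" "\<And>x. x \<in> U \<Longrightarrow> f x \<noteq> 0"
  shows "ndiff_on k U f \<Longrightarrow> ndiff_on k U (\<lambda>x. inverse (f x))"
proof (induction k)
  case (Suc k)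
  then have "ndiff_on k U (\<lambda>x. inverse (f x))" "\<And>j. ndiff_on k U (partial_deriv j f)"
    using ndiff_on_Suc_imp by auto
  then have "ndiff_on k U (\<lambda>x. (-1) * (partial_deriv j f x * (inverse (f x) * inverse (f x))))" for j
    using assms by (intro ndiff_on_mult ndiff_on_const)
  then show ?case using assms Suc.prems
    by (intro ndiff_on_SucI[where g = "\<lambda>j x. (-1) * (partial_deriv j f x * (inverse (f x) * inverse (f x)))"])
       (auto simp: partial_deriv_inverse intro!: differentiable_inverse)
qed simp

lemma smooth_on_cong:
  "open U \<Longrightarrow> (\<And>x. x \<in> U \<Longrightarrow> f x = g x) \<Longrightarrow> smooth_on U f \<Longrightarrow> smooth_on U g"
  unfolding smooth_on_def using ndiff_on_cong by metis

lemma smooth_on_const [simp]: "open U \<Longrightarrow> smooth_on U (\<lambda>x. c)"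
  by (simp add: smooth_on_def ndiff_on_const)

lemma smooth_on_add: "open U \<Longrightarrow> smooth_on U f \<Longrightarrow> smooth_on U g \<Longrightarrow> smooth_on U (\<lambda>x. f x + g x)"
  by (simp add: smooth_on_def ndiff_on_add)

lemma smooth_on_bounded_linear:
  "bounded_linear L \<Longrightarrow> open U \<Longrightarrow> smooth_on U f \<Longrightarrow> smooth_on U (\<lambda>x. L (f x))"
  by (simp add: smooth_on_def ndiff_on_bounded_linear)

lemma smooth_on_diff: "open U \<Longrightarrow> smooth_on U f \<Longrightarrow> smooth_on U g \<Longrightarrow> smooth_on U (\<lambda>x. f x - g x)"
  using smooth_on_add[of U f "\<lambda>x. - g x"] smooth_on_bounded_linear[OF bounded_linear_minus[OF bounded_linear_ident], of U g]
  by simp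

lemma smooth_on_mult:
  fixes f g :: "real ^ 'n::finite \<Rightarrow> 'a::real_normed_algebra"
  shows "open U \<Longrightarrow> smooth_on U f \<Longrightarrow> smooth_on U g \<Longrightarrow> smooth_on U (\<lambda>x. f x * g x)"
  by (simp add: smooth_on_def ndiff_on_mult)

lemma smooth_on_inverse:
  fixes f :: "real ^ 'n::finite \<Rightarrow> 'a::real_normed_field"
  shows "open U \<Longrightarrow> (\<And>x. x \<in> U \<Longrightarrow> f x \<noteq> 0) \<Longrightarrow> smooth_on U f \<Longrightarrow> smooth_on U (\<lambda>x. inverse (f x))"
  by (simp add: smooth_on_def ndiff_on_inverse)

lemma smooth_on_subset: "smooth_on U f \<Longrightarrow> V \<subseteq> U \<Longrightarrow> smooth_on V f"
  unfolding smooth_on_def using ndiff_on_subset by blast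

lemma smooth_on_Un: "smooth_on U f \<Longrightarrow> smooth_on V f \<Longrightarrow> smooth_on (U \<union> V) f"
  by (simp add: smooth_on_def ndiff_on_Un)

lemma smooth_on_partial: "smooth_on U f \<Longrightarrow> smooth_on U (partial_deriv j f)"
  unfolding smooth_on_def by (metis ndiff_on.simps(2))

lemma smooth_on_differentiable: "smooth_on U f \<Longrightarrow> x \<in> U \<Longrightarrow> f differentiable (at x)"
  unfolding smooth_on_def by (metis ndiff_on.simps(2))

lemma smooth_on_continuous: "smooth_on U f \<Longrightarrow> continuous_on U f"
  by (meson continuous_at_imp_continuous_on differentiable_imp_continuous_within smooth_on_differentiable)

lemma smooth_on_component:
  fixes U :: "(real ^ 'n::finite) set"
  assumes U: "open U"
  shows "smooth_on U (\<lambda>x. x $ i)"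
proof -
  have "ndiff_on k U (\<lambda>x. x $ i)" for k
  proof (cases k)
    case (Suc m)
    have d: "(\<lambda>x. x $ i) differentiable (at x)" for x :: "real ^ 'n"
      using bounded_linear_imp_differentiable[OF bounded_linear_vec_nth] .
    show ?thesis unfolding Suc
      by (rule ndiff_on_SucI[where g = "\<lambda>j x. if i = j then 1 else 0"])
         (auto simp: partial_deriv_component U d intro: ndiff_on_const)
  qed simp
  then show ?thesis by (simp add: smooth_on_def)
qed

text \<open>\<open>iterated_partial\<close> adds derivatives on the outside while
  \<open>ndiff_on\<close> removes them from the inside; an index appended at the end of the list is
  the innermost derivative.\<close>

lemma iterated_partial_append:
  "iterated_partial (js @ [j]) f = iterated_partial js (partial_deriv j f)"
  by (induction js) auto

lemma smooth_iff:
  fixes f :: "real ^ 'n::finite \<Rightarrow> 'a::real_normed_vector"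
  shows "smooth f \<longleftrightarrow> smooth_on UNIV f"
proof
  assume s: "smooth f"
  have "smooth g \<Longrightarrow> ndiff_on k UNIV g" for k and g :: "real ^ 'n \<Rightarrow> 'a"
  proof (induction k arbitrary: g)
    case (Suc k)
    have "smooth (partial_deriv j g)" for j
      using Suc.prems unfolding smooth_def by (metis iterated_partial_append)
    moreover have "g differentiable (at x)" for x
      using Suc.prems[unfolded smooth_def, rule_format, of "[]"] by simp
    ultimately show ?case using Suc.IH by auto
  qed simp
  then show "smooth_on UNIV f" using s by (simp add: smooth_on_def)
next
  assume s: "smooth_on UNIV f"
  have "smooth_on UNIV (iterated_partial js f)" for js
    by (induction js) (auto simp: s smooth_on_partial)
  then show "smooth f" unfolding smooth_def by (meson UNIV_I smooth_on_differentiable)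
qed

text \<open>Bootstrapping: every derivative of \<open>G\<close> is again a smooth multiple of
  \<open>G\<close>, so the first-order equation alone raises the order of differentiability. This
  spares higher derivatives of square roots.\<close>

lemma smooth_on_gauge:
  fixes G :: "real ^ 'n::finite \<Rightarrow> 'a::real_normed_algebra"
  assumes "open U" "\<And>x. x \<in> U \<Longrightarrow> G differentiable (at x)"
    "\<And>j x. x \<in> U \<Longrightarrow> partial_deriv j G x = B j x * G x" "\<And>j. smooth_on U (B j)"
  shows "smooth_on U G"
proof -
  have "ndiff_on k U G" for k
  proof (induction k)
    case (Suc k)
    then show ?case using assms
      by (intro ndiff_on_SucI[where g = "\<lambda>j x. B j x * G x"])
         (auto simp: smooth_on_def intro: ndiff_on_mult)
  qed simp
  then show ?thesis by (simp add: smooth_on_def)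
qed

section \<open>A smooth step function and cutoffs\<close>

text \<open>\<open>y ^ n / fact n\<close> is a single term of the exponential series, whose terms
  are all nonnegative.\<close>

lemma power_le_fact_mult_exp:
  fixes y :: real assumes "0 \<le> y" shows "y ^ n \<le> fact n * exp y"
proof -
  have "(\<Sum>i\<in>{n}. inverse (fact i) * y ^ i) \<le> (\<Sum>i. inverse (fact i) * y ^ i)"
    using assms by (intro sum_le_suminf summable_exp) auto
  then show ?thesis by (simp add: exp_def field_simps)
qed

text \<open>The functions x^{-k} e^{-1/x} are closed under differentiation up to linear
  combinations, so an induction that keeps \<open>k\<close> arbitrary proves smoothness of
  e^{-1/x}.\<close>

definition exp_recip :: "nat \<Rightarrow> real \<Rightarrow> real" where
  "exp_recip k x = (if x \<le> 0 then 0 else inverse x ^ k * exp (- inverse x))"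

text \<open>The exponential bound at 1/x with exponent \<open>k + 2\<close> leaves a factor x^2 to
  spare.\<close>

lemma exp_recip_bound: "\<bar>exp_recip k x\<bar> \<le> fact (k + 2) * x\<^sup>2"
proof (cases "x \<le> 0")
  case False
  then have x: "x > 0" by simp
  have "inverse x ^ (k + 2) \<le> fact (k + 2) * exp (inverse x)"
    using x by (intro power_le_fact_mult_exp) auto
  then have "inverse x ^ k * exp (- inverse x) \<le> fact (k + 2) * x\<^sup>2"
    using x by (simp add: power_add exp_minus field_simps power2_eq_square)
  then show ?thesis using x by (simp add: exp_recip_def)
qed (simp add: exp_recip_def)

lemma exp_recip_deriv:
  "(exp_recip k has_real_derivative exp_recip (k + 2) x - real k * exp_recip (k + 1) x) (at x)"
proof -
  consider "x < 0" | "x = 0" | "x > 0" by linarith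
  then show ?thesis
  proof cases
    case 1
    have "((\<lambda>x. 0) has_real_derivative 0) (at x)" by simp
    then have "(exp_recip k has_real_derivative 0) (at x)"
      by (rule has_field_derivative_transform_within_open[where S = "{..<0}"]) (use 1 in \<open>auto simp: exp_recip_def\<close>)
    then show ?thesis using 1 by (simp add: exp_recip_def)
  next
    case 2
    \<comment> \<open>One factor of the quadratic bound absorbs the denominator of the difference
      quotient at 0, the other one sends it to 0.\<close>
    have lim: "((\<lambda>y :: real. fact (k + 2) * \<bar>y\<bar>) \<longlongrightarrow> 0) (at 0)"
      by (rule tendsto_mult_right_zero[OF tendsto_rabs_zero[OF tendsto_ident_at]])
    have "norm (exp_recip k y / y) \<le> fact (k + 2) * \<bar>y\<bar>" for y
      using exp_recip_bound[of k y]
      by (cases "y = 0") (auto simp: divide_le_eq power2_eq_square abs_mult_self_eq mult.assoc)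
    then have "((\<lambda>y. exp_recip k y / y) \<longlongrightarrow> 0) (at 0)"
      by (intro Lim_null_comparison[OF _ lim] always_eventually allI)
    then show ?thesis using 2 by (simp add: has_field_derivative_iff exp_recip_def)
  next
    case 3
    have "((\<lambda>x. inverse x ^ k * exp (- inverse x)) has_real_derivative
       (exp_recip (k + 2) x - real k * exp_recip (k + 1) x)) (at x)"
    proof -
      have i: "(inverse has_real_derivative - (inverse x * inverse x)) (at x)"
        using DERIV_inverse[of x UNIV] 3 by (simp add: power2_eq_square)
      have e: "((\<lambda>x. exp (- inverse x)) has_real_derivative exp (- inverse x) * (inverse x * inverse x)) (at x)"
        using DERIV_chain2[OF DERIV_exp DERIV_minus[OF i]] by simp
      show ?thesis
        by (rule DERIV_cong[OF DERIV_mult[OF DERIV_power[OF i] e]], cases k)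
           (use 3 in \<open>auto simp: exp_recip_def algebra_simps\<close>)
    qed
    then show ?thesis
      by (rule has_field_derivative_transform_within_open[where S = "{0<..}"]) (use 3 in \<open>auto simp: exp_recip_def\<close>)
  qed
qed

lemma exp_recip_nonneg: "exp_recip k x \<ge> 0" by (simp add: exp_recip_def)

lemma exp_recip_pos_iff: "exp_recip k x > 0 \<longleftrightarrow> x > 0" by (simp add: exp_recip_def)

lemma continuous_exp_recip: "continuous_on S (exp_recip k)"
  by (meson DERIV_isCont continuous_at_imp_continuous_on exp_recip_deriv)

lemma smooth_on_exp_recip:
  fixes f :: "real ^ 'n::finite \<Rightarrow> real"
  assumes "open U" "smooth_on U f"
  shows "smooth_on U (\<lambda>x. exp_recip k (f x))"
proof -
  have "ndiff_on n U (\<lambda>x. exp_recip k (f x))" for n k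
  proof (induction n arbitrary: k)
    case (Suc n)
    have "ndiff_on n U (\<lambda>x. (exp_recip (k + 2) (f x) + (- real k) * exp_recip (k + 1) (f x)) * partial_deriv j f x)" for j
      using smooth_on_partial[OF assms(2), of j] assms(1) Suc
      by (intro ndiff_on_mult ndiff_on_add ndiff_on_const) (auto simp: smooth_on_def)
    moreover note partial_deriv_comp_real[OF smooth_on_differentiable[OF assms(2)] exp_recip_deriv]
    ultimately show ?case using assms(1) by (intro ndiff_on_SucI[where g =
       "\<lambda>j x. (exp_recip (k + 2) (f x) + (- real k) * exp_recip (k + 1) (f x)) * partial_deriv j f x"]) auto
  qed simp
  then show ?thesis by (simp add: smooth_on_def)
qed

text \<open>The standard smooth transition function. Its denominator never vanishes because
  \<open>s\<close> and \<open>1 - s\<close> are not both nonpositive.\<close>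

definition step :: "real \<Rightarrow> real" where
  "step s = exp_recip 0 s / (exp_recip 0 s + exp_recip 0 (1 - s))"

lemma step_denominator_pos: "exp_recip 0 s + exp_recip 0 (1 - s) > 0"
proof (cases "s > 0")
  case True
  then show ?thesis using exp_recip_pos_iff[of 0 s] exp_recip_nonneg[of 0 "1 - s"] by linarith
next
  case False
  then show ?thesis using exp_recip_pos_iff[of 0 "1 - s"] exp_recip_nonneg[of 0 s] by linarith
qed

lemma step_eq_0: "s \<le> 0 \<Longrightarrow> step s = 0" by (simp add: step_def exp_recip_def)

lemma step_eq_1: "s \<ge> 1 \<Longrightarrow> step s = 1" by (simp add: step_def exp_recip_def)

lemma step_bounds: "0 \<le> step s" "step s \<le> 1"
  using step_denominator_pos[of s] exp_recip_nonneg[of 0 s] exp_recip_nonneg[of 0 "1 - s"]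
  by (auto simp: step_def)

lemma smooth_on_step:
  fixes f :: "real ^ 'n::finite \<Rightarrow> real"
  assumes "open U" "smooth_on U f"
  shows "smooth_on U (\<lambda>x. step (f x))"
  unfolding step_def divide_inverse using assms step_denominator_pos
  by (intro smooth_on_mult smooth_on_inverse smooth_on_add smooth_on_exp_recip smooth_on_diff smooth_on_const)
     (auto simp: less_imp_neq[symmetric])

text \<open>Two derivatives are controlled because the cutoffs enter a second-order operator. Both
  are continuous on [0, 1] and vanish outside it, hence are bounded.\<close>

lemma step_derivatives:
  obtains s1 s2 :: "real \<Rightarrow> real" and B :: real where
    "\<And>x. (step has_real_derivative s1 x) (at x)"
    "\<And>x. (s1 has_real_derivative s2 x) (at x)"
    "\<And>x. \<bar>s1 x\<bar> \<le> B" "\<And>x. \<bar>s2 x\<bar> \<le> B"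
proof -
  define e where "e = exp_recip"
  define g where "g x = e 0 x + e 0 (1 - x)" for x
  define g' where "g' x = e 2 x - e 2 (1 - x)" for x
  \<comment> \<open>The numerator of the quotient rule after the common product cancels.
    Differentiation sends index 0 to 2, and index 2 to 4 with the correction
    \<open>- 2 * e 3\<close>, which explains the indices in \<open>N'\<close>.\<close>
  define N where "N x = e 2 x * e 0 (1 - x) + e 0 x * e 2 (1 - x)" for x
  define N' where "N' x = (e 4 x - 2 * e 3 x) * e 0 (1 - x) - e 0 x * (e 4 (1 - x) - 2 * e 3 (1 - x))" for x
  define s1 where "s1 x = N x / (g x)\<^sup>2" for x
  define s2 where "s2 x = (N' x * g x - 2 * N x * g' x) / (g x) ^ 3" for x
  have gpos: "g x > 0" for x using step_denominator_pos by (simp add: g_def e_def)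
  have e0: "(e 0 has_real_derivative e 2 x) (at x)" for x using exp_recip_deriv[of 0 x] by (simp add: e_def numeral_eq_Suc)
  have e2: "(e 2 has_real_derivative e 4 x - 2 * e 3 x) (at x)" for x using exp_recip_deriv[of 2 x] by (simp add: e_def numeral_eq_Suc)
  have r: "((\<lambda>x. 1 - x) has_real_derivative -1) (at x)" for x :: real
    by (auto intro!: derivative_eq_intros)
  have r0: "((\<lambda>x. e 0 (1 - x)) has_real_derivative - e 2 (1 - x)) (at x)" for x
    using DERIV_chain2[OF e0 r] by simp
  have r2: "((\<lambda>x. e 2 (1 - x)) has_real_derivative - (e 4 (1 - x) - 2 * e 3 (1 - x))) (at x)" for x
    using DERIV_chain2[OF e2 r] by simp
  have dg: "(g has_real_derivative g' x) (at x)" for x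
    using DERIV_add[OF e0 r0] by (simp add: g_def[abs_def] g'_def)
  have dN: "(N has_real_derivative N' x) (at x)" for x
    unfolding N_def[abs_def] N'_def
    by (rule DERIV_cong[OF DERIV_add[OF DERIV_mult[OF e2 r0] DERIV_mult[OF e0 r2]]]) (simp add: algebra_simps)
  have stepe: "step = (\<lambda>x. e 0 x / g x)" by (simp add: fun_eq_iff step_def g_def e_def)
  have d1: "(step has_real_derivative s1 x) (at x)" for x
    unfolding stepe using gpos[of x]
    by (intro DERIV_cong[OF DERIV_divide[OF e0 dg]])
       (auto simp: s1_def N_def g_def g'_def power2_eq_square algebra_simps)
  have d2: "(s1 has_real_derivative s2 x) (at x)" for x
  proof -
    have "(s1 has_real_derivative (N' x * (g x)\<^sup>2 - N x * (2 * g x * g' x)) / ((g x)\<^sup>2 * (g x)\<^sup>2)) (at x)"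
      unfolding s1_def[abs_def] using gpos[of x]
      by (intro DERIV_cong[OF DERIV_divide[OF dN DERIV_power[OF dg]]]) (auto simp: algebra_simps)
    moreover have "(N' x * (g x)\<^sup>2 - N x * (2 * g x * g' x)) / ((g x)\<^sup>2 * (g x)\<^sup>2) = s2 x"
      using gpos[of x] by (simp add: s2_def field_simps power2_eq_square power3_eq_cube)
    ultimately show ?thesis by simp
  qed
  have zero: "s1 x = 0" "s2 x = 0" if "x \<notin> {0..1}" for x
    using that by (auto simp: s1_def s2_def N_def N'_def e_def exp_recip_def)
  have cont: "continuous_on {0..1} s1" "continuous_on {0..1} s2"
    unfolding s1_def[abs_def] s2_def[abs_def] N_def[abs_def] N'_def[abs_def] g_def[abs_def] g'_def[abs_def]
    using gpos[unfolded g_def] unfolding e_def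
    by (auto intro!: continuous_intros continuous_on_compose2[OF continuous_exp_recip[of UNIV]]
        simp: less_imp_neq[symmetric])
  have bound: "\<exists>B. \<forall>x\<in>{0..1}. \<bar>s x\<bar> \<le> B" if "continuous_on {0..1} s" for s :: "real \<Rightarrow> real"
    using compact_imp_bounded[OF compact_continuous_image[OF that compact_Icc]] by (simp add: bounded_iff)
  obtain B1 where B1: "\<forall>x\<in>{0..1}. \<bar>s1 x\<bar> \<le> B1" using bound[OF cont(1)] ..
  obtain B2 where B2: "\<forall>x\<in>{0..1}. \<bar>s2 x\<bar> \<le> B2" using bound[OF cont(2)] ..
  show thesis
  proof (rule that[OF d1 d2, of "max 0 (max B1 B2)"])
    fix x
    show "\<bar>s1 x\<bar> \<le> max 0 (max B1 B2)"
      by (cases "x \<in> {0..1}") (use B1 zero(1)[of x] in \<open>auto simp: le_max_iff_disj\<close>)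
    show "\<bar>s2 x\<bar> \<le> max 0 (max B1 B2)"
      by (cases "x \<in> {0..1}") (use B2 zero(2)[of x] in \<open>auto simp: le_max_iff_disj\<close>)
  qed
qed

text \<open>The scaling of functions that vary on length 1/(n + 1): each derivative costs one factor
  n + 1. Only pure second derivatives are recorded, as these are the ones in a Laplacian.\<close>

definition cutoff_seq :: "(nat \<Rightarrow> real ^ 'n::finite \<Rightarrow> real) \<Rightarrow> bool" where
  "cutoff_seq \<eta> \<longleftrightarrow> (\<forall>n. smooth_on UNIV (\<eta> n)) \<and>
     (\<exists>C. \<forall>n x. \<bar>\<eta> n x\<bar> \<le> C \<and>
        (\<forall>j. \<bar>partial_deriv j (\<eta> n) x\<bar> \<le> C * real (Suc n) \<and>
             \<bar>partial_deriv j (partial_deriv j (\<eta> n)) x\<bar> \<le> C * (real (Suc n))\<^sup>2))"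

lemma cutoff_seqI:
  assumes "\<And>n. smooth_on UNIV (\<eta> n)" "\<And>n x. \<bar>\<eta> n x\<bar> \<le> A"
    "\<And>n x j. \<bar>partial_deriv j (\<eta> n) x\<bar> \<le> B * real (Suc n)"
    "\<And>n x j. \<bar>partial_deriv j (partial_deriv j (\<eta> n)) x\<bar> \<le> C * (real (Suc n))\<^sup>2"
  shows "cutoff_seq \<eta>"
  unfolding cutoff_seq_def
proof (intro conjI allI exI[where x = "max A (max B C)"])
  fix n x j
  show "\<bar>\<eta> n x\<bar> \<le> max A (max B C)" using assms(2)[of n x] by simp
  have "B * real (Suc n) \<le> max A (max B C) * real (Suc n)"
    "C * (real (Suc n))\<^sup>2 \<le> max A (max B C) * (real (Suc n))\<^sup>2"
    by (auto intro!: mult_right_mono)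
  then show "\<bar>partial_deriv j (\<eta> n) x\<bar> \<le> max A (max B C) * real (Suc n)"
    "\<bar>partial_deriv j (partial_deriv j (\<eta> n)) x\<bar> \<le> max A (max B C) * (real (Suc n))\<^sup>2"
    using assms(3)[of j n x] assms(4)[of j n x] by linarith+
qed (rule assms)

lemma partial_deriv_mult_fun:
  fixes f g :: "real ^ 'n::finite \<Rightarrow> 'a::real_normed_algebra"
  assumes "smooth_on UNIV f" "smooth_on UNIV g"
  shows "partial_deriv j (\<lambda>x. f x * g x) = (\<lambda>x. f x * partial_deriv j g x + partial_deriv j f x * g x)"
  using assms by (intro ext partial_deriv_mult) (auto intro: smooth_on_differentiable)

lemma partial_deriv2_mult:
  fixes f g :: "real ^ 'n::finite \<Rightarrow> 'a::real_normed_field"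
  assumes "smooth_on UNIV f" "smooth_on UNIV g"
  shows "partial_deriv j (partial_deriv j (\<lambda>x. f x * g x)) x =
    f x * partial_deriv j (partial_deriv j g) x + 2 * (partial_deriv j f x * partial_deriv j g x)
    + partial_deriv j (partial_deriv j f) x * g x"
  using assms
  by (simp add: partial_deriv_mult_fun partial_deriv_add smooth_on_partial smooth_on_mult
      smooth_on_differentiable[where U = UNIV] algebra_simps mult_2[symmetric])

lemma cutoff_seq_mult:
  assumes "cutoff_seq \<eta>" "cutoff_seq \<theta>"
  shows "cutoff_seq (\<lambda>n x. \<eta> n x * \<theta> n x)"
proof -
  obtain A where A: "\<And>n x. \<bar>\<eta> n x\<bar> \<le> A" "\<And>n x j. \<bar>partial_deriv j (\<eta> n) x\<bar> \<le> A * real (Suc n)"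
    "\<And>n x j. \<bar>partial_deriv j (partial_deriv j (\<eta> n)) x\<bar> \<le> A * (real (Suc n))\<^sup>2"
    using assms(1) unfolding cutoff_seq_def by blast
  obtain B where B: "\<And>n x. \<bar>\<theta> n x\<bar> \<le> B" "\<And>n x j. \<bar>partial_deriv j (\<theta> n) x\<bar> \<le> B * real (Suc n)"
    "\<And>n x j. \<bar>partial_deriv j (partial_deriv j (\<theta> n)) x\<bar> \<le> B * (real (Suc n))\<^sup>2"
    using assms(2) unfolding cutoff_seq_def by blast
  have s: "smooth_on UNIV (\<eta> n)" "smooth_on UNIV (\<theta> n)" for n
    using assms unfolding cutoff_seq_def by auto
  have AB: "A \<ge> 0" "B \<ge> 0" using A(1) B(1) abs_ge_zero order_trans by blast+
  show ?thesis
  proof (rule cutoff_seqI)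
    fix n x j
    show "smooth_on UNIV (\<lambda>x. \<eta> n x * \<theta> n x)" using s by (intro smooth_on_mult) auto
    \<comment> \<open>The Leibniz rule yields 1 + 2 + 1 products, each at most A B k^2; hence the
      factor 4.\<close>
    have assoc: "\<bar>a + 2 * b + c\<bar> \<le> 4 * A * B * k\<^sup>2"
      if "\<bar>a\<bar> \<le> A * (B * k\<^sup>2)" "\<bar>b\<bar> \<le> (A * k) * (B * k)" "\<bar>c\<bar> \<le> (A * k\<^sup>2) * B" for a b c k :: real
    proof -
      have "A * (B * k\<^sup>2) = A * B * k\<^sup>2" "(A * k) * (B * k) = A * B * k\<^sup>2" "(A * k\<^sup>2) * B = A * B * k\<^sup>2"
        by (simp_all add: power2_eq_square)
      then show ?thesis using that by linarith
    qed
    show "\<bar>\<eta> n x * \<theta> n x\<bar> \<le> A * B"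
      using A(1) B(1) AB by (simp add: abs_mult mult_mono)
    have "\<bar>\<eta> n x * partial_deriv j (\<theta> n) x\<bar> \<le> A * (B * real (Suc n))"
      "\<bar>partial_deriv j (\<eta> n) x * \<theta> n x\<bar> \<le> (A * real (Suc n)) * B"
      unfolding abs_mult using A B AB by (intro mult_mono; simp)+
    then show "\<bar>partial_deriv j (\<lambda>x. \<eta> n x * \<theta> n x) x\<bar> \<le> (2 * A * B) * real (Suc n)"
      by (simp add: partial_deriv_mult_fun[OF s] algebra_simps)
    have "\<bar>\<eta> n x * partial_deriv j (partial_deriv j (\<theta> n)) x\<bar> \<le> A * (B * (real (Suc n))\<^sup>2)"
      "\<bar>partial_deriv j (\<eta> n) x * partial_deriv j (\<theta> n) x\<bar> \<le> (A * real (Suc n)) * (B * real (Suc n))"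
      "\<bar>partial_deriv j (partial_deriv j (\<eta> n)) x * \<theta> n x\<bar> \<le> (A * (real (Suc n))\<^sup>2) * B"
      unfolding abs_mult using A B AB by (intro mult_mono; simp)+
    then show "\<bar>partial_deriv j (partial_deriv j (\<lambda>x. \<eta> n x * \<theta> n x)) x\<bar> \<le> (4 * A * B) * (real (Suc n))\<^sup>2"
      unfolding partial_deriv2_mult[OF s] by (rule assoc)
  qed
qed

lemma cutoff_seq_one_minus:
  assumes "cutoff_seq \<eta>"
  shows "cutoff_seq (\<lambda>n x. 1 - \<eta> n x)"
proof -
  obtain A where A: "\<And>n x. \<bar>\<eta> n x\<bar> \<le> A" "\<And>n x j. \<bar>partial_deriv j (\<eta> n) x\<bar> \<le> A * real (Suc n)"
    "\<And>n x j. \<bar>partial_deriv j (partial_deriv j (\<eta> n)) x\<bar> \<le> A * (real (Suc n))\<^sup>2"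
    using assms(1) unfolding cutoff_seq_def by blast
  have s: "smooth_on UNIV (\<eta> n)" for n using assms unfolding cutoff_seq_def by auto
  have p: "partial_deriv j (\<lambda>x. 1 - \<eta> n x) = (\<lambda>x. 0 - partial_deriv j (\<eta> n) x)" for n j
    using s by (intro ext) (subst partial_deriv_minus, auto intro: smooth_on_differentiable)
  have q: "partial_deriv j (\<lambda>x. 0 - partial_deriv j (\<eta> n) x) x = - partial_deriv j (partial_deriv j (\<eta> n)) x" for n j x
    using s by (subst partial_deriv_minus) (auto intro: smooth_on_differentiable smooth_on_partial)
  show ?thesis
  proof (rule cutoff_seqI)
    fix n x j
    show "smooth_on UNIV (\<lambda>x. 1 - \<eta> n x)" using s by (intro smooth_on_diff) auto
    show "\<bar>1 - \<eta> n x\<bar> \<le> 1 + A" using A(1)[of n x] by linarith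
    show "\<bar>partial_deriv j (\<lambda>x. 1 - \<eta> n x) x\<bar> \<le> A * real (Suc n)"
      using A(2) by (simp add: p)
    show "\<bar>partial_deriv j (partial_deriv j (\<lambda>x. 1 - \<eta> n x)) x\<bar> \<le> A * (real (Suc n))\<^sup>2"
      using A(3) by (simp only: p q abs_minus_cancel)
  qed
qed

text \<open>The chain rule turns the slope \<open>c * real (Suc n)\<close> into one factor n + 1 per
  derivative, and \<open>\<bar>c\<bar> \<le> 1\<close> leaves the bounds of \<open>step\<close> as
  constants.\<close>

lemma cutoff_seq_step:
  fixes b c p :: real and i :: "'n::finite"
  assumes "\<bar>c\<bar> \<le> 1"
  shows "cutoff_seq (\<lambda>n x :: real ^ 'n. step (b + c * real (Suc n) * (x $ i - p)))"
proof -
  obtain s1 s2 :: "real \<Rightarrow> real" and B where s: "\<And>x. (step has_real_derivative s1 x) (at x)"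
    "\<And>x. (s1 has_real_derivative s2 x) (at x)"
    "\<And>x. \<bar>s1 x\<bar> \<le> B" "\<And>x. \<bar>s2 x\<bar> \<le> B" using step_derivatives by blast
  have B: "0 \<le> B" using s(3)[of 0] by linarith
  define l where "l n x = b + c * real (Suc n) * (x $ i - p)" for n and x :: "real ^ 'n"
  define a where "a n j = (if i = j then c * real (Suc n) else 0)" for n j
  have l: "smooth_on UNIV (l n)" for n
    unfolding l_def[abs_def] by (intro smooth_on_add smooth_on_mult smooth_on_diff smooth_on_component smooth_on_const) auto
  have dl: "partial_deriv j (l n) x = a n j" for j n x
    unfolding l_def[abs_def] a_def
    by (rule trans[OF partial_deriv_eqI[of _ "\<lambda>h. c * real (Suc n) * h $ i"]])
       (auto intro!: derivative_eq_intros bounded_linear_imp_has_derivative bounded_linear_vec_nth simp: axis_def)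
  have diff: "l n differentiable (at x)" for n x using smooth_on_differentiable[OF l] by simp
  have d1: "partial_deriv j (\<lambda>x. step (l n x)) = (\<lambda>x. s1 (l n x) * a n j)" for j n
    using partial_deriv_comp_real(1)[OF diff s(1)] dl by auto
  have d2: "partial_deriv j (\<lambda>x. s1 (l n x) * a n j) x = s2 (l n x) * a n j * a n j" for j n x
    using partial_deriv_comp_real[OF diff s(2)] dl by (subst partial_deriv_mult) auto
  have a: "\<bar>a n j\<bar> \<le> real (Suc n)" for n j
    using assms mult_right_mono[of "\<bar>c\<bar>" 1 "real (Suc n)"] by (simp add: a_def abs_mult)
  have "cutoff_seq (\<lambda>n x. step (l n x))"
  proof (rule cutoff_seqI)
    fix n x j
    show "smooth_on UNIV (\<lambda>x. step (l n x))" by (intro smooth_on_step l) simp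
    show "\<bar>step (l n x)\<bar> \<le> 1" using step_bounds by simp
    show "\<bar>partial_deriv j (\<lambda>x. step (l n x)) x\<bar> \<le> B * real (Suc n)"
      unfolding d1 abs_mult using s(3) a B by (intro mult_mono) auto
    have "\<bar>s2 (l n x)\<bar> * \<bar>a n j\<bar> * \<bar>a n j\<bar> \<le> B * real (Suc n) * real (Suc n)"
      using s(4) a B by (intro mult_mono) auto
    then show "\<bar>partial_deriv j (partial_deriv j (\<lambda>x. step (l n x))) x\<bar> \<le> B * (real (Suc n))\<^sup>2"
      unfolding d1 d2 abs_mult power2_eq_square by (simp add: mult.assoc)
  qed
  then show ?thesis by (simp add: l_def)
qed

text \<open>A Lipschitz function vanishing on \<open>N\<close> is \<open>O(1/n)\<close> on the support of \<open>\<eta> n\<close>; this compensates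
  the growth of the derivatives of \<open>\<eta> n\<close>.\<close>

definition cutoffs_near :: "(real ^ 2) set \<Rightarrow> (nat \<Rightarrow> real ^ 2 \<Rightarrow> real) \<Rightarrow> bool" where
  "cutoffs_near N \<eta> \<longleftrightarrow> cutoff_seq \<eta> \<and>
     (\<forall>n. \<exists>V. open V \<and> N \<subseteq> V \<and> (\<forall>x\<in>V. \<eta> n x = 1)) \<and>
     (\<exists>C. \<forall>n x. \<eta> n x \<noteq> 0 \<longrightarrow> (\<exists>y\<in>N. norm (x - y) \<le> C / real (Suc n))) \<and>
     (\<forall>x. x $ 2 \<noteq> 0 \<longrightarrow> (\<forall>\<^sub>F n in sequentially. \<eta> n x = 0)) \<and>
     (\<forall>n x. \<eta> n (\<sigma> x) = \<eta> n x)"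

section \<open>Cutoffs around the segment and around the outer axis\<close>

lemma \<sigma>_components [simp]: "\<sigma> x $ 1 = x $ 1" "\<sigma> x $ 2 = - (x $ 2)"
  by (simp_all add: \<sigma>_def)

text \<open>It is 1 for (n + 1) |x2| \<le> 1 and 0 for (n + 1) |x2| \<ge> 2. The explicit factors
  \<open>(-1)\<close>, \<open>1\<close> and the shift by \<open>0\<close> match the shape required
  by \<open>cutoff_seq_step\<close>.\<close>

definition axis_cutoff :: "nat \<Rightarrow> real ^ 2 \<Rightarrow> real" where
  "axis_cutoff n x = step (2 + (-1) * real (Suc n) * (x $ 2 - 0)) * step (2 + 1 * real (Suc n) * (x $ 2 - 0))"

lemma cutoff_seq_axis_cutoff: "cutoff_seq axis_cutoff"
  unfolding axis_cutoff_def[abs_def] by (intro cutoff_seq_mult cutoff_seq_step) auto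

lemma axis_cutoff_alt:
  "axis_cutoff n x = step (2 - real (Suc n) * x $ 2) * step (2 + real (Suc n) * x $ 2)"
  by (simp add: axis_cutoff_def del: of_nat_Suc)

lemma axis_cutoff_eq_1: "real (Suc n) * \<bar>x $ 2\<bar> \<le> 1 \<Longrightarrow> axis_cutoff n x = 1"
proof -
  assume "real (Suc n) * \<bar>x $ 2\<bar> \<le> 1"
  then have "\<bar>real (Suc n) * x $ 2\<bar> \<le> 1" by (simp add: abs_mult)
  then have "2 - real (Suc n) * x $ 2 \<ge> 1" "2 + real (Suc n) * x $ 2 \<ge> 1" by linarith+
  then show ?thesis unfolding axis_cutoff_alt by (simp only: step_eq_1 mult_1)
qed

lemma axis_cutoff_nonzero: "axis_cutoff n x \<noteq> 0 \<Longrightarrow> \<bar>x $ 2\<bar> \<le> 2 / real (Suc n)"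
proof (rule ccontr)
  assume n: "axis_cutoff n x \<noteq> 0" and "\<not> \<bar>x $ 2\<bar> \<le> 2 / real (Suc n)"
  then have "2 < \<bar>real (Suc n) * x $ 2\<bar>" by (simp add: abs_mult field_simps)
  then have "2 - real (Suc n) * x $ 2 \<le> 0 \<or> 2 + real (Suc n) * x $ 2 \<le> 0" by linarith
  then show False using n step_eq_0 unfolding axis_cutoff_alt by auto
qed

lemma axis_cutoff_sym: "axis_cutoff n (\<sigma> x) = axis_cutoff n x"
  by (simp add: axis_cutoff_alt mult.commute del: of_nat_Suc)

text \<open>\<open>axis_cutoff\<close> already localises to a strip around the axis, which gives the
  eventual vanishing off the axis; only a profile along the first coordinate remains to be supplied.
  The distances along and across the axis add up to at most 4/(n + 1).\<close>

lemma cutoffs_near_axisI: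
  assumes "cutoff_seq \<theta>" "\<And>n x. \<theta> n (\<sigma> x) = \<theta> n x"
    "\<And>n. \<exists>V. open V \<and> N \<subseteq> V \<and> (\<forall>x\<in>V. \<theta> n x = 1)" "N \<subseteq> axis_line"
    "\<And>n x. \<theta> n x \<noteq> 0 \<Longrightarrow> \<exists>y\<in>N. \<bar>x $ 1 - y $ 1\<bar> \<le> 2 / real (Suc n)"
  shows "\<exists>\<eta>. cutoffs_near N \<eta>"
proof (intro exI[where x = "\<lambda>n x. axis_cutoff n x * \<theta> n x"])
  have "\<exists>V. open V \<and> N \<subseteq> V \<and> (\<forall>x\<in>V. axis_cutoff n x * \<theta> n x = 1)" for n
  proof -
    obtain V where V: "open V" "N \<subseteq> V" "\<forall>x\<in>V. \<theta> n x = 1" using assms(3)[of n] by auto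
    have "open {x :: real ^ 2. real (Suc n) * \<bar>x $ 2\<bar> < 1}"
      by (intro open_Collect_less continuous_intros)
    moreover have "N \<subseteq> {x. real (Suc n) * \<bar>x $ 2\<bar> < 1}" using assms(4) by (auto simp: axis_line_def)
    ultimately show ?thesis using V
      by (intro exI[where x = "V \<inter> {x. real (Suc n) * \<bar>x $ 2\<bar> < 1}"])
         (auto simp: axis_cutoff_eq_1 simp del: of_nat_Suc)
  qed
  moreover have "\<exists>y\<in>N. norm (x - y) \<le> 4 / real (Suc n)" if nz: "axis_cutoff n x * \<theta> n x \<noteq> 0" for n x
  proof -
    have a: "\<bar>x $ 2\<bar> \<le> 2 / real (Suc n)" using nz axis_cutoff_nonzero by auto
    obtain y where y: "y \<in> N" "\<bar>x $ 1 - y $ 1\<bar> \<le> 2 / real (Suc n)" using nz assms(5)[of n x] by auto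
    have "y $ 2 = 0" using y(1) assms(4) by (auto simp: axis_line_def)
    then have "norm (x - y) \<le> \<bar>x $ 1 - y $ 1\<bar> + \<bar>x $ 2\<bar>"
      using norm_le_l1_cart[of "x - y"] by (simp add: sum_2)
    then show ?thesis using a y by (intro bexI[where x = y]) auto
  qed
  moreover have "\<forall>\<^sub>F n in sequentially. axis_cutoff n x * \<theta> n x = 0" if "x $ 2 \<noteq> 0" for x
  proof -
    obtain M :: nat where M: "real M > 2 / \<bar>x $ 2\<bar>" using reals_Archimedean2 by blast
    have "axis_cutoff n x = 0" if "n \<ge> M" for n
    proof (rule ccontr)
      assume "axis_cutoff n x \<noteq> 0"
      then have "\<bar>x $ 2\<bar> * real (Suc n) \<le> 2" using axis_cutoff_nonzero[of n x] by (simp add: field_simps)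
      moreover have "2 < \<bar>x $ 2\<bar> * real M" using M \<open>x $ 2 \<noteq> 0\<close> by (simp add: field_simps)
      moreover have "\<bar>x $ 2\<bar> * real M \<le> \<bar>x $ 2\<bar> * real (Suc n)" using that by (intro mult_left_mono) auto
      ultimately show False by linarith
    qed
    then show ?thesis unfolding eventually_sequentially by auto
  qed
  ultimately show "cutoffs_near N (\<lambda>n x. axis_cutoff n x * \<theta> n x)"
    unfolding cutoffs_near_def
    using cutoff_seq_mult[OF cutoff_seq_axis_cutoff assms(1)] assms(2) axis_cutoff_sym by auto
qed

text \<open>The closed version of \<open>axis_line - segment_between am ap\<close>: it contains the
  poles, so its complement is open.\<close>

definition outer_axis :: "real \<Rightarrow> real \<Rightarrow> (real ^ 2) set" where
  "outer_axis am ap = {x. x $ 2 = 0 \<and> (x $ 1 \<le> am \<or> ap \<le> x $ 1)}"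

lemma exists_cutoffs_near_segment:
  assumes "am \<le> ap"
  shows "\<exists>\<eta>. cutoffs_near (segment_between am ap) \<eta>"
proof (rule cutoffs_near_axisI)
  \<comment> \<open>Each factor is 1 up to distance 1/(n + 1) beyond its endpoint and 0 from
    distance 2/(n + 1) on.\<close>
  let ?\<theta> = "\<lambda>n (x :: real ^ 2). step (2 + 1 * real (Suc n) * (x $ 1 - am)) * step (2 + (-1) * real (Suc n) * (x $ 1 - ap))"
  show "cutoff_seq ?\<theta>" by (intro cutoff_seq_mult cutoff_seq_step) auto
  show "?\<theta> n (\<sigma> x) = ?\<theta> n x" for n x by simp
  show "segment_between am ap \<subseteq> axis_line" by (auto simp: segment_between_def axis_line_def)
  show "\<exists>V. open V \<and> segment_between am ap \<subseteq> V \<and> (\<forall>x\<in>V. ?\<theta> n x = 1)" for n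
  proof (intro exI[where x = "{x. - 1 < real (Suc n) * (x $ 1 - am)} \<inter> {x. real (Suc n) * (x $ 1 - ap) < 1}"] conjI ballI)
    show "open ({x. - 1 < real (Suc n) * (x $ 1 - am)} \<inter> {x :: real ^ 2. real (Suc n) * (x $ 1 - ap) < 1})"
      by (intro open_Int open_Collect_less continuous_intros)
    show "segment_between am ap \<subseteq> {x. - 1 < real (Suc n) * (x $ 1 - am)} \<inter> {x. real (Suc n) * (x $ 1 - ap) < 1}"
    proof (intro subsetI IntI CollectI)
      fix x assume x: "x \<in> segment_between am ap"
      have "0 \<le> real (Suc n) * (x $ 1 - am)" "real (Suc n) * (x $ 1 - ap) \<le> 0"
        using x by (auto simp: segment_between_def mult_nonneg_nonpos)
      then show "- 1 < real (Suc n) * (x $ 1 - am)" "real (Suc n) * (x $ 1 - ap) < 1" by linarith+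
    qed
    fix x :: "real ^ 2" assume "x \<in> {x. - 1 < real (Suc n) * (x $ 1 - am)} \<inter> {x. real (Suc n) * (x $ 1 - ap) < 1}"
    then have "1 \<le> 2 + 1 * real (Suc n) * (x $ 1 - am)" "1 \<le> 2 + (-1) * real (Suc n) * (x $ 1 - ap)"
      by (simp_all del: of_nat_Suc)
    then show "?\<theta> n x = 1" by (simp only: step_eq_1 mult_1)
  qed
  show "\<exists>y\<in>segment_between am ap. \<bar>x $ 1 - y $ 1\<bar> \<le> 2 / real (Suc n)" if nz: "?\<theta> n x \<noteq> 0" for n and x :: "real ^ 2"
  proof -
    have "0 < 2 + 1 * real (Suc n) * (x $ 1 - am)" "0 < 2 + (-1) * real (Suc n) * (x $ 1 - ap)"
      using nz step_eq_0[of "2 + 1 * real (Suc n) * (x $ 1 - am)"] step_eq_0[of "2 + (-1) * real (Suc n) * (x $ 1 - ap)"]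
      by (auto simp: not_le[symmetric] simp del: of_nat_Suc)
    then have "am - x $ 1 \<le> 2 / real (Suc n)" "x $ 1 - ap \<le> 2 / real (Suc n)"
      by (auto simp: field_simps)
    moreover have "0 \<le> 2 / real (Suc n)" by simp
    ultimately show ?thesis using assms
      \<comment> \<open>The nearest point of the segment, obtained by clamping the first coordinate
        to [am, ap].\<close>
      by (intro bexI[where x = "vector [max am (min ap (x $ 1)), 0]"]) (auto simp: segment_between_def min_def max_def simp del: of_nat_Suc)
  qed
qed

lemma exists_cutoffs_near_outer_axis: "\<exists>\<eta>. cutoffs_near (outer_axis am ap) \<eta>"
proof (rule cutoffs_near_axisI)
  \<comment> \<open>One minus a cutoff living strictly between the poles: the transition takes place
    at distances between 1/(n + 1) and 2/(n + 1) inside a pole.\<close>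
  let ?\<theta> = "\<lambda>n (x :: real ^ 2). 1 - step (-1 + 1 * real (Suc n) * (x $ 1 - am)) * step (-1 + (-1) * real (Suc n) * (x $ 1 - ap))"
  show "cutoff_seq ?\<theta>" by (intro cutoff_seq_mult cutoff_seq_step cutoff_seq_one_minus) auto
  show "?\<theta> n (\<sigma> x) = ?\<theta> n x" for n x by simp
  show "outer_axis am ap \<subseteq> axis_line" by (auto simp: outer_axis_def axis_line_def)
  show "\<exists>V. open V \<and> outer_axis am ap \<subseteq> V \<and> (\<forall>x\<in>V. ?\<theta> n x = 1)" for n
  proof (intro exI[where x = "{x. real (Suc n) * (x $ 1 - am) < 1} \<union> {x. - 1 < real (Suc n) * (x $ 1 - ap)}"] conjI ballI)
    show "open ({x. real (Suc n) * (x $ 1 - am) < 1} \<union> {x :: real ^ 2. - 1 < real (Suc n) * (x $ 1 - ap)})"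
      by (intro open_Un open_Collect_less continuous_intros)
    show "outer_axis am ap \<subseteq> {x. real (Suc n) * (x $ 1 - am) < 1} \<union> {x. - 1 < real (Suc n) * (x $ 1 - ap)}"
    proof
      fix x assume x: "x \<in> outer_axis am ap"
      have "real (Suc n) * (x $ 1 - am) \<le> 0 \<or> 0 \<le> real (Suc n) * (x $ 1 - ap)"
        using x by (auto simp: outer_axis_def intro: mult_nonneg_nonpos)
      then show "x \<in> {x. real (Suc n) * (x $ 1 - am) < 1} \<union> {x. - 1 < real (Suc n) * (x $ 1 - ap)}"
        by auto
    qed
    fix x :: "real ^ 2" assume "x \<in> {x. real (Suc n) * (x $ 1 - am) < 1} \<union> {x. - 1 < real (Suc n) * (x $ 1 - ap)}"
    then have "-1 + 1 * real (Suc n) * (x $ 1 - am) \<le> 0 \<or> -1 + (-1) * real (Suc n) * (x $ 1 - ap) \<le> 0"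
      by (auto simp del: of_nat_Suc)
    then show "?\<theta> n x = 1" using step_eq_0 by auto
  qed
  show "\<exists>y\<in>outer_axis am ap. \<bar>x $ 1 - y $ 1\<bar> \<le> 2 / real (Suc n)" if nz: "?\<theta> n x \<noteq> 0" for n and x :: "real ^ 2"
  proof -
    have "-1 + 1 * real (Suc n) * (x $ 1 - am) < 1 \<or> -1 + (-1) * real (Suc n) * (x $ 1 - ap) < 1"
      using nz step_eq_1[of "-1 + 1 * real (Suc n) * (x $ 1 - am)"] step_eq_1[of "-1 + (-1) * real (Suc n) * (x $ 1 - ap)"]
      by (auto simp: not_le[symmetric] simp del: of_nat_Suc)
    then consider "x $ 1 - am \<le> 2 / real (Suc n)" | "ap - x $ 1 \<le> 2 / real (Suc n)"
      by (auto simp: field_simps)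
    then show ?thesis
    proof cases
      case 1
      moreover have "0 \<le> 2 / real (Suc n)" by simp
      ultimately show ?thesis
        by (intro bexI[where x = "vector [min am (x $ 1), 0]"]) (auto simp: outer_axis_def min_def max_def)
    next
      case 2
      moreover have "0 \<le> 2 / real (Suc n)" by simp
      ultimately show ?thesis
        by (intro bexI[where x = "vector [max ap (x $ 1), 0]"]) (auto simp: outer_axis_def min_def max_def)
    qed
  qed
qed

section \<open>Test functions\<close>

lemma test_functionsD:
  assumes "f \<in> test_functions U"
  shows "smooth_on UNIV f" "compact (closure {x. f x \<noteq> 0})" "closure {x. f x \<noteq> 0} \<subseteq> U"
    "\<And>x. x \<notin> U \<Longrightarrow> f x = 0"
  using assms closure_subset[of "{x. f x \<noteq> 0}"] by (auto simp: test_functions_def smooth_iff)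

lemma test_functionsI:
  assumes "smooth_on UNIV f" "compact K" "{x. f x \<noteq> 0} \<subseteq> K" "K \<subseteq> U"
  shows "f \<in> test_functions U"
proof -
  have "closure {x. f x \<noteq> 0} \<subseteq> K"
    using assms(2,3) by (simp add: closure_minimal compact_imp_closed)
  then show ?thesis
    using assms compact_closure bounded_subset[OF compact_imp_bounded[OF assms(2)]]
    unfolding test_functions_def by (auto simp: smooth_iff)
qed

lemma test_functions_mono: "U \<subseteq> V \<Longrightarrow> f \<in> test_functions U \<Longrightarrow> f \<in> test_functions V"
  by (auto simp: test_functions_def)

lemma test_functions_zero: "(\<lambda>x. 0) \<in> test_functions U"
  by (rule test_functionsI[where K = "{}"]) auto

lemma test_functions_add:
  assumes "f \<in> test_functions U" "g \<in> test_functions U"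
  shows "(\<lambda>x. f x + g x) \<in> test_functions U"
proof (rule test_functionsI)
  show "compact (closure {x. f x \<noteq> 0} \<union> closure {x. g x \<noteq> 0})"
    by (intro compact_Un test_functionsD(2)[OF assms(1)] test_functionsD(2)[OF assms(2)])
  show "{x. f x + g x \<noteq> 0} \<subseteq> closure {x. f x \<noteq> 0} \<union> closure {x. g x \<noteq> 0}"
    using closure_subset[of "{x. f x \<noteq> 0}"] closure_subset[of "{x. g x \<noteq> 0}"] by force
  show "smooth_on UNIV (\<lambda>x. f x + g x)" using assms by (intro smooth_on_add) (simp_all add: test_functionsD(1,2))
  show "closure {x. f x \<noteq> 0} \<union> closure {x. g x \<noteq> 0} \<subseteq> U" using assms by (auto dest!: test_functionsD(3))
qed

lemma test_functions_bounded_linear: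
  assumes "bounded_linear L" "f \<in> test_functions U"
  shows "(\<lambda>x. L (f x)) \<in> test_functions U"
proof (rule test_functionsI)
  show "{x. L (f x) \<noteq> 0} \<subseteq> closure {x. f x \<noteq> 0}"
    using closure_subset[of "{x. f x \<noteq> 0}"] linear_0[OF bounded_linear.linear[OF assms(1)]] by force
qed (use test_functionsD[OF assms(2)] smooth_on_bounded_linear[OF assms(1) open_UNIV] in blast)+

lemma test_functions_cmult:
  fixes f :: "real ^ 'n::finite \<Rightarrow> 'a::real_normed_algebra"
  shows "f \<in> test_functions U \<Longrightarrow> (\<lambda>x. c * f x) \<in> test_functions U"
  by (rule test_functions_bounded_linear[OF bounded_linear_mult_right])

lemma test_functions_diff:
  assumes "f \<in> test_functions U" "g \<in> test_functions U"
  shows "(\<lambda>x. f x - g x) \<in> test_functions U"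
  using test_functions_add[OF assms(1) test_functions_bounded_linear[OF bounded_linear_minus[OF bounded_linear_ident] assms(2)]]
  by simp

lemma zero_outside_support: "x \<notin> closure {x. f x \<noteq> 0} \<Longrightarrow> f x = 0"
  using closure_subset[of "{x. f x \<noteq> 0}"] by auto

lemma partial_deriv_outside_support:
  assumes "x \<notin> closure {x. f x \<noteq> 0}"
  shows "partial_deriv j f x = 0"
proof -
  have "partial_deriv j f x = partial_deriv j (\<lambda>x. 0) x"
    using closure_subset[of "{x. f x \<noteq> 0}"] assms
    by (intro partial_deriv_cong_open[where U = "- closure {x. f x \<noteq> 0}"]) auto
  then show ?thesis by simp
qed

lemma test_functions_partial:
  assumes "f \<in> test_functions U"
  shows "partial_deriv j f \<in> test_functions U"
proof (rule test_functionsI[where K = "closure {x. f x \<noteq> 0}"])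
  show "smooth_on UNIV (partial_deriv j f)" by (rule smooth_on_partial[OF test_functionsD(1)[OF assms]])
  show "{x. partial_deriv j f x \<noteq> 0} \<subseteq> closure {x. f x \<noteq> 0}"
    using partial_deriv_outside_support by blast
qed (rule test_functionsD[OF assms])+

text \<open>The product is smooth on \<open>V\<close> and zero off the support of \<open>f\<close>,
  and these two open sets cover the space. Hence \<open>g\<close> may be singular outside
  \<open>V\<close>, as the potential is at the poles and a gauge factor on its cut.\<close>

lemma test_functions_mult:
  fixes f g :: "real ^ 'n::finite \<Rightarrow> 'a::real_normed_algebra"
  assumes "f \<in> test_functions U" "open V" "U \<subseteq> V" "smooth_on V g"
  shows "(\<lambda>x. g x * f x) \<in> test_functions U"
proof (rule test_functionsI)
  let ?K = "closure {x. f x \<noteq> 0}"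
  have "smooth_on V (\<lambda>x. g x * f x)"
    using assms by (intro smooth_on_mult smooth_on_subset[OF test_functionsD(1)[OF assms(1)]]) auto
  moreover have "0 = g x * f x" if "x \<in> - ?K" for x
    using that zero_outside_support[of x f] by simp
  then have "smooth_on (- ?K) (\<lambda>x. g x * f x)"
    by (rule smooth_on_cong[OF _ _ smooth_on_const[of _ 0], rotated]) auto
  moreover have "V \<union> - ?K = UNIV" using test_functionsD(3)[OF assms(1)] assms(3) by blast
  ultimately show "smooth_on UNIV (\<lambda>x. g x * f x)" using smooth_on_Un by metis
  show "{x. g x * f x \<noteq> 0} \<subseteq> ?K" using closure_subset[of "{x. f x \<noteq> 0}"] by force
qed (rule test_functionsD[OF assms(1)])+

text \<open>The difference vanishes where \<open>g\<close> is 1, so its support loses the whole open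
  set \<open>V\<close> and stays compact.\<close>

lemma test_functions_cut_off:
  fixes v :: "real ^ 'n::finite \<Rightarrow> 'a::real_normed_algebra_1"
  assumes "v \<in> test_functions U" "smooth_on UNIV g" "open V" "\<And>x. x \<in> V \<Longrightarrow> g x = 1"
  shows "(\<lambda>x. v x - g x * v x) \<in> test_functions (U - V)"
proof (rule test_functionsI[where K = "closure {x. v x \<noteq> 0} - V"])
  show "smooth_on UNIV (\<lambda>x. v x - g x * v x)"
    using test_functionsD(1)[OF assms(1)] assms(2) by (intro smooth_on_diff smooth_on_mult) auto
  show "compact (closure {x. v x \<noteq> 0} - V)"
    using test_functionsD(2)[OF assms(1)] assms(3) by (rule compact_diff)
  show "{x. v x - g x * v x \<noteq> 0} \<subseteq> closure {x. v x \<noteq> 0} - V"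
    using closure_subset[of "{x. v x \<noteq> 0}"] assms(4) by force
qed (use assms in \<open>auto dest!: test_functionsD(3)\<close>)

lemma test_functions_continuous: "f \<in> test_functions U \<Longrightarrow> continuous_on S f"
  using smooth_on_continuous[OF test_functionsD(1)] continuous_on_subset by blast

lemma test_functions_bounded:
  assumes "f \<in> test_functions U"
  obtains C where "0 < C" "\<And>x. norm (f x) \<le> C"
proof -
  obtain B where B: "\<forall>x\<in>closure {x. f x \<noteq> 0}. norm (f x) \<le> B"
    using compact_imp_bounded[OF compact_continuous_image[OF test_functions_continuous[OF assms] test_functionsD(2)[OF assms]]]
    unfolding bounded_iff by auto
  have "norm (f x) \<le> max 1 B" for x
    using B closure_subset[of "{x. f x \<noteq> 0}"] by (cases "f x = 0") (auto simp: le_max_iff_disj)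
  then show thesis using that[of "max 1 B"] by simp
qed

text \<open>Partial derivatives of a test function are test functions, hence bounded, and the mean
  value inequality holds on the whole space. The constant later measures how fast a function grows
  away from its zero set.\<close>

lemma test_functions_Lipschitz:
  assumes "f \<in> test_functions U"
  obtains C where "0 < C" "\<And>x y. norm (f x - f y) \<le> C * norm (x - y)"
proof -
  have "\<forall>j. \<exists>C. 0 < C \<and> (\<forall>x. norm (partial_deriv j f x) \<le> C)"
    using test_functions_bounded[OF test_functions_partial[OF assms]] by metis
  then obtain C where C: "\<And>j. 0 < C j" "\<And>j x. norm (partial_deriv j f x) \<le> C j" by metis
  have "norm (f x - f y) \<le> (\<Sum>j\<in>UNIV. C j) * norm (x - y)" for x y
  proof (rule differentiable_bound[where S = UNIV and f' = "\<lambda>x. frechet_derivative f (at x)"])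
    fix x
    have d: "(f has_derivative frechet_derivative f (at x)) (at x)"
      by (rule differentiable_has_frechet[OF smooth_on_differentiable[OF test_functionsD(1)[OF assms]]]) simp
    then show "(f has_derivative frechet_derivative f (at x)) (at x within UNIV)" by simp
    show "onorm (frechet_derivative f (at x)) \<le> (\<Sum>j\<in>UNIV. C j)"
    proof (rule onorm_le)
      fix h :: "real ^ 'a"
      have "h = (\<Sum>j\<in>UNIV. (h $ j) *\<^sub>R axis j 1)" by (simp add: vec_eq_iff sum_component axis_def if_distrib sum.delta cong: if_cong)
      then have "frechet_derivative f (at x) h = frechet_derivative f (at x) (\<Sum>j\<in>UNIV. (h $ j) *\<^sub>R axis j 1)" by simp
      also have "\<dots> = (\<Sum>j\<in>UNIV. (h $ j) *\<^sub>R partial_deriv j f x)"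
        using has_derivative_linear[OF d] by (simp add: linear_sum linear_cmul partial_deriv_def)
      also have "norm \<dots> \<le> (\<Sum>j\<in>UNIV. C j * norm h)"
        by (rule sum_norm_le) (simp add: mult.commute[of "C _"] mult_mono C(2) component_le_norm_cart)
      finally show "norm (frechet_derivative f (at x) h) \<le> (\<Sum>j\<in>UNIV. C j) * norm h"
        by (simp add: sum_distrib_right)
    qed
  qed auto
  moreover have "0 < (\<Sum>j\<in>UNIV. C j)" using C(1) by (intro sum_pos) auto
  ultimately show thesis using that by blast
qed

section \<open>Integrals of derivatives of test functions\<close>

lemma integral_lebesgue_on_eq_lborel:
  fixes f :: "real ^ 'n::finite \<Rightarrow> 'b::{banach, second_countable_topology}"
  assumes "S \<in> sets lebesgue" "continuous_on UNIV f" "\<And>x. x \<notin> S \<Longrightarrow> f x = 0"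
  shows "(LINT x|lebesgue_on S. f x) = (LINT x|lborel. f x)"
proof -
  have "(LINT x|lebesgue_on S. f x) = (LINT x|lebesgue. indicator S x *\<^sub>R f x)"
    using assms(1) by (simp add: integral_restrict_space)
  also have "(\<lambda>x. indicator S x *\<^sub>R f x) = f" using assms(3) by (auto simp: fun_eq_iff indicator_def)
  also have "(LINT x|lebesgue. f x) = (LINT x|lborel. f x)"
    using assms(2) by (intro integral_completion) (simp add: borel_measurable_continuous_onI)
  finally show ?thesis .
qed

text \<open>Difference quotients integrate to 0 by translation invariance. They are dominated by the
  Lipschitz constant on a fixed ball, so their limit integrates to 0 as well.\<close>

lemma integral_partial_deriv_test_function:
  fixes f :: "real ^ 'n::finite \<Rightarrow> 'b::{banach, second_countable_topology}"
  assumes "f \<in> test_functions \<Omega>" "\<Omega> \<in> sets lebesgue"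
  shows "(LINT x|lebesgue_on \<Omega>. partial_deriv j f x) = 0"
proof -
  obtain C where C: "0 < C" "\<And>x y. norm (f x - f y) \<le> C * norm (x - y)"
    using test_functions_Lipschitz[OF assms(1)] by blast
  obtain R where R: "\<And>x. f x \<noteq> 0 \<Longrightarrow> norm x \<le> R"
    using compact_imp_bounded[OF test_functionsD(2)[OF assms(1)]] closure_subset[of "{x. f x \<noteq> 0}"]
    unfolding bounded_iff by blast
  have cont: "continuous_on UNIV f" by (rule test_functions_continuous[OF assms(1)])
  then have meas: "f \<in> borel_measurable borel" by (rule borel_measurable_continuous_onI)
  define e where "e n = (1 / real (Suc n)) *\<^sub>R axis j (1 :: real)" for n
  have ne: "norm (e n) = 1 / real (Suc n)" for n by (simp add: e_def)
  define F where "F n x = real (Suc n) *\<^sub>R (f (e n + x) - f x)" for n x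
  have mF: "F n \<in> borel_measurable lborel" for n
    unfolding F_def[abs_def] using meas by measurable
  \<comment> \<open>The shift has length at most 1, so outside radius \<open>R + 1\<close> both
    values of \<open>f\<close> are 0.\<close>
  have bound: "norm (F n x) \<le> C * indicator (cball 0 (R + 1)) x" for n x
  proof (cases "norm x \<le> R + 1")
    case True
    have "norm (F n x) \<le> real (Suc n) * (C * norm (e n))"
      using C(2)[of "e n + x" x] by (simp add: F_def del: of_nat_Suc)
    then show ?thesis using True ne[of n] by (simp add: indicator_def del: of_nat_Suc)
  next
    case False
    have "norm (e n + x) > R" using norm_triangle_ineq2[of x "- e n"] False ne[of n]
      by (simp add: add.commute) (smt (verit) divide_le_eq_1 of_nat_0_le_iff)
    then have "f (e n + x) = 0" "f x = 0" using R[of "e n + x"] R[of x] False by auto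
    then show ?thesis by (simp add: F_def False indicator_def)
  qed
  have intf: "integrable lborel f"
  proof (rule Bochner_Integration.integrable_bound[where f = "\<lambda>x. (norm (f 0) + C * R) * indicator (cball 0 R) x"])
    show "integrable lborel (\<lambda>x :: real ^ 'n. (norm (f 0) + C * R) * indicator (cball 0 R) x)"
      using emeasure_lborel_cball_finite by (intro integrable_mult_right integrable_real_indicator) auto
    show "AE x in lborel. norm (f x) \<le> norm ((norm (f 0) + C * R) * indicator (cball 0 R) x)"
    proof (rule AE_I2)
      fix x
      show "norm (f x) \<le> norm ((norm (f 0) + C * R) * indicator (cball 0 R) x)"
      proof (cases "f x = 0")
        case False
        then have "norm x \<le> R" using R by auto
        moreover have "norm (f x) \<le> norm (f 0) + C * norm x" using C(2)[of x 0] norm_triangle_ineq2[of "f x" "f 0"] by simp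
        moreover have "C * norm x \<le> C * R" using \<open>norm x \<le> R\<close> C(1) by simp
        ultimately show ?thesis by (simp add: indicator_def)
      qed simp
    qed
  qed (use meas in simp)
  have shift: "(LINT x|lborel. f (c + x)) = (LINT x|lborel. f x)" "integrable lborel (\<lambda>x. f (c + x))" for c
  proof -
    have "(LINT x|lborel. f x) = (LINT x|distr lborel borel ((+) c). f x)" by (simp add: lborel_distr_plus)
    also have "\<dots> = (LINT x|lborel. f (c + x))" using meas by (intro integral_distr) auto
    finally show "(LINT x|lborel. f (c + x)) = (LINT x|lborel. f x)" by simp
    have "integrable (distr lborel borel ((+) c)) f" using intf by (simp add: lborel_distr_plus)
    then show "integrable lborel (\<lambda>x. f (c + x))" using meas by (simp add: integrable_distr_eq)
  qed
  have zero: "(LINT x|lborel. F n x) = 0" for n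
    unfolding F_def using shift[of "e n"] intf by (simp add: Bochner_Integration.integral_diff)
  have lim: "(\<lambda>n. F n x) \<longlonglongrightarrow> partial_deriv j f x" for x
  proof -
    have d: "(f has_derivative frechet_derivative f (at x)) (at x)"
      by (rule differentiable_has_frechet[OF smooth_on_differentiable[OF test_functionsD(1)[OF assms(1)]]]) simp
    have "e \<longlonglongrightarrow> 0 *\<^sub>R axis j 1"
      unfolding e_def by (intro tendsto_scaleR tendsto_const LIMSEQ_Suc[OF lim_1_over_n])
    then have "(\<lambda>n. e n + x) \<longlonglongrightarrow> 0 *\<^sub>R axis j 1 + x" by (intro tendsto_intros)
    moreover have en: "e n \<noteq> 0" for n using ne[of n] by (metis norm_zero of_nat_0_less_iff zero_less_Suc zero_less_divide_1_iff less_irrefl)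
    ultimately have "filterlim (\<lambda>n. e n + x) (at x) sequentially" by (simp add: filterlim_at)
    with d have "(\<lambda>n. norm (f (e n + x) - f x - frechet_derivative f (at x) (e n + x - x)) / norm (e n + x - x)) \<longlonglongrightarrow> 0"
      unfolding has_derivative_iff_norm
      using filterlim_compose[of "\<lambda>y. norm (f y - f x - frechet_derivative f (at x) (y - x)) / norm (y - x)"] by blast
    moreover have "norm (f (e n + x) - f x - frechet_derivative f (at x) (e n + x - x)) / norm (e n + x - x)
       = norm (F n x - partial_deriv j f x)" for n
    proof -
      have "frechet_derivative f (at x) (e n) = (1 / real (Suc n)) *\<^sub>R partial_deriv j f x"
        unfolding e_def partial_deriv_def by (rule linear_cmul[OF has_derivative_linear[OF d]])
      then have "F n x - partial_deriv j f x = real (Suc n) *\<^sub>R (f (e n + x) - f x - frechet_derivative f (at x) (e n))"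
        by (simp add: F_def algebra_simps del: of_nat_Suc)
      then show ?thesis using ne[of n] en[of n] by (simp add: divide_simps mult.commute del: of_nat_Suc)
    qed
    ultimately have "(\<lambda>n. norm (F n x - partial_deriv j f x)) \<longlonglongrightarrow> 0" by (simp only:)
    then show ?thesis by (simp only: tendsto_norm_zero_iff LIM_zero_iff)
  qed
  have "(\<lambda>n. LINT x|lborel. F n x) \<longlonglongrightarrow> (LINT x|lborel. partial_deriv j f x)"
  proof (rule integral_dominated_convergence[where w = "\<lambda>x. C * indicator (cball 0 (R + 1)) x"])
    show "partial_deriv j f \<in> borel_measurable lborel"
      using test_functions_continuous[OF test_functions_partial[OF assms(1)]] by (simp add: borel_measurable_continuous_onI)
    show "integrable lborel (\<lambda>x. C * indicator (cball 0 (R + 1)) x)"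
      using emeasure_lborel_cball_finite by (intro integrable_mult_right integrable_real_indicator) auto
    show "AE x in lborel. (\<lambda>n. F n x) \<longlonglongrightarrow> partial_deriv j f x" by (rule AE_I2) (rule lim)
    show "AE x in lborel. norm (F n x) \<le> C * indicator (cball 0 (R + 1)) x" for n by (rule AE_I2) (rule bound)
  qed (rule mF)
  then have "(LINT x|lborel. partial_deriv j f x) = 0" using zero by (simp add: LIMSEQ_const_iff)
  moreover have "(LINT x|lebesgue_on \<Omega>. partial_deriv j f x) = (LINT x|lborel. partial_deriv j f x)"
    using assms test_functionsD(4)[OF test_functions_partial[OF assms(1)]]
      test_functions_continuous[OF test_functions_partial[OF assms(1)]]
    by (intro integral_lebesgue_on_eq_lborel) auto
  ultimately show ?thesis by simp
qed

section \<open>The space of square integrable functions and magnetic forms\<close>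

text \<open>Nonnegativity of a real quadratic polynomial. The form may be degenerate, since
  functions are not identified almost everywhere, and \<open>V\<close> is arbitrary: the result
  serves both the inner product on \<open>L2\<close> and the magnetic form on test
  functions.\<close>

lemma sesquilinear_Cauchy_Schwarz:
  fixes B :: "('x \<Rightarrow> complex) \<Rightarrow> ('x \<Rightarrow> complex) \<Rightarrow> complex"
  assumes closed: "\<And>u v c. u \<in> V \<Longrightarrow> v \<in> V \<Longrightarrow> (\<lambda>x. u x - c * v x) \<in> V"
    and left: "\<And>u v w c. u \<in> V \<Longrightarrow> v \<in> V \<Longrightarrow> w \<in> V \<Longrightarrow> B (\<lambda>x. u x - c * v x) w = B u w - c * B v w"
    and herm: "\<And>u v. u \<in> V \<Longrightarrow> v \<in> V \<Longrightarrow> B v u = cnj (B u v)"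
    and nonneg: "\<And>u. u \<in> V \<Longrightarrow> 0 \<le> Re (B u u)"
    and uv: "u \<in> V" "v \<in> V"
  shows "(norm (B u v))\<^sup>2 \<le> norm (B u u) * norm (B v v)"
proof -
  define p q b where "p = Re (B u u)" and "q = Re (B v v)" and "b = (norm (B u v))\<^sup>2"
  have real: "B w w = of_real (Re (B w w))" if "w \<in> V" for w
    using herm[OF that that] by (metis Reals_cnj_iff of_real_Re)
  have bb: "complex_of_real b = B u v * cnj (B u v)" unfolding b_def by (rule complex_norm_square)
  have main: "0 \<le> p - 2 * t * b + t\<^sup>2 * b * q" for t
  proof -
    \<comment> \<open>The factor \<open>B u v\<close> aligns the phases, so that the expansion is a
      real polynomial in \<open>t\<close>.\<close>
    define c where "c = of_real t * B u v"
    let ?w = "\<lambda>x. u x - c * v x"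
    have w: "?w \<in> V" using closed uv .
    have "B ?w ?w = B u ?w - c * B v ?w" using left uv w by blast
    also have "B u ?w = cnj (B u u - c * B v u)" using herm[OF w uv(1)] left[OF uv uv(1)] by simp
    also have "B v ?w = cnj (B u v - c * B v v)" using herm[OF w uv(2)] left[OF uv uv(2)] by simp
    finally have "B ?w ?w = cnj (B u u) - cnj c * cnj (B v u) - c * cnj (B u v) + c * cnj c * cnj (B v v)"
      by (simp add: algebra_simps)
    also have "\<dots> = of_real p - cnj c * B u v - c * cnj (B u v) + c * cnj c * of_real q"
      using herm[OF uv] real[OF uv(1)] real[OF uv(2)] unfolding p_def q_def
      by (metis complex_cnj_cnj complex_cnj_complex_of_real)
    also have "\<dots> = of_real (p - 2 * t * b + t\<^sup>2 * b * q)"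
      by (simp add: c_def bb power2_eq_square algebra_simps)
    finally show ?thesis using nonneg[OF w] by simp
  qed
  have pq: "p \<ge> 0" "q \<ge> 0" "b \<ge> 0" using nonneg uv by (auto simp: p_def q_def b_def)
  have "b \<le> p * q"
  proof (cases "q = 0")
    case True
    have "b = 0"
    proof (rule ccontr)
      assume "b \<noteq> 0"
      \<comment> \<open>With \<open>q = 0\<close> this value of \<open>t\<close> makes the
        right-hand side of \<open>main\<close> equal to -1.\<close>
      then show False using main[of "(p + 1) / (2 * b)"] True pq by (simp add: field_simps)
    qed
    then show ?thesis using True by simp
  next
    case False
    then have "0 \<le> p - b / q" using main[of "1 / q"] by (simp add: power2_eq_square field_simps)
    then show ?thesis using False pq by (simp add: field_simps)
  qed
  moreover have "norm (B u u) = p" "norm (B v v) = q"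
    using real[OF uv(1)] real[OF uv(2)] pq unfolding p_def q_def by (metis abs_of_nonneg norm_of_real)+
  ultimately show ?thesis by (simp add: b_def)
qed

section \<open>Square integrable functions and their inner products\<close>

lemma L2_cmult:
  fixes u :: "real ^ 'n::finite \<Rightarrow> 's::{real_normed_field, banach, second_countable_topology}"
  shows "u \<in> L2 \<Omega> \<Longrightarrow> (\<lambda>x. c * u x) \<in> L2 \<Omega>"
  by (auto simp: L2_def norm_mult power_mult_distrib)

lemma L2_add:
  fixes u v :: "real ^ 'n::finite \<Rightarrow> 's::{real_normed_field, banach, second_countable_topology}"
  assumes "u \<in> L2 \<Omega>" "v \<in> L2 \<Omega>"
  shows "(\<lambda>x. u x + v x) \<in> L2 \<Omega>"
proof -
  have [measurable]: "u \<in> borel_measurable (lebesgue_on \<Omega>)" "v \<in> borel_measurable (lebesgue_on \<Omega>)"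
    using assms by (auto simp: L2_def)
  have "integrable (lebesgue_on \<Omega>) (\<lambda>x. (norm (u x + v x))\<^sup>2)"
  proof (rule Bochner_Integration.integrable_bound[where f = "\<lambda>x. 2 * (norm (u x))\<^sup>2 + 2 * (norm (v x))\<^sup>2"])
    show "integrable (lebesgue_on \<Omega>) (\<lambda>x. 2 * (norm (u x))\<^sup>2 + 2 * (norm (v x))\<^sup>2)"
      using assms by (auto simp: L2_def)
    have "(norm (u x + v x))\<^sup>2 \<le> 2 * (norm (u x))\<^sup>2 + 2 * (norm (v x))\<^sup>2" for x
    proof -
      have "(norm (u x + v x))\<^sup>2 \<le> (norm (u x) + norm (v x))\<^sup>2" by (intro power_mono norm_triangle_ineq) auto
      then show ?thesis using sum_squares_bound[of "norm (u x)" "norm (v x)"] by (simp add: power2_sum)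
    qed
    then show "AE x in lebesgue_on \<Omega>. norm ((norm (u x + v x))\<^sup>2) \<le> norm (2 * (norm (u x))\<^sup>2 + 2 * (norm (v x))\<^sup>2)"
      by simp
  qed measurable
  then show ?thesis by (simp add: L2_def)
qed

lemma L2_diff:
  fixes u v :: "real ^ 'n::finite \<Rightarrow> 's::{real_normed_field, banach, second_countable_topology}"
  shows "u \<in> L2 \<Omega> \<Longrightarrow> v \<in> L2 \<Omega> \<Longrightarrow> (\<lambda>x. u x - v x) \<in> L2 \<Omega>"
  using L2_add[of u \<Omega> "\<lambda>x. - 1 * v x"] L2_cmult[of v \<Omega> "- 1"] by simp

lemma L2_norm_le:
  fixes u :: "real ^ 'n::finite \<Rightarrow> 's::{real_normed_field, banach, second_countable_topology}"
    and v :: "real ^ 'n::finite \<Rightarrow> 't::{real_normed_field, banach, second_countable_topology}"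
  assumes "u \<in> L2 \<Omega>" "v \<in> borel_measurable (lebesgue_on \<Omega>)" "AE x in lebesgue_on \<Omega>. norm (v x) \<le> norm (u x)"
  shows "v \<in> L2 \<Omega>"
proof -
  have "integrable (lebesgue_on \<Omega>) (\<lambda>x. (norm (v x))\<^sup>2)"
  proof (rule Bochner_Integration.integrable_bound)
    show "integrable (lebesgue_on \<Omega>) (\<lambda>x. (norm (u x))\<^sup>2)" using assms(1) by (simp add: L2_def)
    show "(\<lambda>x. (norm (v x))\<^sup>2) \<in> borel_measurable (lebesgue_on \<Omega>)" using assms(2) by measurable
    show "AE x in lebesgue_on \<Omega>. norm ((norm (v x))\<^sup>2) \<le> norm ((norm (u x))\<^sup>2)"
      using assms(3) by eventually_elim (simp add: power_mono)
  qed
  then show ?thesis using assms(2) by (simp add: L2_def)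
qed

lemma L2_mult_integrable:
  fixes u v :: "real ^ 'n::finite \<Rightarrow> 's::{real_normed_field, banach, second_countable_topology}"
  assumes "u \<in> L2 \<Omega>" "v \<in> L2 \<Omega>"
  shows "integrable (lebesgue_on \<Omega>) (\<lambda>x. u x * v x)"
proof (rule Bochner_Integration.integrable_bound[where f = "\<lambda>x. (norm (u x))\<^sup>2 + (norm (v x))\<^sup>2"])
  show "integrable (lebesgue_on \<Omega>) (\<lambda>x. (norm (u x))\<^sup>2 + (norm (v x))\<^sup>2)"
    using assms by (auto simp: L2_def)
  show "(\<lambda>x. u x * v x) \<in> borel_measurable (lebesgue_on \<Omega>)" using assms by (auto simp: L2_def)
  have "norm (u x * v x) \<le> (norm (u x))\<^sup>2 + (norm (v x))\<^sup>2" for x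
    using sum_squares_bound[of "norm (u x)" "norm (v x)"] norm_ge_zero[of "u x"] norm_ge_zero[of "v x"]
      mult_nonneg_nonneg[of "norm (u x)" "norm (v x)"] unfolding norm_mult by linarith
  then show "AE x in lebesgue_on \<Omega>. norm (u x * v x) \<le> norm ((norm (u x))\<^sup>2 + (norm (v x))\<^sup>2)" by simp
qed

lemma L2_cnj: "u \<in> L2 \<Omega> \<Longrightarrow> (\<lambda>x. cnj (u x)) \<in> L2 \<Omega>"
  by (rule L2_norm_le[of u])
     (auto simp: L2_def intro: measurable_compose[OF _ borel_measurable_continuous_onI[OF continuous_on_cnj[OF continuous_on_id]]])

lemma L2_inner_complex_integrable:
  "u \<in> L2 \<Omega> \<Longrightarrow> v \<in> L2 \<Omega> \<Longrightarrow> integrable (lebesgue_on \<Omega>) (\<lambda>x. u x * cnj (v x))"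
  by (intro L2_mult_integrable L2_cnj)

lemma L2_inner_complex_diff_left:
  "u \<in> L2 \<Omega> \<Longrightarrow> v \<in> L2 \<Omega> \<Longrightarrow> w \<in> L2 \<Omega> \<Longrightarrow>
   L2_inner_complex \<Omega> (\<lambda>x. u x - v x) w = L2_inner_complex \<Omega> u w - L2_inner_complex \<Omega> v w"
  using L2_inner_complex_integrable[of u \<Omega> w] L2_inner_complex_integrable[of v \<Omega> w]
  by (simp add: L2_inner_complex_def left_diff_distrib)

lemma L2_inner_complex_add_left:
  "u \<in> L2 \<Omega> \<Longrightarrow> v \<in> L2 \<Omega> \<Longrightarrow> w \<in> L2 \<Omega> \<Longrightarrow>
   L2_inner_complex \<Omega> (\<lambda>x. u x + v x) w = L2_inner_complex \<Omega> u w + L2_inner_complex \<Omega> v w"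
  using L2_inner_complex_integrable[of u \<Omega> w] L2_inner_complex_integrable[of v \<Omega> w]
  by (simp add: L2_inner_complex_def distrib_right)

lemma L2_inner_complex_cmult_left:
  "L2_inner_complex \<Omega> (\<lambda>x. c * u x) w = c * L2_inner_complex \<Omega> u w"
  by (simp add: L2_inner_complex_def mult.assoc)

lemma L2_inner_complex_commute: "L2_inner_complex \<Omega> v u = cnj (L2_inner_complex \<Omega> u v)"
  unfolding L2_inner_complex_def by (subst Bochner_Integration.integral_cnj[symmetric]) (simp add: mult.commute)

lemma L2_inner_complex_diff_right:
  "u \<in> L2 \<Omega> \<Longrightarrow> v \<in> L2 \<Omega> \<Longrightarrow> w \<in> L2 \<Omega> \<Longrightarrow>
   L2_inner_complex \<Omega> w (\<lambda>x. u x - v x) = L2_inner_complex \<Omega> w u - L2_inner_complex \<Omega> w v"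
  by (subst (1 2 3) L2_inner_complex_commute) (simp add: L2_inner_complex_diff_left)

lemma L2_inner_complex_add_right:
  "u \<in> L2 \<Omega> \<Longrightarrow> v \<in> L2 \<Omega> \<Longrightarrow> w \<in> L2 \<Omega> \<Longrightarrow>
   L2_inner_complex \<Omega> w (\<lambda>x. u x + v x) = L2_inner_complex \<Omega> w u + L2_inner_complex \<Omega> w v"
  by (subst (1 2 3) L2_inner_complex_commute) (simp add: L2_inner_complex_add_left)

lemma L2_inner_complex_self:
  "L2_inner_complex \<Omega> u u = of_real (LINT x|lebesgue_on \<Omega>. (norm (u x))\<^sup>2)"
  by (simp only: L2_inner_complex_def complex_norm_square[symmetric] integral_complex_of_real)

lemma L2_inner_complex_Cauchy_Schwarz:
  assumes "u \<in> L2 \<Omega>" "v \<in> L2 \<Omega>"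
  shows "(norm (L2_inner_complex \<Omega> u v))\<^sup>2 \<le> norm (L2_inner_complex \<Omega> u u) * norm (L2_inner_complex \<Omega> v v)"
  by (rule sesquilinear_Cauchy_Schwarz[where V = "L2 \<Omega>"])
     (auto simp: assms L2_inner_complex_diff_left L2_inner_complex_cmult_left L2_diff L2_cmult
       L2_inner_complex_self intro: L2_inner_complex_commute)

lemma L2_of_real: "f \<in> L2 \<Omega> \<Longrightarrow> (\<lambda>x. complex_of_real (f x)) \<in> L2 \<Omega>"
  by (auto simp: L2_def)

lemma L2_inner_of_real:
  "L2_inner_complex \<Omega> (\<lambda>x. complex_of_real (f x)) (\<lambda>x. complex_of_real (g x)) = of_real (L2_inner_real \<Omega> f g)"
  by (simp add: L2_inner_complex_def L2_inner_real_def flip: of_real_mult)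

lemma L2_inner_real_diff:
  assumes "u \<in> L2 \<Omega>" "v \<in> L2 \<Omega>" "w \<in> L2 \<Omega>"
  shows "L2_inner_real \<Omega> (\<lambda>x. u x - v x) w = L2_inner_real \<Omega> u w - L2_inner_real \<Omega> v w"
    and "L2_inner_real \<Omega> w (\<lambda>x. u x - v x) = L2_inner_real \<Omega> w u - L2_inner_real \<Omega> w v"
  using L2_mult_integrable[of u \<Omega> w] L2_mult_integrable[of v \<Omega> w]
    L2_mult_integrable[of w \<Omega> u] L2_mult_integrable[of w \<Omega> v] assms
  by (simp_all add: L2_inner_real_def left_diff_distrib right_diff_distrib)

lemma L2_inner_real_Cauchy_Schwarz:
  assumes "u \<in> L2 \<Omega>" "v \<in> L2 \<Omega>"
  shows "(norm (L2_inner_real \<Omega> u v))\<^sup>2 \<le> norm (L2_inner_real \<Omega> u u) * norm (L2_inner_real \<Omega> v v)"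
  using L2_inner_complex_Cauchy_Schwarz[OF L2_of_real[OF assms(1)] L2_of_real[OF assms(2)]]
  by (simp add: L2_inner_of_real)

text \<open>Boundedness enters through finite measure: constants become integrable majorants, both
  for test functions and in dominated convergence.\<close>

locale bounded_open =
  fixes \<Omega> :: "(real ^ 'n::finite) set"
  assumes open_\<Omega>: "open \<Omega>" and bounded_\<Omega>: "bounded \<Omega>"
begin

lemma lmeasurable_\<Omega>: "\<Omega> \<in> lmeasurable"
  using open_\<Omega> bounded_\<Omega> by (simp add: lmeasurable_open)

lemma sets_\<Omega>: "\<Omega> \<in> sets lebesgue"
  using lmeasurable_\<Omega> by (rule fmeasurableD)

lemma finite_measure_\<Omega>: "finite_measure (lebesgue_on \<Omega>)"
  using lmeasurable_\<Omega> by (rule finite_measure_lebesgue_on)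

lemma space_\<Omega>: "space (lebesgue_on \<Omega>) = \<Omega>"
  by (simp add: space_restrict_space)

lemma continuous_measurable: "continuous_on UNIV f \<Longrightarrow> f \<in> borel_measurable (lebesgue_on \<Omega>)"
  for f :: "real ^ 'n \<Rightarrow> 'b::euclidean_space"
  using continuous_imp_measurable_on_sets_lebesgue[OF _ sets_\<Omega>] continuous_on_subset by blast

lemma test_functions_L2:
  fixes f :: "real ^ 'n \<Rightarrow> 's::{real_normed_field, euclidean_space}"
  assumes "f \<in> test_functions U"
  shows "f \<in> L2 \<Omega>"
proof -
  obtain C where C: "0 < C" "\<And>x. norm (f x) \<le> C" using test_functions_bounded[OF assms] by blast
  have f: "f \<in> borel_measurable (lebesgue_on \<Omega>)"
    using test_functions_continuous[OF assms] by (rule continuous_measurable)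
  have "(norm (f x))\<^sup>2 \<le> C\<^sup>2" for x using C by (intro power_mono) auto
  then have "integrable (lebesgue_on \<Omega>) (\<lambda>x. (norm (f x))\<^sup>2)"
    using f by (intro finite_measure.integrable_const_bound[OF finite_measure_\<Omega>, of _ "C\<^sup>2"]) auto
  then show ?thesis using f by (simp add: L2_def)
qed

text \<open>Dominated convergence with a constant majorant. The cutoff estimate is reduced to this
  situation.\<close>

lemma integral_tendsto_0:
  fixes F :: "nat \<Rightarrow> real ^ 'n \<Rightarrow> 'b::{banach, second_countable_topology}"
  assumes "\<And>n. F n \<in> borel_measurable (lebesgue_on \<Omega>)" "\<And>n x. norm (F n x) \<le> C"
    "AE x in lebesgue_on \<Omega>. \<forall>\<^sub>F n in sequentially. F n x = 0"
  shows "(\<lambda>n. LINT x|lebesgue_on \<Omega>. F n x) \<longlonglongrightarrow> 0"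
proof -
  have "(\<lambda>n. LINT x|lebesgue_on \<Omega>. F n x) \<longlonglongrightarrow> (LINT x|lebesgue_on \<Omega>. 0)"
  proof (rule integral_dominated_convergence[where w = "\<lambda>x. C"])
    show "AE x in lebesgue_on \<Omega>. (\<lambda>n. F n x) \<longlonglongrightarrow> 0"
      using assms(3) by eventually_elim (rule tendsto_eventually)
    show "integrable (lebesgue_on \<Omega>) (\<lambda>x. C)" by (rule finite_measure.integrable_const[OF finite_measure_\<Omega>])
  qed (use assms in auto)
  then show ?thesis by simp
qed

end

section \<open>Magnetic derivatives and the form of the magnetic Laplacian\<close>

lemma magnetic_deriv_test_function:
  assumes "f \<in> test_functions U" "open U" "smooth_on U (\<lambda>x. A x $ j)"
  shows "magnetic_deriv A j f \<in> test_functions U"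
proof -
  have "smooth_on U (\<lambda>x. complex_of_real (A x $ j))"
    using smooth_on_bounded_linear[OF bounded_linear_of_real assms(2,3)] .
  then have "(\<lambda>x. \<i> * partial_deriv j f x + of_real (A x $ j) * f x) \<in> test_functions U"
    using assms by (intro test_functions_add test_functions_cmult test_functions_partial test_functions_mult[of f U U]) auto
  then show ?thesis by (simp add: magnetic_deriv_def[abs_def])
qed

lemma magnetic_laplacian_test_function:
  assumes "f \<in> test_functions U" "open U" "\<And>j. smooth_on U (\<lambda>x. A x $ j)"
  shows "magnetic_laplacian A f \<in> test_functions U"
  using assms unfolding magnetic_laplacian_def[abs_def] sum_2
  by (intro test_functions_add magnetic_deriv_test_function)

lemma smooth_on_cnj: "open U \<Longrightarrow> smooth_on U f \<Longrightarrow> smooth_on U (\<lambda>x. cnj (f x))"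
  by (rule smooth_on_bounded_linear[OF bounded_linear_cnj])

text \<open>The potential is real, so its contributions cancel, and the difference of the two
  integrands is i times a partial derivative of the test function \<open>cnj g * f\<close>.\<close>

lemma magnetic_deriv_adjoint:
  fixes \<Omega> :: "(real ^ 2) set"
  assumes "bounded_open \<Omega>" "f \<in> test_functions U" "g \<in> test_functions U" "U \<subseteq> \<Omega>" "open U" "smooth_on U (\<lambda>x. A x $ j)"
  shows "L2_inner_complex \<Omega> (magnetic_deriv A j f) g = L2_inner_complex \<Omega> f (magnetic_deriv A j g)"
proof -
  interpret bounded_open \<Omega> by fact
  have fg: "(\<lambda>x. cnj (g x) * f x) \<in> test_functions \<Omega>"
    using assms(2,3,4) smooth_on_cnj[OF open_UNIV test_functionsD(1)[OF assms(3)]]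
    by (intro test_functions_mult[OF test_functions_mono[OF assms(4) assms(2)] open_UNIV]) auto
  have d: "f differentiable (at x)" "g differentiable (at x)" for x
    using smooth_on_differentiable[OF test_functionsD(1)[OF assms(2)]]
      smooth_on_differentiable[OF test_functionsD(1)[OF assms(3)]] by auto
  have dc: "(\<lambda>x. cnj (g x)) differentiable (at x)" for x
    using smooth_on_differentiable[OF smooth_on_cnj[OF open_UNIV test_functionsD(1)[OF assms(3)]]] by auto
  have eq: "magnetic_deriv A j f x * cnj (g x) - f x * cnj (magnetic_deriv A j g x)
     = \<i> * partial_deriv j (\<lambda>x. cnj (g x) * f x) x" for x
    unfolding partial_deriv_mult[OF dc d(1)] partial_deriv_bounded_linear[OF bounded_linear_cnj d(2)]
    by (simp add: magnetic_deriv_def algebra_simps)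
  have "integrable (lebesgue_on \<Omega>) (\<lambda>x. magnetic_deriv A j f x * cnj (g x))"
    "integrable (lebesgue_on \<Omega>) (\<lambda>x. f x * cnj (magnetic_deriv A j g x))"
    using assms magnetic_deriv_test_function test_functions_L2 by (blast intro: L2_inner_complex_integrable)+
  then have "L2_inner_complex \<Omega> (magnetic_deriv A j f) g - L2_inner_complex \<Omega> f (magnetic_deriv A j g)
     = (LINT x|lebesgue_on \<Omega>. \<i> * partial_deriv j (\<lambda>x. cnj (g x) * f x) x)"
    unfolding L2_inner_complex_def eq[symmetric] by (simp add: Bochner_Integration.integral_diff)
  also have "\<dots> = 0" using integral_partial_deriv_test_function[OF fg sets_\<Omega>] by simp
  finally show ?thesis by simp
qed

text \<open>Three kinds of instances occur: the complements of the poles and of a cut, with the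
  singular potential, and \<open>\<Omega>\<close> itself with zero potential.\<close>

locale magnetic_form = bounded_open \<Omega> for \<Omega> :: "(real ^ 2) set" +
  fixes U :: "(real ^ 2) set" and A :: "real ^ 2 \<Rightarrow> real ^ 2"
  assumes open_U: "open U" and U_subset: "U \<subseteq> \<Omega>" and smooth_A: "\<And>j. smooth_on U (\<lambda>x. A x $ j)"
begin

abbreviation "form u v \<equiv> L2_inner_complex \<Omega> (magnetic_laplacian A u) v"

lemma test_L2: "f \<in> test_functions U \<Longrightarrow> f \<in> L2 \<Omega>" for f :: "real ^ 2 \<Rightarrow> complex"
  by (rule test_functions_L2)

lemma magnetic_laplacian_test: "f \<in> test_functions U \<Longrightarrow> magnetic_laplacian A f \<in> test_functions U"
  by (rule magnetic_laplacian_test_function[OF _ open_U smooth_A])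

lemma magnetic_deriv_test: "f \<in> test_functions U \<Longrightarrow> magnetic_deriv A j f \<in> test_functions U"
  by (rule magnetic_deriv_test_function[OF _ open_U smooth_A])

text \<open>Each magnetic derivative is symmetric on test functions, so one of the two moves to the
  other side. Hermitian symmetry and nonnegativity of the form are read off from this
  expression.\<close>

lemma form_eq:
  assumes "u \<in> test_functions U" "v \<in> test_functions U"
  shows "form u v = (\<Sum>j\<in>UNIV. L2_inner_complex \<Omega> (magnetic_deriv A j u) (magnetic_deriv A j v))"
proof -
  have "form u v = (\<Sum>j\<in>UNIV. L2_inner_complex \<Omega> (magnetic_deriv A j (magnetic_deriv A j u)) v)"
    unfolding magnetic_laplacian_def[abs_def] sum_2 using assms
    by (intro L2_inner_complex_add_left test_L2 magnetic_deriv_test)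
  then show ?thesis
    using assms magnetic_deriv_adjoint[OF bounded_open_axioms _ _ U_subset open_U smooth_A] magnetic_deriv_test by simp
qed

lemma form_commute:
  assumes "u \<in> test_functions U" "v \<in> test_functions U"
  shows "form v u = cnj (form u v)"
  unfolding form_eq[OF assms] form_eq[OF assms(2,1)] cnj_sum
  by (rule sum.cong[OF refl], rule L2_inner_complex_commute)

lemma magnetic_laplacian_symmetric:
  assumes "u \<in> test_functions U" "v \<in> test_functions U"
  shows "form u v = L2_inner_complex \<Omega> u (magnetic_laplacian A v)"
  using form_commute[OF assms(2,1)] L2_inner_complex_commute[where u = "magnetic_laplacian A v" and v = u] by simp

lemma form_nonneg: "u \<in> test_functions U \<Longrightarrow> 0 \<le> Re (form u u)"
  by (simp add: form_eq L2_inner_complex_self sum_nonneg)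

lemma magnetic_deriv_diff:
  assumes "u \<in> test_functions U" "v \<in> test_functions U"
  shows "magnetic_deriv A j (\<lambda>x. u x - v x) = (\<lambda>x. magnetic_deriv A j u x - magnetic_deriv A j v x)"
proof
  fix x
  have "u differentiable (at x)" "v differentiable (at x)"
    using assms[THEN test_functionsD(1)] smooth_on_differentiable by blast+
  then show "magnetic_deriv A j (\<lambda>x. u x - v x) x = magnetic_deriv A j u x - magnetic_deriv A j v x"
    by (simp add: magnetic_deriv_def partial_deriv_minus algebra_simps)
qed

lemma magnetic_laplacian_diff:
  assumes "u \<in> test_functions U" "v \<in> test_functions U"
  shows "magnetic_laplacian A (\<lambda>x. u x - v x) = (\<lambda>x. magnetic_laplacian A u x - magnetic_laplacian A v x)"
  using assms by (simp add: magnetic_laplacian_def[abs_def] magnetic_deriv_diff magnetic_deriv_test sum_subtractf)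

lemma magnetic_deriv_cmult:
  assumes "u \<in> test_functions U"
  shows "magnetic_deriv A j (\<lambda>x. c * u x) = (\<lambda>x. c * magnetic_deriv A j u x)"
proof
  fix x
  have "u differentiable (at x)"
    using assms[THEN test_functionsD(1)] smooth_on_differentiable by blast
  then show "magnetic_deriv A j (\<lambda>x. c * u x) x = c * magnetic_deriv A j u x"
    by (simp add: magnetic_deriv_def partial_deriv_bounded_linear[OF bounded_linear_mult_right] algebra_simps)
qed

lemma magnetic_laplacian_cmult:
  assumes "u \<in> test_functions U"
  shows "magnetic_laplacian A (\<lambda>x. c * u x) = (\<lambda>x. c * magnetic_laplacian A u x)"
  using assms by (simp add: magnetic_laplacian_def[abs_def] magnetic_deriv_cmult magnetic_deriv_test sum_distrib_left)

lemma form_Cauchy_Schwarz: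
  assumes "u \<in> test_functions U" "v \<in> test_functions U"
  shows "(norm (form u v))\<^sup>2 \<le> norm (form u u) * norm (form v v)"
proof (rule sesquilinear_Cauchy_Schwarz[where V = "test_functions U"])
  fix u v w :: "real ^ 2 \<Rightarrow> complex" and c assume "u \<in> test_functions U" "v \<in> test_functions U" "w \<in> test_functions U"
  then show "form (\<lambda>x. u x - c * v x) w = form u w - c * form v w"
    by (simp add: magnetic_laplacian_diff magnetic_laplacian_cmult test_functions_cmult
       L2_inner_complex_diff_left L2_inner_complex_cmult_left test_L2 magnetic_laplacian_test L2_cmult)
qed (auto intro: test_functions_diff test_functions_cmult form_commute form_nonneg assms)

end

section \<open>Form-dense subspaces and the Friedrichs extension\<close>

text \<open>Cauchy-Schwarz bounds the two cross terms. The inequality is phrased with differences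
  because these are the linear operation under which the spaces of \<open>symmetric_form\<close> are
  assumed closed.\<close>

lemma form_triangle:
  fixes B :: "('x \<Rightarrow> 's::real_normed_field) \<Rightarrow> ('x \<Rightarrow> 's) \<Rightarrow> 's"
  assumes closed: "(\<lambda>x. u x - v x) \<in> V" and uv: "u \<in> V" "v \<in> V"
    and left: "\<And>w. w \<in> V \<Longrightarrow> B (\<lambda>x. u x - v x) w = B u w - B v w"
    and right: "\<And>w. w \<in> V \<Longrightarrow> B w (\<lambda>x. u x - v x) = B w u - B w v"
    and CS: "\<And>u v. u \<in> V \<Longrightarrow> v \<in> V \<Longrightarrow> (norm (B u v))\<^sup>2 \<le> norm (B u u) * norm (B v v)"
  shows "sqrt (norm (B (\<lambda>x. u x - v x) (\<lambda>x. u x - v x))) \<le> sqrt (norm (B u u)) + sqrt (norm (B v v))"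
proof -
  have cs: "norm (B a b) \<le> sqrt (norm (B a a)) * sqrt (norm (B b b))" if "a \<in> V" "b \<in> V" for a b
    using CS[OF that] real_le_rsqrt by (simp add: real_sqrt_mult flip: real_sqrt_mult)
  have "B (\<lambda>x. u x - v x) (\<lambda>x. u x - v x) = (B u u - B u v) - (B v u - B v v)"
    using left[OF closed] right uv by simp
  also have "norm \<dots> \<le> norm (B u u) + norm (B u v) + (norm (B v u) + norm (B v v))"
    by (intro order_trans[OF norm_triangle_ineq4] add_mono norm_triangle_ineq4)
  also have "\<dots> \<le> (sqrt (norm (B u u)) + sqrt (norm (B v v)))\<^sup>2"
  proof -
    have "(sqrt (norm (B u u)) + sqrt (norm (B v v)))\<^sup>2 =
      norm (B u u) + norm (B v v) + 2 * (sqrt (norm (B u u)) * sqrt (norm (B v v)))"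
      by (simp add: power2_sum)
    then show ?thesis
      using cs[OF uv] cs[OF uv(2,1)] mult.commute[of "sqrt (norm (B v v))" "sqrt (norm (B u u))"] by linarith
  qed
  finally show ?thesis by (intro real_le_lsqrt) auto
qed

text \<open>An interface common to complex \<open>L2\<close> with the magnetic Laplacian and to real
  even functions with the Laplacian. Symmetry and the two Cauchy-Schwarz inequalities are stated
  without conjugation, so the scalar field stays abstract.\<close>

locale symmetric_form =
  fixes H :: "('x \<Rightarrow> 's::real_normed_field) set" and ip :: "('x \<Rightarrow> 's) \<Rightarrow> ('x \<Rightarrow> 's) \<Rightarrow> 's"
    and D :: "('x \<Rightarrow> 's) set" and S :: "('x \<Rightarrow> 's) \<Rightarrow> ('x \<Rightarrow> 's)"
  assumes H_diff: "\<And>u v. u \<in> H \<Longrightarrow> v \<in> H \<Longrightarrow> (\<lambda>x. u x - v x) \<in> H"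
    and D_H: "D \<subseteq> H" and S_H: "\<And>v. v \<in> D \<Longrightarrow> S v \<in> H"
    and D_diff: "\<And>u v. u \<in> D \<Longrightarrow> v \<in> D \<Longrightarrow> (\<lambda>x. u x - v x) \<in> D"
    and ip_diff_left: "\<And>u v w. u \<in> H \<Longrightarrow> v \<in> H \<Longrightarrow> w \<in> H \<Longrightarrow> ip (\<lambda>x. u x - v x) w = ip u w - ip v w"
    and ip_diff_right: "\<And>u v w. u \<in> H \<Longrightarrow> v \<in> H \<Longrightarrow> w \<in> H \<Longrightarrow> ip w (\<lambda>x. u x - v x) = ip w u - ip w v"
    and S_diff: "\<And>u v. u \<in> D \<Longrightarrow> v \<in> D \<Longrightarrow> S (\<lambda>x. u x - v x) = (\<lambda>x. S u x - S v x)"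
    and S_symmetric: "\<And>u v. u \<in> D \<Longrightarrow> v \<in> D \<Longrightarrow> ip (S u) v = ip u (S v)"
    and ip_CS: "\<And>u v. u \<in> H \<Longrightarrow> v \<in> H \<Longrightarrow> (norm (ip u v))\<^sup>2 \<le> norm (ip u u) * norm (ip v v)"
    and form_CS: "\<And>u v. u \<in> D \<Longrightarrow> v \<in> D \<Longrightarrow> (norm (ip (S u) v))\<^sup>2 \<le> norm (ip (S u) u) * norm (ip (S v) v)"
begin

definition ip_norm :: "('x \<Rightarrow> 's) \<Rightarrow> real" where "ip_norm u = sqrt (norm (ip u u))"
definition form_norm :: "('x \<Rightarrow> 's) \<Rightarrow> real" where "form_norm u = sqrt (norm (ip (S u) u))"

lemma ip_norm_triangle: "u \<in> H \<Longrightarrow> v \<in> H \<Longrightarrow> ip_norm (\<lambda>x. u x - v x) \<le> ip_norm u + ip_norm v"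
  unfolding ip_norm_def by (rule form_triangle[where V = H]) (auto simp: H_diff ip_diff_left ip_diff_right ip_CS)

lemma form_norm_triangle: "u \<in> D \<Longrightarrow> v \<in> D \<Longrightarrow> form_norm (\<lambda>x. u x - v x) \<le> form_norm u + form_norm v"
  unfolding form_norm_def
proof (rule form_triangle[where V = D and B = "\<lambda>u v. ip (S u) v"])
  assume uv: "u \<in> D" "v \<in> D"
  fix w assume w: "w \<in> D"
  have *: "u \<in> H" "v \<in> H" "w \<in> H" "S u \<in> H" "S v \<in> H" "S w \<in> H" using uv w D_H S_H by auto
  show "ip (S (\<lambda>x. u x - v x)) w = ip (S u) w - ip (S v) w" using uv * by (simp add: S_diff ip_diff_left)
  show "ip (S w) (\<lambda>x. u x - v x) = ip (S w) u - ip (S w) v" using uv * by (simp add: ip_diff_right)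
qed (auto simp: D_diff form_CS)

lemma norm_ip_le: "u \<in> H \<Longrightarrow> v \<in> H \<Longrightarrow> norm (ip u v) \<le> ip_norm u * ip_norm v"
  using ip_CS[of u v] unfolding ip_norm_def by (metis real_le_rsqrt real_sqrt_mult)

lemma norm_form_le: "u \<in> D \<Longrightarrow> v \<in> D \<Longrightarrow> norm (ip (S u) v) \<le> form_norm u * form_norm v"
  using form_CS[of u v] unfolding form_norm_def by (metis real_le_rsqrt real_sqrt_mult)

lemma ip_norm_tendsto_0_iff: "(\<lambda>n. ip (u n) (u n)) \<longlonglongrightarrow> 0 \<longleftrightarrow> (\<lambda>n. ip_norm (u n)) \<longlonglongrightarrow> 0"
proof
  assume "(\<lambda>n. ip (u n) (u n)) \<longlonglongrightarrow> 0"
  then show "(\<lambda>n. ip_norm (u n)) \<longlonglongrightarrow> 0" unfolding ip_norm_def using tendsto_real_sqrt[OF tendsto_norm_zero] by fastforce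
next
  assume "(\<lambda>n. ip_norm (u n)) \<longlonglongrightarrow> 0"
  then have "(\<lambda>n. (ip_norm (u n))\<^sup>2) \<longlonglongrightarrow> 0\<^sup>2" by (intro tendsto_power)
  then show "(\<lambda>n. ip (u n) (u n)) \<longlonglongrightarrow> 0" unfolding ip_norm_def by (simp add: tendsto_norm_zero_iff)
qed

lemma form_norm_tendsto_0_iff: "(\<lambda>n. ip (S (u n)) (u n)) \<longlonglongrightarrow> 0 \<longleftrightarrow> (\<lambda>n. form_norm (u n)) \<longlonglongrightarrow> 0"
proof
  assume "(\<lambda>n. ip (S (u n)) (u n)) \<longlonglongrightarrow> 0"
  then show "(\<lambda>n. form_norm (u n)) \<longlonglongrightarrow> 0" unfolding form_norm_def using tendsto_real_sqrt[OF tendsto_norm_zero] by fastforce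
next
  assume "(\<lambda>n. form_norm (u n)) \<longlonglongrightarrow> 0"
  then have "(\<lambda>n. (form_norm (u n))\<^sup>2) \<longlonglongrightarrow> 0\<^sup>2" by (intro tendsto_power)
  then show "(\<lambda>n. ip (S (u n)) (u n)) \<longlonglongrightarrow> 0" unfolding form_norm_def by (simp add: tendsto_norm_zero_iff)
qed

lemma norm_less_iff_sqrt: "0 < e \<Longrightarrow> norm a < e\<^sup>2 \<longleftrightarrow> sqrt (norm a) < e"
  by (metis less_eq_real_def norm_ge_zero real_sqrt_abs real_sqrt_less_iff abs_of_pos)

lemma form_domain_iff:
  "u \<in> form_domain H ip D S \<longleftrightarrow> u \<in> H \<and> (\<exists>w. (\<forall>n. w n \<in> D) \<and> (\<lambda>n. ip_norm (\<lambda>x. w n x - u x)) \<longlonglongrightarrow> 0 \<and>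
     (\<forall>e>0. \<exists>N. \<forall>m\<ge>N. \<forall>n\<ge>N. form_norm (\<lambda>x. w m x - w n x) < e))"
proof -
  have "(\<forall>e>0. \<exists>N. \<forall>m\<ge>N. \<forall>n\<ge>N. norm (ip (S (\<lambda>x. w m x - w n x)) (\<lambda>x. w m x - w n x)) < e)
     \<longleftrightarrow> (\<forall>e>0. \<exists>N. \<forall>m\<ge>N. \<forall>n\<ge>N. form_norm (\<lambda>x. w m x - w n x) < e)" (is "?L \<longleftrightarrow> ?R") for w :: "nat \<Rightarrow> 'x \<Rightarrow> 's"
  proof
    assume L: ?L
    show ?R
    proof (intro allI impI)
      fix e :: real assume "e > 0"
      then show "\<exists>N. \<forall>m\<ge>N. \<forall>n\<ge>N. form_norm (\<lambda>x. w m x - w n x) < e"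
        using L[rule_format, OF zero_less_power[OF \<open>e > 0\<close>, of 2]]
        unfolding form_norm_def norm_less_iff_sqrt[OF \<open>e > 0\<close>] by simp
    qed
  next
    assume R: ?R
    show ?L
    proof (intro allI impI)
      fix e :: real assume "e > 0"
      then show "\<exists>N. \<forall>m\<ge>N. \<forall>n\<ge>N. norm (ip (S (\<lambda>x. w m x - w n x)) (\<lambda>x. w m x - w n x)) < e"
        using R[rule_format, of "sqrt e"] norm_less_iff_sqrt[of "sqrt e"] unfolding form_norm_def by simp
    qed
  qed
  then show ?thesis unfolding form_domain_def by (simp add: ip_norm_tendsto_0_iff)
qed

text \<open>The weak equation extends from \<open>D'\<close> to \<open>D\<close> because \<open>d \<mapsto> ip u (S d)\<close> is bounded in the form norm
  for \<open>u\<close> in the form domain.\<close>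

theorem friedrichs_extension_core:
  assumes D': "D' \<subseteq> D"
    and dense: "\<And>v. v \<in> D \<Longrightarrow> \<exists>g. (\<forall>n. g n \<in> D') \<and>
       (\<lambda>n. ip (\<lambda>x. v x - g n x) (\<lambda>x. v x - g n x)) \<longlonglongrightarrow> 0 \<and>
       (\<lambda>n. ip (S (\<lambda>x. v x - g n x)) (\<lambda>x. v x - g n x)) \<longlonglongrightarrow> 0"
  shows "friedrichs_extension H ip D S = friedrichs_extension H ip D' S"
proof -
  have dense': "\<exists>g. (\<forall>n. g n \<in> D') \<and> (\<lambda>n. ip_norm (\<lambda>x. v x - g n x)) \<longlonglongrightarrow> 0 \<and> (\<lambda>n. form_norm (\<lambda>x. v x - g n x)) \<longlonglongrightarrow> 0"
    if "v \<in> D" for v using dense[OF that] unfolding ip_norm_tendsto_0_iff form_norm_tendsto_0_iff .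
  have sub: "form_domain H ip D' S \<subseteq> form_domain H ip D S"
    using D' unfolding form_domain_def by blast
  have sup: "u \<in> form_domain H ip D' S" if u: "u \<in> form_domain H ip D S" for u
  proof -
    obtain w where w: "u \<in> H" "\<And>n. w n \<in> D" "(\<lambda>n. ip_norm (\<lambda>x. w n x - u x)) \<longlonglongrightarrow> 0"
      "\<And>e. e > 0 \<Longrightarrow> \<exists>N. \<forall>m\<ge>N. \<forall>n\<ge>N. form_norm (\<lambda>x. w m x - w n x) < e"
      using u unfolding form_domain_iff by auto
    \<comment> \<open>Diagonal choice: \<open>w n\<close> is replaced by an element of
      \<open>D'\<close> within 1/(n + 1) in both norms, which preserves the limit and the Cauchy
      property.\<close>
    have "\<exists>g\<in>D'. ip_norm (\<lambda>x. w n x - g x) < 1 / real (Suc n) \<and> form_norm (\<lambda>x. w n x - g x) < 1 / real (Suc n)" for n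
    proof -
      obtain g where g: "\<forall>n. g n \<in> D'" "(\<lambda>k. ip_norm (\<lambda>x. w n x - g k x)) \<longlonglongrightarrow> 0" "(\<lambda>k. form_norm (\<lambda>x. w n x - g k x)) \<longlonglongrightarrow> 0"
        using dense'[OF w(2)] by blast
      have "\<forall>\<^sub>F k in sequentially. ip_norm (\<lambda>x. w n x - g k x) < 1 / real (Suc n) \<and> form_norm (\<lambda>x. w n x - g k x) < 1 / real (Suc n)"
        using g(2,3) by (intro eventually_conj order_tendstoD(2)) auto
      then show ?thesis using g(1) eventually_happens'[OF sequentially_bot] by blast
    qed
    then obtain g where g: "\<And>n. g n \<in> D'" "\<And>n. ip_norm (\<lambda>x. w n x - g n x) < 1 / real (Suc n)"
      "\<And>n. form_norm (\<lambda>x. w n x - g n x) < 1 / real (Suc n)" by metis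
    have gD: "g n \<in> D" for n using g(1) D' by blast
    have H: "w n \<in> H" "g n \<in> H" for n using w(2) gD D_H by auto
    have P: "(\<lambda>n. ip_norm (\<lambda>x. g n x - u x)) \<longlonglongrightarrow> 0"
    proof (rule tendsto_sandwich[where f = "\<lambda>_. 0"])
      have "ip_norm (\<lambda>x. g n x - u x) \<le> ip_norm (\<lambda>x. w n x - u x) + 1 / real (Suc n)" for n
        using ip_norm_triangle[OF H_diff[OF H(1)[of n] w(1)] H_diff[OF H(1)[of n] H(2)[of n]]] g(2)[of n] by simp
      then show "\<forall>\<^sub>F n in sequentially. ip_norm (\<lambda>x. g n x - u x) \<le> ip_norm (\<lambda>x. w n x - u x) + 1 / real (Suc n)"
        by (intro always_eventually allI)
      show "(\<lambda>n. ip_norm (\<lambda>x. w n x - u x) + 1 / real (Suc n)) \<longlonglongrightarrow> 0"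
        using tendsto_add[OF w(3) LIMSEQ_Suc[OF lim_1_over_n]] by simp
      show "\<forall>\<^sub>F n in sequentially. 0 \<le> ip_norm (\<lambda>x. g n x - u x)" by (simp add: ip_norm_def)
    qed simp
    have R: "\<exists>N. \<forall>m\<ge>N. \<forall>n\<ge>N. form_norm (\<lambda>x. g m x - g n x) < e" if "e > 0" for e
    proof -
      have "e / 3 > 0" using that by simp
      from w(4)[OF this] obtain N where N: "\<forall>m\<ge>N. \<forall>n\<ge>N. form_norm (\<lambda>x. w m x - w n x) < e / 3" ..
      obtain M where M: "inverse (real (Suc M)) < e / 3" using reals_Archimedean[OF \<open>e / 3 > 0\<close>] ..
      have "form_norm (\<lambda>x. g m x - g n x) < e" if mn: "m \<ge> max N M" "n \<ge> max N M" for m n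
      proof -
        \<comment> \<open>The function on the left is \<open>g m - g n\<close>, arranged so that the
          triangle inequality for differences applies twice.\<close>
        have "form_norm (\<lambda>x. (w m x - w n x) - ((w m x - g m x) - (w n x - g n x)))
          \<le> form_norm (\<lambda>x. w m x - w n x) + form_norm (\<lambda>x. (w m x - g m x) - (w n x - g n x))"
          using w(2) gD by (intro form_norm_triangle D_diff) auto
        also have "form_norm (\<lambda>x. (w m x - g m x) - (w n x - g n x)) \<le> form_norm (\<lambda>x. w m x - g m x) + form_norm (\<lambda>x. w n x - g n x)"
          using w(2) gD by (intro form_norm_triangle D_diff) auto
        finally have "form_norm (\<lambda>x. g m x - g n x) \<le> form_norm (\<lambda>x. w m x - w n x) + (form_norm (\<lambda>x. w m x - g m x) + form_norm (\<lambda>x. w n x - g n x))"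
          by simp
        moreover have "1 / real (Suc m) \<le> inverse (real (Suc M))" "1 / real (Suc n) \<le> inverse (real (Suc M))"
          using mn by (auto simp: field_simps)
        ultimately show ?thesis using N[rule_format, of m n] mn g(3)[of m] g(3)[of n] M by simp
      qed
      then show ?thesis by blast
    qed
    have "\<exists>N. \<forall>m\<ge>N. \<forall>n\<ge>N. norm (ip (S (\<lambda>x. g m x - g n x)) (\<lambda>x. g m x - g n x)) < e" if "e > 0" for e
      using R[of "sqrt e"] that unfolding form_norm_def by simp
    then show ?thesis
      using w(1) g(1) P[folded ip_norm_tendsto_0_iff] unfolding form_domain_def by auto
  qed
  have ext: "ip u (S v) = ip f v"
    if uf: "(u, f) \<in> friedrichs_extension H ip D' S" and v: "v \<in> D" for u f v
  proof -
    have uf': "u \<in> form_domain H ip D S" "f \<in> H" "\<And>v. v \<in> D' \<Longrightarrow> ip u (S v) = ip f v"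
      using uf sub unfolding friedrichs_extension_def by auto
    obtain w where w: "u \<in> H" "\<And>n. w n \<in> D" "(\<lambda>n. ip_norm (\<lambda>x. w n x - u x)) \<longlonglongrightarrow> 0"
      "\<And>e. e > 0 \<Longrightarrow> \<exists>N. \<forall>m\<ge>N. \<forall>n\<ge>N. form_norm (\<lambda>x. w m x - w n x) < e"
      using uf'(1) unfolding form_domain_iff by auto
    from w(4)[OF zero_less_one] obtain N where N: "\<forall>m\<ge>N. \<forall>n\<ge>N. form_norm (\<lambda>x. w m x - w n x) < 1" ..
    \<comment> \<open>The tail of a form-Cauchy sequence is bounded in the form norm;
      \<open>K\<close> is a bound from index \<open>N\<close> on.\<close>
    define K where "K = form_norm (w N) + 1"
    have K: "form_norm (w n) \<le> K" if "n \<ge> N" for n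
    proof -
      have "form_norm (\<lambda>x. w N x - (w N x - w n x)) \<le> form_norm (w N) + form_norm (\<lambda>x. w N x - w n x)"
        using w(2) by (intro form_norm_triangle D_diff)
      then show ?thesis using N[rule_format, of N n] that by (simp add: K_def)
    qed
    \<comment> \<open>For \<open>w n\<close> in place of \<open>u\<close> the pairing equals
      \<open>ip (S (w n)) d\<close>, which the form Cauchy-Schwarz inequality controls; the bound
      survives the limit in \<open>H\<close>.\<close>
    have bound: "norm (ip u (S d)) \<le> K * form_norm d" if d: "d \<in> D" for d
    proof -
      have dH: "S d \<in> H" "d \<in> H" "\<And>n. w n \<in> H" using S_H[OF d] d D_H w(2) by auto
      have "(\<lambda>n. ip (\<lambda>x. w n x - u x) (S d)) \<longlonglongrightarrow> 0"
      proof (rule Lim_null_comparison[OF always_eventually[OF allI]])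
        show "norm (ip (\<lambda>x. w n x - u x) (S d)) \<le> ip_norm (\<lambda>x. w n x - u x) * ip_norm (S d)" for n
          using dH w(1) by (intro norm_ip_le H_diff)
        show "(\<lambda>n. ip_norm (\<lambda>x. w n x - u x) * ip_norm (S d)) \<longlonglongrightarrow> 0" using tendsto_mult_left_zero[OF w(3)] .
      qed
      then have "(\<lambda>n. ip (w n) (S d) - ip u (S d)) \<longlonglongrightarrow> 0" using dH w(1) by (simp add: ip_diff_left)
      then have "(\<lambda>n. norm (ip (w n) (S d))) \<longlonglongrightarrow> norm (ip u (S d))" by (intro tendsto_norm) (simp only: LIM_zero_iff)
      moreover have "norm (ip (w n) (S d)) \<le> K * form_norm d" if "n \<ge> N" for n
      proof -
        have "norm (ip (w n) (S d)) \<le> form_norm (w n) * form_norm d" using norm_form_le[OF w(2) d] S_symmetric[OF w(2) d] by simp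
        also have "\<dots> \<le> K * form_norm d" using K[OF that] by (intro mult_right_mono) (auto simp: form_norm_def)
        finally show ?thesis .
      qed
      ultimately show ?thesis by (intro LIMSEQ_le_const2) auto
    qed
    obtain g where g: "\<And>n. g n \<in> D'" "(\<lambda>n. ip_norm (\<lambda>x. v x - g n x)) \<longlonglongrightarrow> 0" "(\<lambda>n. form_norm (\<lambda>x. v x - g n x)) \<longlonglongrightarrow> 0"
      using dense'[OF v] by blast
    have gD: "g n \<in> D" for n using g(1) D' by blast
    have *: "norm (ip u (S v) - ip f v) \<le> K * form_norm (\<lambda>x. v x - g n x) + ip_norm f * ip_norm (\<lambda>x. v x - g n x)" for n
    proof -
      have inH: "v \<in> H" "g n \<in> H" "S v \<in> H" "S (g n) \<in> H" using v gD D_H S_H by auto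
      have "ip u (S (\<lambda>x. v x - g n x)) - ip f (\<lambda>x. v x - g n x) = ip u (S v) - ip f v"
        using inH uf' w(1) g(1) by (simp add: S_diff[OF v gD] ip_diff_right)
      then have "norm (ip u (S v) - ip f v) \<le> norm (ip u (S (\<lambda>x. v x - g n x))) + norm (ip f (\<lambda>x. v x - g n x))"
        by (metis norm_triangle_ineq4)
      also have "\<dots> \<le> K * form_norm (\<lambda>x. v x - g n x) + ip_norm f * ip_norm (\<lambda>x. v x - g n x)"
        using v gD uf' inH by (intro add_mono bound norm_ip_le D_diff H_diff)
      finally show ?thesis .
    qed
    have "(\<lambda>n. K * form_norm (\<lambda>x. v x - g n x) + ip_norm f * ip_norm (\<lambda>x. v x - g n x)) \<longlonglongrightarrow> K * 0 + ip_norm f * 0"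
      using g by (intro tendsto_intros)
    then have "norm (ip u (S v) - ip f v) \<le> K * 0 + ip_norm f * 0"
      by (rule LIMSEQ_le_const) (use * in auto)
    then show ?thesis by simp
  qed
  show ?thesis
  proof (intro equalityI subrelI)
    fix u f assume "(u, f) \<in> friedrichs_extension H ip D S"
    then show "(u, f) \<in> friedrichs_extension H ip D' S"
      using sup D' unfolding friedrichs_extension_def by auto
  next
    fix u f assume uf: "(u, f) \<in> friedrichs_extension H ip D' S"
    then show "(u, f) \<in> friedrichs_extension H ip D S"
      using sub ext[OF uf] unfolding friedrichs_extension_def by auto
  qed
qed

end

section \<open>The reflection and the cutoff estimate\<close>

lemma \<sigma>_\<sigma> [simp]: "\<sigma> (\<sigma> x) = x"
  by (simp add: vec_eq_iff forall_2)

lemma linear_\<sigma>: "linear \<sigma>"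
  by (rule linearI) (simp_all add: vec_eq_iff forall_2)

lemma bounded_linear_\<sigma>: "bounded_linear \<sigma>"
  using linear_\<sigma> by (rule linear_conv_bounded_linear[THEN iffD1])

definition axis_sign :: "2 \<Rightarrow> real" where "axis_sign j = (if j = 2 then -1 else 1)"

lemma \<sigma>_axis: "\<sigma> (axis j 1) = axis_sign j *\<^sub>R axis j 1"
  using exhaust_2[of j] by (auto simp: axis_sign_def vec_eq_iff forall_2 axis_def)

lemma partial_deriv_\<sigma>:
  assumes "f differentiable (at (\<sigma> x))"
  shows "partial_deriv j (\<lambda>x. f (\<sigma> x)) x = axis_sign j *\<^sub>R partial_deriv j f (\<sigma> x)"
    and "(\<lambda>x. f (\<sigma> x)) differentiable (at x)"
proof -
  have d: "(f has_derivative frechet_derivative f (at (\<sigma> x))) (at (\<sigma> x))"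
    using assms by (rule differentiable_has_frechet)
  have c: "((\<lambda>x. f (\<sigma> x)) has_derivative (\<lambda>h. frechet_derivative f (at (\<sigma> x)) (\<sigma> h))) (at x)"
    by (rule has_derivative_compose[OF bounded_linear_imp_has_derivative[OF bounded_linear_\<sigma>] d])
  show "partial_deriv j (\<lambda>x. f (\<sigma> x)) x = axis_sign j *\<^sub>R partial_deriv j f (\<sigma> x)"
    using partial_deriv_eqI[OF c, of j] linear_cmul[OF has_derivative_linear[OF d]]
    by (simp add: \<sigma>_axis partial_deriv_def)
  show "(\<lambda>x. f (\<sigma> x)) differentiable (at x)" using c by (rule differentiableI)
qed

lemma smooth_on_\<sigma>:
  assumes "smooth_on UNIV f"
  shows "smooth_on UNIV (\<lambda>x. f (\<sigma> x))"
proof -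
  have "ndiff_on k UNIV (\<lambda>x. f (\<sigma> x))" if "ndiff_on k UNIV f" for k
    using that
  proof (induction k arbitrary: f)
    case (Suc k)
    then show ?case
      by (intro ndiff_on_SucI[where g = "\<lambda>j x. axis_sign j *\<^sub>R partial_deriv j f (\<sigma> x)"]
          ndiff_on_bounded_linear[OF bounded_linear_scaleR_right]) (auto simp: partial_deriv_\<sigma>)
  qed simp
  then show ?thesis using assms by (simp add: smooth_on_def)
qed

lemma test_functions_\<sigma>:
  assumes "f \<in> test_functions U" "\<sigma> ` U = U"
  shows "(\<lambda>x. f (\<sigma> x)) \<in> test_functions U"
proof (rule test_functionsI[where K = "\<sigma> ` closure {x. f x \<noteq> 0}"])
  show "smooth_on UNIV (\<lambda>x. f (\<sigma> x))" by (rule smooth_on_\<sigma>[OF test_functionsD(1)[OF assms(1)]])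
  show "compact (\<sigma> ` closure {x. f x \<noteq> 0})"
    by (rule compact_continuous_image[OF linear_continuous_on[OF bounded_linear_\<sigma>] test_functionsD(2)[OF assms(1)]])
  show "{x. f (\<sigma> x) \<noteq> 0} \<subseteq> \<sigma> ` closure {x. f x \<noteq> 0}"
  proof
    fix x assume "x \<in> {x. f (\<sigma> x) \<noteq> 0}"
    then have "\<sigma> x \<in> closure {x. f x \<noteq> 0}" using closure_subset[of "{x. f x \<noteq> 0}"] by auto
    then show "x \<in> \<sigma> ` closure {x. f x \<noteq> 0}" by (metis \<sigma>_\<sigma> image_eqI)
  qed
  show "\<sigma> ` closure {x. f x \<noteq> 0} \<subseteq> U" using test_functionsD(3)[OF assms(1)] assms(2) by blast
qed

text \<open>In coordinates \<sigma> scales each axis by 1 or -1, so its Jacobian has modulus 1 and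
  the affine change of variables introduces no density.\<close>

lemma \<sigma>_lebesgue: "\<sigma> \<in> lebesgue \<rightarrow>\<^sub>M lebesgue" "distr lebesgue lebesgue \<sigma> = lebesgue"
proof -
  define c :: "real ^ 2 \<Rightarrow> real" where "c b = (if b = axis 2 1 then -1 else 1)" for b
  have \<sigma>: "\<sigma> = (\<lambda>x. 0 + (\<Sum>j\<in>Basis. (c j * (x \<bullet> j)) *\<^sub>R j))"
  proof
    fix x
    show "\<sigma> x = 0 + (\<Sum>j\<in>Basis. (c j * (x \<bullet> j)) *\<^sub>R j)"
    proof (rule euclidean_eqI)
      fix b :: "real ^ 2" assume b: "b \<in> Basis"
      then obtain i where i: "b = axis i 1" by (auto simp: Basis_vec_def)
      have "\<sigma> x \<bullet> b = c b * (x \<bullet> b)"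
        using exhaust_2[of i] by (auto simp: i c_def inner_axis axis_eq_axis)
      then show "\<sigma> x \<bullet> b = (0 + (\<Sum>j\<in>Basis. (c j * (x \<bullet> j)) *\<^sub>R j)) \<bullet> b"
        using b by (simp add: inner_sum_left_Basis)
    qed
  qed
  have c: "\<And>j. j \<in> Basis \<Longrightarrow> c j \<noteq> 0" by (simp add: c_def)
  show "\<sigma> \<in> lebesgue \<rightarrow>\<^sub>M lebesgue" unfolding \<sigma> by (rule lebesgue_affine_measurable[OF c])
  have "(\<Prod>j\<in>(Basis :: (real ^ 2) set). \<bar>c j\<bar>) = 1" by (intro prod.neutral) (simp add: c_def)
  then have "lebesgue = density (distr lebesgue lebesgue \<sigma>) (\<lambda>_. 1)"
    using lebesgue_affine_euclidean[of c 0, OF c] unfolding \<sigma>[symmetric] by (simp add: one_ennreal_def)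
  then show "distr lebesgue lebesgue \<sigma> = lebesgue" by (simp add: density_1)
qed

section \<open>The reflection acting on the domain\<close>

locale symmetric_domain = bounded_open \<Omega> for \<Omega> :: "(real ^ 2) set" +
  assumes \<sigma>_\<Omega>: "\<sigma> ` \<Omega> = \<Omega>"
begin

lemma \<sigma>_in_iff: "\<sigma> x \<in> \<Omega> \<longleftrightarrow> x \<in> \<Omega>"
  using \<sigma>_\<Omega> by (metis \<sigma>_\<sigma> image_eqI)

lemma measurable_\<sigma>: "\<sigma> \<in> lebesgue_on \<Omega> \<rightarrow>\<^sub>M lebesgue_on \<Omega>"
proof (rule measurable_restrict_space2)
  show "\<sigma> \<in> space (lebesgue_on \<Omega>) \<rightarrow> \<Omega>" by (auto simp: space_\<Omega> \<sigma>_in_iff)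
  show "\<sigma> \<in> lebesgue_on \<Omega> \<rightarrow>\<^sub>M lebesgue" using \<sigma>_lebesgue(1) by (rule measurable_restrict_space1)
qed

lemma distr_\<sigma>: "distr (lebesgue_on \<Omega>) (lebesgue_on \<Omega>) \<sigma> = lebesgue_on \<Omega>"
proof (rule measure_eqI)
  fix X assume "X \<in> sets (distr (lebesgue_on \<Omega>) (lebesgue_on \<Omega>) \<sigma>)"
  then have X: "X \<in> sets (lebesgue_on \<Omega>)" by simp
  then have X': "X \<in> sets lebesgue" "X \<subseteq> \<Omega>" using sets_\<Omega> by (auto simp: sets_restrict_space_iff)
  have sub: "\<sigma> -` X \<subseteq> \<Omega>" using X'(2) \<sigma>_in_iff by blast
  have "emeasure (distr (lebesgue_on \<Omega>) (lebesgue_on \<Omega>) \<sigma>) X = emeasure (lebesgue_on \<Omega>) (\<sigma> -` X)"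
    using X sub by (simp add: emeasure_distr[OF measurable_\<sigma>] space_\<Omega> Int_absorb2)
  also have "\<dots> = emeasure lebesgue (\<sigma> -` X)" using sub sets_\<Omega> by (intro emeasure_restrict_space) auto
  also have "\<dots> = emeasure (distr lebesgue lebesgue \<sigma>) X" using X' by (simp add: emeasure_distr[OF \<sigma>_lebesgue(1)])
  also have "\<dots> = emeasure lebesgue X" by (simp add: \<sigma>_lebesgue(2))
  also have "\<dots> = emeasure (lebesgue_on \<Omega>) X" using X' sets_\<Omega> by (intro emeasure_restrict_space[symmetric]) auto
  finally show "emeasure (distr (lebesgue_on \<Omega>) (lebesgue_on \<Omega>) \<sigma>) X = emeasure (lebesgue_on \<Omega>) X" .
qed simp

lemma AE_\<sigma>:
  assumes "AE x in lebesgue_on \<Omega>. P x"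
  shows "AE x in lebesgue_on \<Omega>. P (\<sigma> x)"
proof (rule AE_distrD[OF measurable_\<sigma>])
  show "AE x in distr (lebesgue_on \<Omega>) (lebesgue_on \<Omega>) \<sigma>. P x" unfolding distr_\<sigma> by (rule assms)
qed

lemma integral_\<sigma>:
  fixes f :: "real ^ 2 \<Rightarrow> 'b::{banach, second_countable_topology}"
  assumes "f \<in> borel_measurable (lebesgue_on \<Omega>)"
  shows "(LINT x|lebesgue_on \<Omega>. f (\<sigma> x)) = (LINT x|lebesgue_on \<Omega>. f x)"
  using integral_distr[OF measurable_\<sigma> assms] by (simp add: distr_\<sigma>)

lemma L2_\<sigma>:
  fixes u :: "real ^ 2 \<Rightarrow> 's::{real_normed_field, banach, second_countable_topology}"
  assumes "u \<in> L2 \<Omega>"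
  shows "(\<lambda>x. u (\<sigma> x)) \<in> L2 \<Omega>"
proof -
  have m: "u \<in> borel_measurable (lebesgue_on \<Omega>)" using assms by (simp add: L2_def)
  have "integrable (distr (lebesgue_on \<Omega>) (lebesgue_on \<Omega>) \<sigma>) (\<lambda>x. (norm (u x))\<^sup>2)"
    unfolding distr_\<sigma> using assms by (simp add: L2_def)
  then have "integrable (lebesgue_on \<Omega>) (\<lambda>x. (norm (u (\<sigma> x)))\<^sup>2)"
    by (rule integrable_distr[OF measurable_\<sigma>])
  then show ?thesis using measurable_compose[OF measurable_\<sigma> m] by (simp add: L2_def)
qed

text \<open>A hyperplane is negligible. All cuts lie in this one, so identities that fail on a cut
  still hold almost everywhere.\<close>

lemma AE_off_axis: "AE x in lebesgue_on \<Omega>. x $ 2 \<noteq> 0"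
proof -
  have "negligible {x :: real ^ 2. x \<bullet> axis 2 1 = 0}"
    by (rule negligible_standard_hyperplane) (auto simp: Basis_vec_def)
  then have "{x :: real ^ 2. x $ 2 = 0} \<in> null_sets lebesgue"
    by (simp add: inner_axis negligible_iff_null_sets)
  then have "AE x in lebesgue. x \<notin> {x :: real ^ 2. x $ 2 = 0}" by (rule AE_not_in)
  then show ?thesis using sets_\<Omega>
    by (simp add: AE_restrict_space_iff) (auto elim: eventually_mono)
qed

end

text \<open>The potential is kept inside the magnetic derivatives of \<open>v\<close>, which are
  bounded for a test function. Derivatives of \<open>e\<close> then occur without it, and the second
  derivative of \<open>e\<close> meets only \<open>v\<close> itself.\<close>

lemma magnetic_laplacian_mult:
  assumes e: "smooth_on UNIV e" and v: "smooth_on UNIV v" "\<And>j. smooth_on UNIV (magnetic_deriv A j v)"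
  shows "magnetic_laplacian A (\<lambda>x. e x * v x) x =
    (\<Sum>j\<in>UNIV. - partial_deriv j (partial_deriv j e) x * v x
       + 2 * \<i> * partial_deriv j e x * magnetic_deriv A j v x + e x * magnetic_deriv A j (magnetic_deriv A j v) x)"
proof -
  have d: "e differentiable (at x)" "v differentiable (at x)" "partial_deriv j e differentiable (at x)"
    "magnetic_deriv A j v differentiable (at x)" for x j
    using e v smooth_on_differentiable smooth_on_partial by blast+
  have 1: "magnetic_deriv A j (\<lambda>x. e x * v x) = (\<lambda>x. \<i> * (partial_deriv j e x * v x) + e x * magnetic_deriv A j v x)" for j
    by (simp add: magnetic_deriv_def fun_eq_iff partial_deriv_mult[OF d(1,2)] algebra_simps)
  have 2: "partial_deriv j (\<lambda>x. \<i> * (partial_deriv j e x * v x) + e x * magnetic_deriv A j v x) x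
    = \<i> * (partial_deriv j e x * partial_deriv j v x + partial_deriv j (partial_deriv j e) x * v x)
      + (e x * partial_deriv j (magnetic_deriv A j v) x + partial_deriv j e x * magnetic_deriv A j v x)" for j
    using d by (simp add: partial_deriv_add partial_deriv_bounded_linear[OF bounded_linear_mult_right] partial_deriv_mult)
  show ?thesis
    unfolding magnetic_laplacian_def 1
    by (rule sum.cong[OF refl], subst magnetic_deriv_def, subst 2)
       (simp add: magnetic_deriv_def algebra_simps)
qed

lemma partial_deriv_of_real:
  assumes "smooth_on UNIV h"
  shows "partial_deriv j (\<lambda>x. complex_of_real (h x)) = (\<lambda>x. of_real (partial_deriv j h x))"
  using partial_deriv_bounded_linear[OF bounded_linear_of_real smooth_on_differentiable[OF assms]] by auto

context magnetic_form
begin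

text \<open>On the support of \<open>\<eta> n\<close> the function \<open>v\<close> is O(1/n), hence
  so is the product \<open>d n\<close>. Its magnetic Laplacian is only O(n), because the second
  derivative of size n^2 is multiplied by \<open>v\<close>. The integrand of the form is therefore
  bounded, and at each point off the axis it is eventually 0.\<close>

lemma cutoff_form_tendsto_0:
  assumes v: "v \<in> test_functions U" and \<eta>: "cutoffs_near N \<eta>" and N: "\<And>y. y \<in> N \<Longrightarrow> v y = 0"
    and axis: "AE x in lebesgue_on \<Omega>. x $ 2 \<noteq> 0"
  shows "(\<lambda>n. L2_inner_complex \<Omega> (\<lambda>x. of_real (\<eta> n x) * v x) (\<lambda>x. of_real (\<eta> n x) * v x)) \<longlonglongrightarrow> 0"
    and "(\<lambda>n. form (\<lambda>x. of_real (\<eta> n x) * v x) (\<lambda>x. of_real (\<eta> n x) * v x)) \<longlonglongrightarrow> 0"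
proof -
  define d where "d n x = complex_of_real (\<eta> n x) * v x" for n x
  have seq: "cutoff_seq \<eta>" using \<eta> unfolding cutoffs_near_def by blast
  obtain C where C: "\<And>n x. \<bar>\<eta> n x\<bar> \<le> C" "\<And>n x j. \<bar>partial_deriv j (\<eta> n) x\<bar> \<le> C * real (Suc n)"
    "\<And>n x j. \<bar>partial_deriv j (partial_deriv j (\<eta> n)) x\<bar> \<le> C * (real (Suc n))\<^sup>2"
    using seq unfolding cutoff_seq_def by blast
  obtain R0 where R0: "\<And>n x. \<eta> n x \<noteq> 0 \<Longrightarrow> \<exists>y\<in>N. norm (x - y) \<le> R0 / real (Suc n)"
    using \<eta> unfolding cutoffs_near_def by blast
  \<comment> \<open>The constant \<open>R0\<close> comes without a sign; its absolute value keeps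
    the products below nonnegative.\<close>
  define R where "R = \<bar>R0\<bar>"
  have s: "smooth_on UNIV (\<eta> n)" for n using seq unfolding cutoff_seq_def by blast
  have ev: "\<forall>\<^sub>F n in sequentially. \<eta> n x = 0" if "x $ 2 \<noteq> 0" for x
    using \<eta> that unfolding cutoffs_near_def by blast
  have sc: "smooth_on UNIV (\<lambda>x. complex_of_real (\<eta> n x))" for n
    using s by (intro smooth_on_bounded_linear[OF bounded_linear_of_real]) auto
  have d: "d n \<in> test_functions U" for n
    unfolding d_def[abs_def] by (rule test_functions_mult[OF v open_UNIV _ sc]) simp
  obtain L where L: "0 < L" "\<And>x y. norm (v x - v y) \<le> L * norm (x - y)" using test_functions_Lipschitz[OF v] by blast
  have "\<forall>j. \<exists>K. 0 < K \<and> (\<forall>x. norm (magnetic_deriv A j v x) \<le> K)"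
    using test_functions_bounded[OF magnetic_deriv_test[OF v]] by metis
  then obtain K1 where K1: "\<And>j. 0 < K1 j" "\<And>j x. norm (magnetic_deriv A j v x) \<le> K1 j" by metis
  have "\<forall>j. \<exists>K. 0 < K \<and> (\<forall>x. norm (magnetic_deriv A j (magnetic_deriv A j v) x) \<le> K)"
    using test_functions_bounded[OF magnetic_deriv_test[OF magnetic_deriv_test[OF v]]] by metis
  then obtain K2 where K2: "\<And>j. 0 < K2 j" "\<And>j x. norm (magnetic_deriv A j (magnetic_deriv A j v) x) \<le> K2 j" by metis
  have C0: "0 \<le> C" using C(1)[of undefined undefined] by linarith
  have small: "norm (v x) * real (Suc n) \<le> L * R" if "\<eta> n x \<noteq> 0" for n x
  proof -
    obtain y where y: "y \<in> N" "norm (x - y) \<le> R0 / real (Suc n)" using R0 \<open>\<eta> n x \<noteq> 0\<close> by blast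
    have "R0 / real (Suc n) \<le> R / real (Suc n)" unfolding R_def by (intro divide_right_mono) auto
    then have yR: "norm (x - y) \<le> R / real (Suc n)" using y(2) by linarith
    have "norm (v x) \<le> L * norm (x - y)" using L(2)[of x y] N[OF y(1)] by simp
    also have "\<dots> \<le> L * (R / real (Suc n))" using yR L(1) by (intro mult_left_mono) auto
    finally show ?thesis by (simp add: field_simps del: of_nat_Suc)
  qed
  have LR: "0 \<le> L * R" using L(1) by (simp add: R_def)
  have bound_d: "norm (d n x) * real (Suc n) \<le> C * (L * R)" if "\<eta> n x \<noteq> 0" for n x
  proof -
    have "norm (d n x) * real (Suc n) = \<bar>\<eta> n x\<bar> * (norm (v x) * real (Suc n))" by (simp add: d_def norm_mult)
    also have "\<dots> \<le> C * (L * R)" by (intro mult_mono[of _ C _ "L * R"] C(1) small[OF that] C0) auto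
    finally show ?thesis .
  qed
  \<comment> \<open>For each coordinate the three summands bound the three Leibniz terms after
    division by n + 1.\<close>
  define M where "M = (\<Sum>j\<in>UNIV. C * (L * R) + 2 * C * K1 j + C * K2 j)"
  have "0 \<le> C * (L * R) + 2 * C * K1 j + C * K2 j" for j
    using C0 K1(1)[of j] K2(1)[of j] mult_nonneg_nonneg[OF C0 LR] by simp
  then have M0: "0 \<le> M" unfolding M_def by (intro sum_nonneg) auto
  have bound_S: "norm (magnetic_laplacian A (d n) x) \<le> M * real (Suc n)" if nz: "\<eta> n x \<noteq> 0" for n x
  proof -
    let ?m = "real (Suc n)"
    have "magnetic_laplacian A (d n) x = (\<Sum>j\<in>UNIV. - of_real (partial_deriv j (partial_deriv j (\<eta> n)) x) * v x
       + 2 * \<i> * of_real (partial_deriv j (\<eta> n) x) * magnetic_deriv A j v x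
       + of_real (\<eta> n x) * magnetic_deriv A j (magnetic_deriv A j v) x)"
      unfolding d_def[abs_def]
      using magnetic_laplacian_mult[OF sc test_functionsD(1)[OF v] test_functionsD(1)[OF magnetic_deriv_test[OF v]]]
      by (simp add: partial_deriv_of_real s smooth_on_partial)
    also have "norm \<dots> \<le> (\<Sum>j\<in>UNIV. (C * (L * R) + 2 * C * K1 j + C * K2 j) * ?m)"
    proof (rule sum_norm_le)
      fix j
      have 1: "\<bar>partial_deriv j (partial_deriv j (\<eta> n)) x\<bar> * norm (v x) \<le> C * (L * R) * ?m"
      proof -
        have "\<bar>partial_deriv j (partial_deriv j (\<eta> n)) x\<bar> * norm (v x) \<le> C * ?m\<^sup>2 * norm (v x)"
          using C(3) by (intro mult_right_mono) auto
        also have "\<dots> = C * (norm (v x) * ?m) * ?m" by (simp add: power2_eq_square)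
        also have "\<dots> \<le> C * (L * R) * ?m"
          using small[OF nz] C0 by (intro mult_right_mono mult_left_mono) auto
        finally show ?thesis .
      qed
      have 2: "\<bar>partial_deriv j (\<eta> n) x\<bar> * norm (magnetic_deriv A j v x) \<le> (C * ?m) * K1 j"
        using C(2) K1(2) C0 by (intro mult_mono) auto
      have "\<bar>\<eta> n x\<bar> * norm (magnetic_deriv A j (magnetic_deriv A j v) x) \<le> C * K2 j"
        using C(1) K2(2) C0 by (intro mult_mono) auto
      also have "\<dots> \<le> C * K2 j * ?m" using C0 K2(1)[of j] mult_left_mono[of 1 ?m "C * K2 j"] by simp
      finally have 3: "\<bar>\<eta> n x\<bar> * norm (magnetic_deriv A j (magnetic_deriv A j v) x) \<le> C * K2 j * ?m" .
      have "norm (- of_real (partial_deriv j (partial_deriv j (\<eta> n)) x) * v x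
         + 2 * \<i> * of_real (partial_deriv j (\<eta> n) x) * magnetic_deriv A j v x
         + of_real (\<eta> n x) * magnetic_deriv A j (magnetic_deriv A j v) x)
        \<le> norm (- of_real (partial_deriv j (partial_deriv j (\<eta> n)) x) * v x)
         + norm (2 * \<i> * of_real (partial_deriv j (\<eta> n) x) * magnetic_deriv A j v x)
         + norm (of_real (\<eta> n x) * magnetic_deriv A j (magnetic_deriv A j v) x)"
        by (intro order_trans[OF norm_triangle_ineq] add_right_mono norm_triangle_ineq)
      also have "\<dots> = \<bar>partial_deriv j (partial_deriv j (\<eta> n)) x\<bar> * norm (v x)
         + 2 * (\<bar>partial_deriv j (\<eta> n) x\<bar> * norm (magnetic_deriv A j v x))
         + \<bar>\<eta> n x\<bar> * norm (magnetic_deriv A j (magnetic_deriv A j v) x)"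
        by (simp add: norm_mult)
      also have "\<dots> \<le> C * (L * R) * ?m + 2 * ((C * ?m) * K1 j) + C * K2 j * ?m" using 1 2 3 by linarith
      also have "\<dots> = (C * (L * R) + 2 * C * K1 j + C * K2 j) * ?m" by (simp add: algebra_simps del: of_nat_Suc)
      finally show "norm (- of_real (partial_deriv j (partial_deriv j (\<eta> n)) x) * v x
         + 2 * \<i> * of_real (partial_deriv j (\<eta> n) x) * magnetic_deriv A j v x
         + of_real (\<eta> n x) * magnetic_deriv A j (magnetic_deriv A j v) x)
         \<le> (C * (L * R) + 2 * C * K1 j + C * K2 j) * ?m" .
    qed
    also have "\<dots> = M * ?m" unfolding M_def by (rule sum_distrib_right[symmetric])
    finally show ?thesis .
  qed
  have eventually_0: "AE x in lebesgue_on \<Omega>. \<forall>\<^sub>F n in sequentially. w n x * cnj (d n x) = 0" for w :: "nat \<Rightarrow> real ^ 2 \<Rightarrow> complex"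
    using axis
  proof eventually_elim
    case (elim x)
    show ?case using ev[OF elim] by eventually_elim (simp add: d_def)
  qed
  have meas: "(\<lambda>x. w x * cnj (d n x)) \<in> borel_measurable (lebesgue_on \<Omega>)" if "w \<in> test_functions U" for w n
    using L2_inner_complex_integrable[OF test_L2[OF that] test_L2[OF d[of n]]] by (rule borel_measurable_integrable)
  have "(\<lambda>n. LINT x|lebesgue_on \<Omega>. magnetic_laplacian A (d n) x * cnj (d n x)) \<longlonglongrightarrow> 0"
  proof (rule integral_tendsto_0)
    show "(\<lambda>x. magnetic_laplacian A (d n) x * cnj (d n x)) \<in> borel_measurable (lebesgue_on \<Omega>)" for n
      by (intro meas magnetic_laplacian_test d)
    show "norm (magnetic_laplacian A (d n) x * cnj (d n x)) \<le> M * (C * (L * R))" for n x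
    proof (cases "\<eta> n x = 0")
      case True
      then show ?thesis using M0 C0 LR by (simp add: d_def)
    next
      case False
      have "norm (magnetic_laplacian A (d n) x * cnj (d n x)) \<le> (M * real (Suc n)) * norm (d n x)"
        unfolding norm_mult complex_mod_cnj by (intro mult_right_mono bound_S False) auto
      also have "\<dots> = M * (norm (d n x) * real (Suc n))" by simp
      also have "\<dots> \<le> M * (C * (L * R))" by (intro mult_left_mono bound_d False M0)
      finally show ?thesis .
    qed
  qed (rule eventually_0)
  then show "(\<lambda>n. form (\<lambda>x. of_real (\<eta> n x) * v x) (\<lambda>x. of_real (\<eta> n x) * v x)) \<longlonglongrightarrow> 0"
    by (simp add: L2_inner_complex_def d_def[abs_def])
  obtain K where K: "0 < K" "\<And>x. norm (v x) \<le> K" using test_functions_bounded[OF v] by blast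
  have dK: "norm (d n x) \<le> C * K" for n x
    unfolding d_def norm_mult using C(1) K C0 by (intro mult_mono) auto
  have "(\<lambda>n. LINT x|lebesgue_on \<Omega>. d n x * cnj (d n x)) \<longlonglongrightarrow> 0"
  proof (rule integral_tendsto_0)
    show "(\<lambda>x. d n x * cnj (d n x)) \<in> borel_measurable (lebesgue_on \<Omega>)" for n by (intro meas d)
    show "norm (d n x * cnj (d n x)) \<le> (C * K) * (C * K)" for n x
      unfolding norm_mult complex_mod_cnj using dK C0 K(1) by (intro mult_mono) auto
  qed (rule eventually_0)
  then show "(\<lambda>n. L2_inner_complex \<Omega> (\<lambda>x. of_real (\<eta> n x) * v x) (\<lambda>x. of_real (\<eta> n x) * v x)) \<longlonglongrightarrow> 0"
    by (simp add: L2_inner_complex_def d_def[abs_def])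
qed

end

section \<open>Gauge factors\<close>

definition sq_dist :: "real \<Rightarrow> real ^ 2 \<Rightarrow> real" where
  "sq_dist a x = (x $ 1 - a)\<^sup>2 + (x $ 2)\<^sup>2"

text \<open>The gradient of the polar angle around \<open>pole a\<close>.\<close>

definition angular :: "real \<Rightarrow> real ^ 2 \<Rightarrow> 2 \<Rightarrow> real" where
  "angular a x j = (if j = 1 then - x $ 2 else x $ 1 - a) / sq_dist a x"

text \<open>The unit complex number e^{i\<theta>}, where \<theta> is the polar angle around
  \<open>pole a\<close>; it is 0 at the pole.\<close>

definition direction :: "real \<Rightarrow> real ^ 2 \<Rightarrow> complex" where
  "direction a x = (of_real (x $ 1 - a) + \<i> * of_real (x $ 2)) * of_real (inverse (sqrt (sq_dist a x)))"

text \<open>The square \<open>e\<^bsup>2i\<phi>\<^esup>\<close> of the gauge factor, where locally \<open>A = \<nabla>\<phi>\<close>.\<close>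

definition gauge_square :: "real \<Rightarrow> real \<Rightarrow> real ^ 2 \<Rightarrow> complex" where
  "gauge_square am ap x = cnj (direction am x) * direction ap x"

lemma vec2_eq_iff: "(x :: 'a ^ 2) = y \<longleftrightarrow> x $ 1 = y $ 1 \<and> x $ 2 = y $ 2"
  by (simp add: vec_eq_iff forall_2)

lemma sq_dist_pos_iff: "0 < sq_dist a x \<longleftrightarrow> x \<noteq> pole a"
  by (simp add: sq_dist_def pole_def vec2_eq_iff sum_power2_gt_zero_iff)

lemma sq_dist_pole [simp]: "sq_dist a (pole a) = 0"
  by (simp add: sq_dist_def pole_def)

lemma open_minus_pole: "open (- {pole a})" "open (- {pole a, pole b})"
  by (auto intro!: open_Compl finite_imp_closed)

lemma smooth_on_sq_dist: "open U \<Longrightarrow> smooth_on U (sq_dist a)"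
  unfolding sq_dist_def[abs_def] power2_eq_square
  by (intro smooth_on_add smooth_on_mult smooth_on_diff smooth_on_component smooth_on_const)

lemma smooth_on_angular: "smooth_on (- {pole a}) (\<lambda>x. angular a x j)"
proof -
  have "smooth_on (- {pole a}) (\<lambda>x. inverse (sq_dist a x))"
    using sq_dist_pos_iff[of a] by (intro smooth_on_inverse smooth_on_sq_dist) (auto simp: open_minus_pole less_imp_neq[symmetric])
  moreover have "smooth_on (- {pole a}) (\<lambda>x. 0 - x $ 2)" "smooth_on (- {pole a}) (\<lambda>x. x $ 1 - a)"
    by (intro smooth_on_diff smooth_on_component smooth_on_const open_minus_pole)+
  then have "smooth_on (- {pole a}) (\<lambda>x. if j = 1 then - x $ 2 else x $ 1 - a)" by (cases "j = 1") simp_all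
  ultimately have "smooth_on (- {pole a}) (\<lambda>x. (if j = 1 then - x $ 2 else x $ 1 - a) * inverse (sq_dist a x))"
    by (intro smooth_on_mult open_minus_pole)
  then show ?thesis by (simp add: angular_def divide_inverse)
qed

text \<open>This displays \<phi> as half the difference of the polar angles around the two poles.
  The factor 1/2 is what makes e^{i\<phi>} two-valued and e^{2i\<phi>} single-valued.\<close>

lemma AB_potential_eq: "AB_potential am ap x $ j = (angular ap x j - angular am x j) / 2"
proof -
  have *: "- (1/2) * (1 / q * c) + (1/2) * (1 / q' * c') = (c' / q' - c / q) / 2" for q q' c c' :: real
    by (simp add: diff_divide_distrib)
  have n2: "((2 :: 2) = 1) = False" by simp
  consider "j = 1" | "j = 2" using exhaust_2[of j] by blast
  then show ?thesis
    by cases (simp_all only: AB_potential_def angular_def sq_dist_def vector_add_component vector_scaleR_component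
        vector_2 real_scaleR_def * n2 if_True if_False simp_thms)
qed

lemma smooth_on_AB_potential: "smooth_on (- {pole am, pole ap}) (\<lambda>x. AB_potential am ap x $ j)"
proof -
  have "smooth_on (- {pole am, pole ap}) (\<lambda>x. (1 / 2) * (angular ap x j - angular am x j))"
    by (intro smooth_on_mult smooth_on_diff smooth_on_const open_minus_pole smooth_on_subset[OF smooth_on_angular]) auto
  then show ?thesis by (simp add: AB_potential_eq[abs_def])
qed

lemma partial_deriv_sq_dist: "partial_deriv j (sq_dist a) x = (if j = 1 then 2 * (x $ 1 - a) else 2 * x $ 2)"
proof -
  have c: "((\<lambda>x. x $ i) has_derivative (\<lambda>h. h $ i)) (at x)" for i :: 2
    by (rule bounded_linear_imp_has_derivative[OF bounded_linear_vec_nth])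
  have "(sq_dist a has_derivative (\<lambda>h. 2 * (x $ 1 - a) * h $ 1 + 2 * (x $ 2) * h $ 2)) (at x)"
    unfolding sq_dist_def[abs_def] by (auto intro!: derivative_eq_intros c)
  from partial_deriv_eqI[OF this] show ?thesis using exhaust_2[of j] by (auto simp: axis_def)
qed

text \<open>The rule d e^{i\<theta>} = i e^{i\<theta>} d\<theta>, derived from the explicit quotient
  so that no branch of the angle is chosen.\<close>

lemma direction_derivative:
  assumes "x \<noteq> pole a"
  shows "direction a differentiable (at x)"
    and "partial_deriv j (direction a) x = \<i> * of_real (angular a x j) * direction a x"
proof -
  define q where "q = sq_dist a x"
  have q: "q > 0" using assms by (simp add: q_def sq_dist_pos_iff)
  define P where "P y = complex_of_real (y $ 1 - a) + \<i> * of_real (y $ 2)" for y :: "real ^ 2"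
  define h where "h y = inverse (sqrt (sq_dist a y))" for y
  have "((\<lambda>s. inverse (sqrt s)) has_real_derivative - (inverse (sqrt q) / (2 * q))) (at q)"
  proof -
    have "(sqrt has_real_derivative inverse (sqrt q) / 2) (at q)" using DERIV_real_sqrt[OF q] by simp
    from DERIV_inverse_fun[OF this] q show ?thesis
      by (simp add: field_simps power2_eq_square)
  qed
  note hd' = partial_deriv_comp_real[OF smooth_on_differentiable[OF smooth_on_sq_dist[OF open_UNIV] UNIV_I] this[unfolded q_def]]
  have hd: "h differentiable (at x)" "partial_deriv j h x = - (inverse (sqrt q) / (2 * q)) * partial_deriv j (sq_dist a) x"
    unfolding h_def[abs_def] q_def by (rule hd')+
  have P: "(P has_derivative (\<lambda>k. of_real (k $ 1) + \<i> * of_real (k $ 2))) (at x)"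
  proof -
    have c: "((\<lambda>x. x $ i) has_derivative (\<lambda>h. h $ i)) (at x)" for i :: 2
      by (rule bounded_linear_imp_has_derivative[OF bounded_linear_vec_nth])
    show ?thesis unfolding P_def[abs_def] by (auto intro!: derivative_eq_intros c)
  qed
  have pP: "partial_deriv j P x = (if j = 1 then 1 else \<i>)"
    using partial_deriv_eqI[OF P] exhaust_2[of j] by (auto simp: axis_def)
  have hc: "(\<lambda>y. complex_of_real (h y)) differentiable (at x)"
    "partial_deriv j (\<lambda>y. complex_of_real (h y)) x = of_real (partial_deriv j h x)"
    using bounded_linear.has_derivative[OF bounded_linear_of_real differentiable_has_frechet[OF hd(1)]]
      partial_deriv_bounded_linear[OF bounded_linear_of_real hd(1)] by (auto intro: differentiableI)
  have dir: "direction a = (\<lambda>y. P y * of_real (h y))" by (simp add: fun_eq_iff direction_def P_def h_def)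
  show "direction a differentiable (at x)"
    unfolding dir by (intro differentiable_mult differentiableI[OF P] hc)
  have "partial_deriv j (direction a) x = P x * of_real (partial_deriv j h x) + partial_deriv j P x * of_real (h x)"
    unfolding dir by (subst partial_deriv_mult[OF differentiableI[OF P] hc(1)]) (simp add: hc)
  also have "\<dots> = of_real (h x) * (partial_deriv j P x - P x * of_real (partial_deriv j (sq_dist a) x / (2 * q)))"
    by (simp add: hd(2) h_def q_def[symmetric] algebra_simps)
  also have "partial_deriv j P x - P x * of_real (partial_deriv j (sq_dist a) x / (2 * q)) = \<i> * of_real (angular a x j) * P x"
  proof -
    \<comment> \<open>Multiplication by \<open>q\<close> clears the denominators; what remains is
      polynomial and is checked on real and imaginary parts.\<close>
    have "complex_of_real q * (partial_deriv j P x - P x * of_real (partial_deriv j (sq_dist a) x / (2 * q)))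
      = of_real q * partial_deriv j P x - P x * of_real (partial_deriv j (sq_dist a) x / 2)"
      using q by (simp add: right_diff_distrib)
    also have "\<dots> = of_real q * (\<i> * of_real (angular a x j) * P x)"
    proof -
      have qa: "complex_of_real q * of_real (angular a x j) = of_real (if j = 1 then - x $ 2 else x $ 1 - a)"
      proof -
        have "q * angular a x j = (if j = 1 then - x $ 2 else x $ 1 - a)" using q by (simp add: angular_def q_def)
        then show ?thesis by (simp only: of_real_mult[symmetric])
      qed
      have "of_real q * partial_deriv j P x - P x * of_real (partial_deriv j (sq_dist a) x / 2)
        = \<i> * of_real (if j = 1 then - x $ 2 else x $ 1 - a) * P x"
        unfolding pP partial_deriv_sq_dist
        by (simp add: q_def sq_dist_def P_def complex_eq_iff power2_eq_square algebra_simps add_divide_distrib diff_divide_distrib)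
      also have "\<dots> = of_real q * (\<i> * of_real (angular a x j) * P x)"
        unfolding qa[symmetric] by (simp only: mult_ac)
      finally show ?thesis .
    qed
    finally show ?thesis using q by simp
  qed
  finally show "partial_deriv j (direction a) x = \<i> * of_real (angular a x j) * direction a x"
    by (simp add: dir)
qed

lemma norm_direction: "x \<noteq> pole a \<Longrightarrow> norm (direction a x) = 1"
proof -
  assume "x \<noteq> pole a"
  then have q: "sq_dist a x > 0" by (simp add: sq_dist_pos_iff)
  have n: "norm (complex_of_real (x $ 1 - a) + \<i> * of_real (x $ 2)) = sqrt (sq_dist a x)"
    by (simp add: cmod_def sq_dist_def)
  have "norm (direction a x) = sqrt (sq_dist a x) * \<bar>inverse (sqrt (sq_dist a x))\<bar>"
    unfolding direction_def norm_mult norm_of_real n ..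
  then show ?thesis using q by simp
qed

lemma direction_pole [simp]: "direction a (pole a) = 0"
  by (simp add: direction_def)

lemma direction_\<sigma>: "direction a (\<sigma> x) = cnj (direction a x)"
  by (simp add: direction_def sq_dist_def)

lemma gauge_square_\<sigma>: "gauge_square am ap (\<sigma> x) = cnj (gauge_square am ap x)"
  by (simp add: gauge_square_def direction_\<sigma>)

lemma norm_gauge_square: "x \<noteq> pole am \<Longrightarrow> x \<noteq> pole ap \<Longrightarrow> norm (gauge_square am ap x) = 1"
  by (simp add: gauge_square_def norm_mult norm_direction)

lemma gauge_square_pole [simp]: "gauge_square am ap (pole am) = 0" "gauge_square am ap (pole ap) = 0"
  by (simp_all add: gauge_square_def)

text \<open>The conjugate reverses the angle around \<open>pole am\<close>, so the logarithmic
  derivative is i times the difference of the two angular gradients, which is twice the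
  potential.\<close>

lemma gauge_square_derivative:
  assumes "x \<noteq> pole am" "x \<noteq> pole ap"
  shows "gauge_square am ap differentiable (at x)"
    and "partial_deriv j (gauge_square am ap) x = 2 * \<i> * of_real (AB_potential am ap x $ j) * gauge_square am ap x"
proof -
  have c: "(\<lambda>x. cnj (direction am x)) differentiable (at x)"
    using bounded_linear.has_derivative[OF bounded_linear_cnj differentiable_has_frechet[OF direction_derivative(1)[OF assms(1)]]]
    by (rule differentiableI)
  show "gauge_square am ap differentiable (at x)"
    unfolding gauge_square_def[abs_def] by (rule differentiable_mult[OF c direction_derivative(1)[OF assms(2)]])
  show "partial_deriv j (gauge_square am ap) x = 2 * \<i> * of_real (AB_potential am ap x $ j) * gauge_square am ap x"
    unfolding gauge_square_def[abs_def] partial_deriv_mult[OF c direction_derivative(1)[OF assms(2)]]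
      partial_deriv_bounded_linear[OF bounded_linear_cnj direction_derivative(1)[OF assms(1)]]
      direction_derivative(2)[OF assms(1)] direction_derivative(2)[OF assms(2)] AB_potential_eq
    by (simp add: algebra_simps)
qed

lemma smooth_on_gauge_square: "smooth_on (- {pole am, pole ap}) (gauge_square am ap)"
proof (rule smooth_on_gauge)
  show "smooth_on (- {pole am, pole ap}) (\<lambda>x. 2 * \<i> * complex_of_real (AB_potential am ap x $ j))" for j
    by (intro smooth_on_mult smooth_on_const open_minus_pole smooth_on_bounded_linear[OF bounded_linear_of_real] smooth_on_AB_potential)
qed (auto simp: open_minus_pole gauge_square_derivative)

text \<open>Up to a positive factor W is the conjugate of z - am times z - ap, with imaginary part
  \<open>x $ 2 * (ap - am)\<close>. Off the axis both W and -W thus avoid the branch cut of the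
  principal root.\<close>

lemma Im_gauge_square:
  assumes "am < ap" "x $ 2 \<noteq> 0"
  shows "Im (gauge_square am ap x) \<noteq> 0"
proof -
  have "gauge_square am ap x = of_real (inverse (sqrt (sq_dist am x)) * inverse (sqrt (sq_dist ap x)))
     * ((of_real (x $ 1 - am) - \<i> * of_real (x $ 2)) * (of_real (x $ 1 - ap) + \<i> * of_real (x $ 2)))"
    by (simp add: gauge_square_def direction_def)
  moreover have "Im (of_real r * z) = r * Im z" for r z by simp
  moreover have "Im ((of_real (x $ 1 - am) - \<i> * of_real (x $ 2)) * (of_real (x $ 1 - ap) + \<i> * of_real (x $ 2))) = x $ 2 * (ap - am)"
    by (simp add: algebra_simps)
  ultimately have "Im (gauge_square am ap x) = inverse (sqrt (sq_dist am x)) * inverse (sqrt (sq_dist ap x)) * (x $ 2 * (ap - am))"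
    by (simp only:)
  moreover have "sq_dist am x > 0" "sq_dist ap x > 0"
    using assms(2) by (auto simp: sq_dist_pos_iff pole_def)
  ultimately show ?thesis using assms by simp
qed

lemma direction_axis: "x $ 2 = 0 \<Longrightarrow> direction a x = of_real (sgn (x $ 1 - a))"
proof -
  assume "x $ 2 = 0"
  then have "direction a x = of_real ((x $ 1 - a) * inverse \<bar>x $ 1 - a\<bar>)"
    by (simp add: direction_def sq_dist_def)
  also have "(x $ 1 - a) * inverse \<bar>x $ 1 - a\<bar> = sgn (x $ 1 - a)" by (simp add: real_sgn_eq divide_inverse)
  finally show ?thesis .
qed

text \<open>Both directions are signs on the axis. For am < ap this makes W equal to -1 between the
  poles and 1 beyond them, which decides where each gauge has its cut.\<close>

lemma gauge_square_axis: "x $ 2 = 0 \<Longrightarrow> gauge_square am ap x = of_real (sgn (x $ 1 - am) * sgn (x $ 1 - ap))"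
  by (simp add: gauge_square_def direction_axis)

lemma partial_deriv_comp_complex:
  assumes "f differentiable (at x)" "(F has_field_derivative F') (at (f x))"
  shows "partial_deriv j (\<lambda>x. F (f x)) x = F' * partial_deriv j f x"
    and "(\<lambda>x. F (f x)) differentiable (at x)"
proof -
  have d: "((\<lambda>x. F (f x)) has_derivative (\<lambda>h. F' * frechet_derivative f (at x) h)) (at x)"
    using has_derivative_compose[OF differentiable_has_frechet[OF assms(1)], of F "(*) F'"] assms(2)
    by (simp add: has_field_derivative_def)
  show "partial_deriv j (\<lambda>x. F (f x)) x = F' * partial_deriv j f x"
    using partial_deriv_eqI[OF d] by (simp add: partial_deriv_def)
  show "(\<lambda>x. F (f x)) differentiable (at x)" using d by (rule differentiableI)
qed

text \<open>With \<open>s = 1\<close> the gauge turns Dirichlet conditions on \<open>N\<close> into the symmetry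
  \<open>W \<cdot> (u \<circ> \<sigma>) = u\<close>, where \<open>W = e\<^bsup>2i\<phi>\<^esup>\<close>; with \<open>s = -1\<close> into \<open>W \<cdot> (u \<circ> \<sigma>) = - u\<close>.
  The value \<open>0\<close> of \<open>G\<close> on \<open>N\<close> is a convention that keeps identities valid on the cut.\<close>

locale gauge = symmetric_domain \<Omega> for \<Omega> :: "(real ^ 2) set" +
  fixes am ap :: real and N :: "(real ^ 2) set" and G :: "real ^ 2 \<Rightarrow> complex" and s :: real
  assumes closed_N: "closed N" and N_axis: "N \<subseteq> axis_line" and poles_N: "pole am \<in> N" "pole ap \<in> N"
    and cutoffs: "\<exists>\<eta>. cutoffs_near N \<eta>"
    and s: "s = 1 \<or> s = -1"
    and smooth_G: "smooth_on (- N) G"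
    and partial_G: "\<And>x j. x \<notin> N \<Longrightarrow> partial_deriv j G x = \<i> * of_real (AB_potential am ap x $ j) * G x"
    and norm_G: "\<And>x. x \<notin> N \<Longrightarrow> norm (G x) = 1"
    and G_N: "\<And>x. x \<in> N \<Longrightarrow> G x = 0"
    and G_\<sigma>: "\<And>x. G (\<sigma> x) = of_real s * cnj (G x)"
    and G_square: "\<And>x. x \<notin> N \<Longrightarrow> G x * G x = gauge_square am ap x"
    and W_N: "\<And>x. x \<in> N \<Longrightarrow> x \<noteq> pole am \<Longrightarrow> x \<noteq> pole ap \<Longrightarrow> of_real s * gauge_square am ap x = -1"

text \<open>\<open>\<kappa>\<close> is a square root of \<open>s\<close>: 1 for the segment, \<i>
  for the outer axis. The inner factor moves the branch cut to where \<open>s * W\<close> is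
  negative; the outer factor restores the square W, since
  \<open>\<kappa>\<^sup>2 * \<kappa>\<^sup>2 = 1\<close>.\<close>

definition gauge_root :: "real \<Rightarrow> real \<Rightarrow> (real ^ 2) set \<Rightarrow> complex \<Rightarrow> real ^ 2 \<Rightarrow> complex" where
  "gauge_root am ap N \<kappa> x = (if x \<in> N then 0 else \<kappa> * csqrt (\<kappa>\<^sup>2 * gauge_square am ap x))"

text \<open>Off \<open>N\<close> the argument of \<open>csqrt\<close> avoids the nonpositive reals,
  so the root is differentiable there and commutes with conjugation. Higher smoothness then comes
  from the differential equation through \<open>smooth_on_gauge\<close>.\<close>

lemma gauge_root_gauge:
  assumes "symmetric_domain \<Omega>" "closed N" "N \<subseteq> axis_line" "pole am \<in> N" "pole ap \<in> N" "\<exists>\<eta>. cutoffs_near N \<eta>"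
    and \<kappa>: "\<kappa>\<^sup>2 = of_real s" "s = 1 \<or> s = -1" "norm \<kappa> = 1"
    and off: "\<And>x. x \<notin> N \<Longrightarrow> of_real s * gauge_square am ap x \<notin> \<real>\<^sub>\<le>\<^sub>0"
    and on: "\<And>x. x \<in> N \<Longrightarrow> x \<noteq> pole am \<Longrightarrow> x \<noteq> pole ap \<Longrightarrow> of_real s * gauge_square am ap x = -1"
  shows "gauge \<Omega> am ap N (gauge_root am ap N \<kappa>) s"
proof -
  let ?W = "gauge_square am ap" and ?G = "gauge_root am ap N \<kappa>"
  interpret symmetric_domain \<Omega> by fact
  have o: "open (- N)" using assms(2) by auto
  have poles: "x \<noteq> pole am" "x \<noteq> pole ap" if "x \<notin> N" for x using assms that by auto
  have \<sigma>N: "\<sigma> x \<in> N \<longleftrightarrow> x \<in> N" for x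
  proof -
    have "\<sigma> x = x" if "x \<in> axis_line" for x using that by (simp add: vec2_eq_iff axis_line_def)
    then show ?thesis using assms(3) by (metis \<sigma>_\<sigma> subsetD)
  qed
  have ss: "complex_of_real s * of_real s = 1" using \<kappa>(2) by auto
  have \<kappa>4: "\<kappa>\<^sup>2 * \<kappa>\<^sup>2 = 1" using ss \<kappa>(1) by simp
  have sq: "?G x * ?G x = ?W x" if "x \<notin> N" for x
  proof -
    have "?G x * ?G x = \<kappa>\<^sup>2 * (csqrt (\<kappa>\<^sup>2 * ?W x))\<^sup>2" using that by (simp add: gauge_root_def power2_eq_square)
    then show ?thesis using \<kappa>4 by (simp add: mult.assoc[symmetric])
  qed
  have der: "?G differentiable (at x) \<and> partial_deriv j ?G x = \<i> * of_real (AB_potential am ap x $ j) * ?G x"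
    if x: "x \<notin> N" for x j
  proof -
    define c where "c = csqrt (\<kappa>\<^sup>2 * ?W x)"
    have c: "c * c = \<kappa>\<^sup>2 * ?W x" using power2_csqrt[of "\<kappa>\<^sup>2 * ?W x"] by (simp add: c_def power2_eq_square)
    have W0: "?W x \<noteq> 0" using norm_gauge_square[OF poles[OF x]] by auto
    have c0: "c \<noteq> 0" using c W0 \<kappa>4 by auto
    have "((\<lambda>z. \<kappa> * csqrt (\<kappa>\<^sup>2 * z)) has_field_derivative \<kappa> * (inverse (2 * c) * \<kappa>\<^sup>2)) (at (?W x))"
    proof -
      have "(csqrt has_field_derivative inverse (2 * c)) (at (\<kappa>\<^sup>2 * ?W x))"
        unfolding c_def using off[OF x] \<kappa>(1) by (intro has_field_derivative_csqrt) simp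
      from DERIV_cmult[OF DERIV_chain2[OF this DERIV_cmult[OF DERIV_ident]], of \<kappa>] show ?thesis by simp
    qed
    note d = partial_deriv_comp_complex[OF gauge_square_derivative(1)[OF poles[OF x]] this]
    have "(\<lambda>z. \<kappa> * csqrt (\<kappa>\<^sup>2 * ?W z)) differentiable (at x)" by (rule d(2))
    then obtain D where D: "((\<lambda>z. \<kappa> * csqrt (\<kappa>\<^sup>2 * ?W z)) has_derivative D) (at x)"
      unfolding differentiable_def by blast
    have "(?G has_derivative D) (at x)"
      by (rule has_derivative_transform_within_open[OF D o]) (use x in \<open>auto simp: gauge_root_def\<close>)
    then have 1: "?G differentiable (at x)" by (rule differentiableI)
    have "partial_deriv j ?G x = partial_deriv j (\<lambda>z. \<kappa> * csqrt (\<kappa>\<^sup>2 * ?W z)) x"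
      using x by (intro partial_deriv_cong_open[OF o]) (auto simp: gauge_root_def)
    also have "\<dots> = \<kappa> * (inverse (2 * c) * \<kappa>\<^sup>2) * (2 * \<i> * of_real (AB_potential am ap x $ j) * ?W x)"
      unfolding d(1) gauge_square_derivative(2)[OF poles[OF x]] ..
    also have "\<dots> = \<i> * of_real (AB_potential am ap x $ j) * \<kappa> * (inverse c * (\<kappa>\<^sup>2 * ?W x))"
      by simp
    \<comment> \<open>Since \<open>c * c\<close> is \<open>\<kappa>\<^sup>2 * ?W x\<close>, the
      derivative of the root reproduces the root itself.\<close>
    also have "\<dots> = \<i> * of_real (AB_potential am ap x $ j) * (\<kappa> * c)"
      using c0 by (simp add: c[symmetric])
    also have "\<kappa> * c = ?G x" using x by (simp add: gauge_root_def c_def)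
    finally show ?thesis using 1 by blast
  qed
  show ?thesis
  proof unfold_locales
    show "smooth_on (- N) ?G"
    proof (rule smooth_on_gauge[OF o])
      show "smooth_on (- N) (\<lambda>x. \<i> * complex_of_real (AB_potential am ap x $ j))" for j
        using o assms(4,5)
        by (intro smooth_on_mult smooth_on_const smooth_on_bounded_linear[OF bounded_linear_of_real]
             smooth_on_subset[OF smooth_on_AB_potential]) auto
    qed (use der in auto)
    show "norm (?G x) = 1" if "x \<notin> N" for x
    proof -
      have "norm (?G x) * norm (?G x) = 1" using arg_cong[OF sq[OF that], of norm] norm_gauge_square[OF poles[OF that]] by (simp add: norm_mult)
      then show ?thesis by (metis abs_norm_cancel abs_square_eq_1 power2_eq_square)
    qed
    show "?G (\<sigma> x) = of_real s * cnj (?G x)" for x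
    proof (cases "x \<in> N")
      case False
      have "csqrt (\<kappa>\<^sup>2 * ?W (\<sigma> x)) = cnj (csqrt (\<kappa>\<^sup>2 * ?W x))"
        using cnj_csqrt[OF off[OF False]] by (simp add: gauge_square_\<sigma> \<kappa>(1))
      \<comment> \<open>\<open>s\<close> is \<open>\<kappa>\<^sup>2\<close> and
        \<open>\<kappa> * cnj \<kappa>\<close> is 1; reflection therefore conjugates the gauge
        factor at the cost of exactly the sign \<open>s\<close>.\<close>
      moreover have "of_real s * cnj \<kappa> = \<kappa>"
      proof -
        have "of_real s * cnj \<kappa> = \<kappa> * (\<kappa> * cnj \<kappa>)" using \<kappa>(1) by (simp add: power2_eq_square)
        also have "\<kappa> * cnj \<kappa> = 1" using \<kappa>(3) by (simp add: complex_norm_square[symmetric])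
        finally show ?thesis by simp
      qed
      ultimately show ?thesis using False \<sigma>N by (simp add: gauge_root_def mult.assoc[symmetric])
    qed (use \<sigma>N in \<open>simp add: gauge_root_def\<close>)
  qed (use assms der sq in \<open>auto simp: gauge_root_def\<close>)
qed

section \<open>The two gauges: cut along the segment and cut along the outer axis\<close>

lemma closed_axis_subset:
  "closed (segment_between am ap)" "closed (outer_axis am ap)"
proof -
  have "segment_between am ap = {x. am \<le> x $ 1} \<inter> {x. x $ 1 \<le> ap} \<inter> {x. x $ 2 = 0}"
    by (auto simp: segment_between_def)
  also have "closed \<dots>" by (intro closed_Int closed_Collect_le closed_Collect_eq continuous_intros)
  finally show "closed (segment_between am ap)" .
  have "outer_axis am ap = {x. x $ 2 = 0} \<inter> ({x. x $ 1 \<le> am} \<union> {x. ap \<le> x $ 1})"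
    by (auto simp: outer_axis_def)
  also have "closed \<dots>" by (intro closed_Int closed_Un closed_Collect_le closed_Collect_eq continuous_intros)
  finally show "closed (outer_axis am ap)" .
qed

text \<open>W is 1 on the axis beyond the poles and -1 between them, so the principal root of W is
  cut exactly along the segment.\<close>

lemma gauge_segment:
  assumes "symmetric_domain \<Omega>" "am < ap"
  shows "gauge \<Omega> am ap (segment_between am ap) (gauge_root am ap (segment_between am ap) 1) 1"
proof (rule gauge_root_gauge)
  fix x assume x: "x \<notin> segment_between am ap"
  show "of_real 1 * gauge_square am ap x \<notin> \<real>\<^sub>\<le>\<^sub>0"
  proof (cases "x $ 2 = 0")
    case True
    then show ?thesis using x assms(2) by (auto simp: gauge_square_axis segment_between_def sgn_real_def)
  qed (use Im_gauge_square[OF assms(2)] in \<open>auto simp: complex_nonpos_Reals_iff\<close>)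
next
  show "closed (segment_between am ap)" by (rule closed_axis_subset)
  show "\<exists>\<eta>. cutoffs_near (segment_between am ap) \<eta>" using assms(2) by (intro exists_cutoffs_near_segment) simp
  fix x assume "x \<in> segment_between am ap" "x \<noteq> pole am" "x \<noteq> pole ap"
  then show "of_real (1) * gauge_square am ap x = -1"
    using assms(2) by (auto simp: gauge_square_axis segment_between_def pole_def vec2_eq_iff sgn_real_def)
qed (use assms in \<open>auto simp: segment_between_def axis_line_def pole_def\<close>)

text \<open>Passing to -W exchanges the two values on the axis and moves the cut to the part beyond
  the poles.\<close>

lemma gauge_outer_axis:
  assumes "symmetric_domain \<Omega>" "am < ap"
  shows "gauge \<Omega> am ap (outer_axis am ap) (gauge_root am ap (outer_axis am ap) \<i>) (-1)"
proof (rule gauge_root_gauge)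
  fix x assume x: "x \<notin> outer_axis am ap"
  show "of_real (-1) * gauge_square am ap x \<notin> \<real>\<^sub>\<le>\<^sub>0"
  proof (cases "x $ 2 = 0")
    case True
    then show ?thesis using x assms(2) by (auto simp: gauge_square_axis outer_axis_def sgn_real_def)
  qed (use Im_gauge_square[OF assms(2)] in \<open>auto simp: complex_nonpos_Reals_iff\<close>)
next
  show "closed (outer_axis am ap)" by (rule closed_axis_subset)
  show "\<exists>\<eta>. cutoffs_near (outer_axis am ap) \<eta>" by (rule exists_cutoffs_near_outer_axis)
  fix x assume "x \<in> outer_axis am ap" "x \<noteq> pole am" "x \<noteq> pole ap"
  then show "of_real (-1) * gauge_square am ap x = -1"
    using assms(2) by (auto simp: gauge_square_axis outer_axis_def pole_def vec2_eq_iff sgn_real_def)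
qed (use assms in \<open>auto simp: outer_axis_def axis_line_def pole_def\<close>)

section \<open>Even test functions\<close>

text \<open>Zero potential makes the results on magnetic forms available for the Laplacian; its
  minus sign comes from the square of \<i>.\<close>

abbreviation complex_laplacian :: "(real ^ 2 \<Rightarrow> complex) \<Rightarrow> real ^ 2 \<Rightarrow> complex" where
  "complex_laplacian \<equiv> magnetic_laplacian (\<lambda>_. 0)"

lemma magnetic_deriv_0: "magnetic_deriv (\<lambda>_. 0) j h = (\<lambda>x. \<i> * partial_deriv j h x)"
  by (simp add: magnetic_deriv_def fun_eq_iff)

lemma complex_laplacian_eq:
  assumes "smooth_on UNIV h"
  shows "complex_laplacian h x = - (\<Sum>j\<in>UNIV. partial_deriv j (partial_deriv j h) x)"
  using partial_deriv_bounded_linear[OF bounded_linear_mult_right smooth_on_differentiable[OF smooth_on_partial[OF assms] UNIV_I]]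
  by (simp add: magnetic_laplacian_def magnetic_deriv_0 sum_negf)

lemma bounded_linear_complex_laplacian:
  assumes "smooth_on UNIV h" "bounded_linear \<rho>"
  shows "\<rho> (complex_laplacian h x) = neg_laplacian (\<lambda>x. \<rho> (h x)) x"
proof -
  have 1: "partial_deriv j (\<lambda>x. \<rho> (h x)) = (\<lambda>x. \<rho> (partial_deriv j h x))" for j
    using partial_deriv_bounded_linear[OF assms(2) smooth_on_differentiable[OF assms(1) UNIV_I]] by auto
  have 2: "partial_deriv j (\<lambda>x. \<rho> (partial_deriv j h x)) x = \<rho> (partial_deriv j (partial_deriv j h) x)" for j
    using partial_deriv_bounded_linear[OF assms(2) smooth_on_differentiable[OF smooth_on_partial[OF assms(1)] UNIV_I]] .
  have "linear \<rho>" using assms(2) by (rule bounded_linear.linear)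
  then show ?thesis
    unfolding complex_laplacian_eq[OF assms(1)] neg_laplacian_def 1 2 by (simp add: linear_neg linear_sum)
qed

lemma complex_laplacian_of_real:
  assumes "smooth_on UNIV g"
  shows "complex_laplacian (\<lambda>x. of_real (g x)) = (\<lambda>x. of_real (neg_laplacian g x))"
proof
  fix x
  have s: "smooth_on UNIV (\<lambda>x. complex_of_real (g x))"
    using assms by (intro smooth_on_bounded_linear[OF bounded_linear_of_real]) auto
  show "complex_laplacian (\<lambda>x. of_real (g x)) x = of_real (neg_laplacian g x)"
    by (simp add: complex_laplacian_eq[OF s] neg_laplacian_def partial_deriv_of_real assms smooth_on_partial)
qed

text \<open>A parity factor \<open>c\<close> is allowed because a first derivative of an even
  function has parity \<open>axis_sign j\<close>; a second application then covers second
  derivatives.\<close>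

lemma partial_deriv_\<sigma>_invariant:
  assumes "smooth_on UNIV h" "\<And>x. h (\<sigma> x) = c *\<^sub>R h x"
  shows "partial_deriv j h (\<sigma> x) = (axis_sign j * c) *\<^sub>R partial_deriv j h x"
proof -
  have d: "h differentiable (at x)" for x using smooth_on_differentiable[OF assms(1)] by simp
  have "axis_sign j *\<^sub>R partial_deriv j h (\<sigma> x) = partial_deriv j (\<lambda>x. h (\<sigma> x)) x"
    using partial_deriv_\<sigma>(1)[OF d] by simp
  also have "\<dots> = c *\<^sub>R partial_deriv j h x"
    unfolding assms(2) by (rule partial_deriv_bounded_linear[OF bounded_linear_scaleR_right d])
  finally have "axis_sign j *\<^sub>R (axis_sign j *\<^sub>R partial_deriv j h (\<sigma> x)) = (axis_sign j * c) *\<^sub>R partial_deriv j h x" by simp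
  then show ?thesis by (simp add: axis_sign_def split: if_splits)
qed

lemma complex_laplacian_\<sigma>:
  assumes "smooth_on UNIV h" "\<And>x. h (\<sigma> x) = h x"
  shows "complex_laplacian h (\<sigma> x) = complex_laplacian h x"
proof -
  have "partial_deriv j (partial_deriv j h) (\<sigma> x) = partial_deriv j (partial_deriv j h) x" for j
    using partial_deriv_\<sigma>_invariant[OF smooth_on_partial[OF assms(1)] partial_deriv_\<sigma>_invariant[OF assms(1), of 1], of j j x] assms(2)
    by (simp add: axis_sign_def split: if_splits)
  then show ?thesis by (simp add: complex_laplacian_eq[OF assms(1)])
qed

context magnetic_form
begin

lemma magnetic_laplacian_add:
  assumes "u \<in> test_functions U" "v \<in> test_functions U"
  shows "magnetic_laplacian A (\<lambda>x. u x + v x) = (\<lambda>x. magnetic_laplacian A u x + magnetic_laplacian A v x)"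
  using magnetic_laplacian_diff[OF assms(1) test_functions_cmult[OF assms(2), of "-1"]]
    magnetic_laplacian_cmult[OF assms(2), of "-1"] by simp

lemma symmetric_form_magnetic:
  "symmetric_form (L2 \<Omega>) (L2_inner_complex \<Omega>) (test_functions U) (magnetic_laplacian A)"
proof
  show "L2_inner_complex \<Omega> (magnetic_laplacian A u) v = L2_inner_complex \<Omega> u (magnetic_laplacian A v)"
    if "u \<in> test_functions U" "v \<in> test_functions U" for u v using magnetic_laplacian_symmetric[OF that] .
qed (auto intro: L2_diff test_L2 magnetic_laplacian_test test_functions_diff L2_inner_complex_diff_left
    L2_inner_complex_diff_right magnetic_laplacian_diff L2_inner_complex_Cauchy_Schwarz form_Cauchy_Schwarz)

end

text \<open>The codomain is left open: real values serve the mixed operators, complex values the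
  form core.\<close>

definition even_tests :: "(real ^ 2) set \<Rightarrow> (real ^ 2 \<Rightarrow> 's::real_normed_vector) set" where
  "even_tests U = {u \<in> test_functions U. u \<circ> \<sigma> = u}"

lemma even_testsD:
  assumes "u \<in> even_tests U"
  shows "u \<in> test_functions U" "u (\<sigma> x) = u x"
proof -
  have "u \<in> test_functions U \<and> u \<circ> \<sigma> = u" using assms unfolding even_tests_def by (rule CollectD)
  then have u: "u \<in> test_functions U" "u \<circ> \<sigma> = u" by blast+
  show "u \<in> test_functions U" by (rule u(1))
  show "u (\<sigma> x) = u x" using fun_cong[OF u(2), of x] unfolding o_apply .
qed

lemma even_testsI: "u \<in> test_functions U \<Longrightarrow> (\<And>x. u (\<sigma> x) = u x) \<Longrightarrow> u \<in> even_tests U"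
  unfolding even_tests_def by (intro CollectI conjI ext) simp_all

lemma even_tests_bounded_linear:
  assumes "bounded_linear L" "u \<in> even_tests U"
  shows "(\<lambda>x. L (u x)) \<in> even_tests U"
  by (rule even_testsI[OF test_functions_bounded_linear[OF assms(1) even_testsD(1)[OF assms(2)]]])
     (simp add: even_testsD(2)[OF assms(2)])

lemma even_tests_diff:
  assumes "u \<in> even_tests U" "v \<in> even_tests U"
  shows "(\<lambda>x. u x - v x) \<in> even_tests U"
  by (rule even_testsI[OF test_functions_diff[OF even_testsD(1)[OF assms(1)] even_testsD(1)[OF assms(2)]]])
     (simp add: even_testsD(2)[OF assms(1)] even_testsD(2)[OF assms(2)])

lemma even_tests_zero: "(\<lambda>x. 0) \<in> even_tests U"
  by (intro even_testsI test_functions_zero) auto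

section \<open>The mixed Laplacians on even test functions\<close>

context symmetric_domain
begin

lemma magnetic_form_laplacian: "magnetic_form \<Omega> \<Omega> (\<lambda>_. 0)"
  by unfold_locales (auto simp: open_\<Omega>)

lemma neg_laplacian_test:
  assumes "u \<in> test_functions U"
  shows "neg_laplacian u \<in> test_functions U"
proof -
  have "(\<lambda>x. -1 * (partial_deriv 1 (partial_deriv 1 u) x + partial_deriv 2 (partial_deriv 2 u) x)) \<in> test_functions U"
    using assms by (intro test_functions_cmult test_functions_add test_functions_partial)
  then show ?thesis by (simp add: neg_laplacian_def[abs_def] sum_2)
qed

lemma real_form_eq:
  assumes "u \<in> test_functions U"
  shows "L2_inner_complex \<Omega> (complex_laplacian (\<lambda>x. of_real (u x))) (\<lambda>x. of_real (v x)) = of_real (L2_inner_real \<Omega> (neg_laplacian u) v)"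
  by (simp add: complex_laplacian_of_real[OF test_functionsD(1)[OF assms]] L2_inner_of_real)

lemma of_real_test: "u \<in> test_functions U \<Longrightarrow> (\<lambda>x. complex_of_real (u x)) \<in> test_functions U"
  by (rule test_functions_bounded_linear[OF bounded_linear_of_real])

lemma real_form_nonneg:
  assumes "u \<in> test_functions \<Omega>"
  shows "0 \<le> L2_inner_real \<Omega> (neg_laplacian u) u"
  using magnetic_form.form_nonneg[OF magnetic_form_laplacian of_real_test[OF assms]]
  by (simp add: real_form_eq[OF assms])

text \<open>The properties of the form are read off from the complex one with zero potential through
  \<open>of_real\<close>. The set \<open>U\<close> is merely contained in \<open>\<Omega>\<close>,
  so the literal domain of \<open>H_DND\<close>, which may fail to be open, is covered.\<close>

lemma symmetric_form_even:
  assumes U: "U \<subseteq> \<Omega>"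
  shows "symmetric_form (L2_sym \<Omega>) (L2_inner_real \<Omega>) (even_tests U) neg_laplacian"
proof
  interpret magnetic_form \<Omega> \<Omega> "\<lambda>_. 0" by (rule magnetic_form_laplacian)
  have tests: "u \<in> test_functions \<Omega>" if "u \<in> even_tests U" for u :: "real ^ 2 \<Rightarrow> real"
    using test_functions_mono[OF U even_testsD(1)[OF that]] .
  have L2: "u \<in> L2 \<Omega>" if "u \<in> L2_sym \<Omega>" for u using that by (simp add: L2_sym_def)
  fix u v w :: "real ^ 2 \<Rightarrow> real"
  show "(\<lambda>x. u x - v x) \<in> L2_sym \<Omega>" if "u \<in> L2_sym \<Omega>" "v \<in> L2_sym \<Omega>"
    using that by (auto simp: L2_sym_def intro!: L2_diff)
  show "even_tests U \<subseteq> L2_sym \<Omega>" 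
  proof
    fix u :: "real ^ 2 \<Rightarrow> real" assume u: "u \<in> even_tests U"
    show "u \<in> L2_sym \<Omega>"
      using test_functions_L2[OF even_testsD(1)[OF u]] by (simp add: L2_sym_def even_testsD(2)[OF u])
  qed
  have lap: "neg_laplacian u (\<sigma> x) = neg_laplacian u x" if "u \<in> even_tests U" for u x
    using complex_laplacian_\<sigma>[of "\<lambda>x. of_real (u x)" x] complex_laplacian_of_real[OF test_functionsD(1)[OF tests[OF that]]]
      test_functionsD(1)[OF of_real_test[OF tests[OF that]]] even_testsD(2)[OF that] by simp
  show "neg_laplacian v \<in> L2_sym \<Omega>" if "v \<in> even_tests U"
    using lap[OF that] test_functions_L2[OF neg_laplacian_test[OF even_testsD(1)[OF that]]] by (simp add: L2_sym_def)
  show "(\<lambda>x. u x - v x) \<in> even_tests U" if "u \<in> even_tests U" "v \<in> even_tests U"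
    using that by (rule even_tests_diff)
  show "L2_inner_real \<Omega> (\<lambda>x. u x - v x) w = L2_inner_real \<Omega> u w - L2_inner_real \<Omega> v w"
    "L2_inner_real \<Omega> w (\<lambda>x. u x - v x) = L2_inner_real \<Omega> w u - L2_inner_real \<Omega> w v"
    if "u \<in> L2_sym \<Omega>" "v \<in> L2_sym \<Omega>" "w \<in> L2_sym \<Omega>" using that by (auto intro: L2_inner_real_diff L2)
  show "(norm (L2_inner_real \<Omega> u v))\<^sup>2 \<le> norm (L2_inner_real \<Omega> u u) * norm (L2_inner_real \<Omega> v v)"
    if "u \<in> L2_sym \<Omega>" "v \<in> L2_sym \<Omega>" using that by (intro L2_inner_real_Cauchy_Schwarz L2)
  show "(norm (L2_inner_real \<Omega> (neg_laplacian u) v))\<^sup>2 \<le> norm (L2_inner_real \<Omega> (neg_laplacian u) u) * norm (L2_inner_real \<Omega> (neg_laplacian v) v)"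
    if "u \<in> even_tests U" "v \<in> even_tests U"
    using form_Cauchy_Schwarz[OF of_real_test[OF tests[OF that(1)]] of_real_test[OF tests[OF that(2)]]] that
    by (simp add: real_form_eq[OF tests])
  show "L2_inner_real \<Omega> (neg_laplacian u) v = L2_inner_real \<Omega> u (neg_laplacian v)"
    if "u \<in> even_tests U" "v \<in> even_tests U"
    using magnetic_laplacian_symmetric[OF of_real_test[OF tests[OF that(1)]] of_real_test[OF tests[OF that(2)]]] that
    by (simp add: real_form_eq[OF tests] complex_laplacian_of_real[OF test_functionsD(1)[OF tests]] L2_inner_of_real)
  show "neg_laplacian (\<lambda>x. u x - v x) = (\<lambda>x. neg_laplacian u x - neg_laplacian v x)"
    if "u \<in> even_tests U" "v \<in> even_tests U"
  proof
    fix x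
    have "complex_laplacian (\<lambda>x. of_real (u x) - of_real (v x)) x = complex_laplacian (\<lambda>x. of_real (u x)) x - complex_laplacian (\<lambda>x. of_real (v x)) x"
      using magnetic_laplacian_diff[OF of_real_test[OF tests[OF that(1)]] of_real_test[OF tests[OF that(2)]]] by simp
    then have "complex_of_real (neg_laplacian (\<lambda>x. u x - v x) x) = of_real (neg_laplacian u x - neg_laplacian v x)"
      using that complex_laplacian_of_real[OF test_functionsD(1)[OF test_functions_diff[OF tests[OF that(1)] tests[OF that(2)]]]]
      by (simp add: complex_laplacian_of_real[OF test_functionsD(1)[OF tests]])
    then show "neg_laplacian (\<lambda>x. u x - v x) x = neg_laplacian u x - neg_laplacian v x" by (simp only: of_real_eq_iff)
  qed
qed

text \<open>Functions that vanish on \<open>N\<close> can be cut off near \<open>N\<close> at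
  vanishing cost in both norms, so the smaller space is a form core. The cutoffs are even, which
  preserves the symmetry.\<close>

lemma friedrichs_extension_cut_off:
  assumes U: "U \<subseteq> \<Omega>" and N: "\<exists>\<eta>. cutoffs_near N \<eta>"
    and zero: "\<And>(v :: real ^ 2 \<Rightarrow> real) y. v \<in> even_tests U \<Longrightarrow> y \<in> N \<Longrightarrow> v y = 0"
  shows "friedrichs_extension (L2_sym \<Omega>) (L2_inner_real \<Omega>) (even_tests U) neg_laplacian
    = friedrichs_extension (L2_sym \<Omega>) (L2_inner_real \<Omega>) (even_tests (U - N)) neg_laplacian"
proof (rule symmetric_form.friedrichs_extension_core[OF symmetric_form_even[OF U]])
  interpret magnetic_form \<Omega> \<Omega> "\<lambda>_. 0" by (rule magnetic_form_laplacian)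
  show "even_tests (U - N) \<subseteq> (even_tests U :: (real ^ 2 \<Rightarrow> real) set)"
  proof
    fix u :: "real ^ 2 \<Rightarrow> real" assume u: "u \<in> even_tests (U - N)"
    show "u \<in> even_tests U"
      by (rule even_testsI[OF test_functions_mono[OF Diff_subset even_testsD(1)[OF u]] even_testsD(2)[OF u]])
  qed
  fix v :: "real ^ 2 \<Rightarrow> real" assume v: "v \<in> even_tests U"
  have v\<Omega>: "v \<in> test_functions \<Omega>" using test_functions_mono[OF U even_testsD(1)[OF v]] .
  obtain \<eta> where \<eta>: "cutoffs_near N \<eta>" using N by blast
  define g where "g n x = v x - \<eta> n x * v x" for n x
  have s: "smooth_on UNIV (\<eta> n)" for n using \<eta> by (simp add: cutoffs_near_def cutoff_seq_def)
  have "g n \<in> even_tests (U - N)" for n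
  proof -
    have "\<exists>V. open V \<and> N \<subseteq> V \<and> (\<forall>x\<in>V. \<eta> n x = 1)" using \<eta> by (simp add: cutoffs_near_def)
    then obtain V where V: "open V" "N \<subseteq> V" "\<And>x. x \<in> V \<Longrightarrow> \<eta> n x = 1" by auto
    have "g n \<in> test_functions (U - V)"
      unfolding g_def[abs_def] by (rule test_functions_cut_off[OF even_testsD(1)[OF v] s V(1,3)])
    moreover have "g n (\<sigma> x) = g n x" for x
      using \<eta> even_testsD(2)[OF v] by (simp add: g_def cutoffs_near_def)
    ultimately show ?thesis using V(2) by (intro even_testsI test_functions_mono[of "U - V" "U - N"]) auto
  qed
  moreover have d: "(\<lambda>x. v x - g n x) = (\<lambda>x. \<eta> n x * v x)" for n by (simp add: g_def)
  have t: "(\<lambda>x. \<eta> n x * v x) \<in> test_functions \<Omega>" for n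
    by (rule test_functions_mult[OF v\<Omega> open_UNIV _ s]) simp
  have z: "complex_of_real (v y) = 0" if "y \<in> N" for y using zero[OF v that] by simp
  note lim = cutoff_form_tendsto_0[OF of_real_test[OF v\<Omega>] \<eta> z AE_off_axis]
  have "(\<lambda>n. complex_of_real (L2_inner_real \<Omega> (\<lambda>x. \<eta> n x * v x) (\<lambda>x. \<eta> n x * v x))) \<longlonglongrightarrow> of_real 0"
    using lim(1) by (simp flip: L2_inner_of_real)
  moreover have "(\<lambda>n. complex_of_real (L2_inner_real \<Omega> (neg_laplacian (\<lambda>x. \<eta> n x * v x)) (\<lambda>x. \<eta> n x * v x))) \<longlonglongrightarrow> of_real 0"
    using lim(2) by (simp flip: real_form_eq[OF t])
  ultimately show "\<exists>g. (\<forall>n. g n \<in> even_tests (U - N)) \<and>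
      (\<lambda>n. L2_inner_real \<Omega> (\<lambda>x. v x - g n x) (\<lambda>x. v x - g n x)) \<longlonglongrightarrow> 0 \<and>
      (\<lambda>n. L2_inner_real \<Omega> (neg_laplacian (\<lambda>x. v x - g n x)) (\<lambda>x. v x - g n x)) \<longlonglongrightarrow> 0"
    unfolding tendsto_of_real_iff by (intro exI[where x = g]) (simp add: d)
qed

lemma H_NDN_eq: "H_NDN \<Omega> am ap = friedrichs_extension (L2_sym \<Omega>) (L2_inner_real \<Omega>) (even_tests (\<Omega> - segment_between am ap)) neg_laplacian"
  by (simp add: H_NDN_def even_tests_def)

text \<open>The literal domain admits supports that touch the poles. By continuity its members
  vanish at the poles as well, so they can be cut off near the closed set
  \<open>outer_axis\<close>.\<close>

lemma H_DND_eq: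
  assumes "am < ap"
  shows "H_DND \<Omega> am ap = friedrichs_extension (L2_sym \<Omega>) (L2_inner_real \<Omega>) (even_tests (\<Omega> - outer_axis am ap)) neg_laplacian"
proof -
  let ?U = "\<Omega> - (axis_line - segment_between am ap)"
  have zero: "v y = 0" if v: "v \<in> even_tests ?U" and y: "y \<in> outer_axis am ap" for v :: "real ^ 2 \<Rightarrow> real" and y
  proof -
    obtain C where C: "0 < C" "\<And>x y. norm (v x - v y) \<le> C * norm (x - y)"
      using test_functions_Lipschitz[OF even_testsD(1)[OF v]] by blast
    have "\<bar>v y\<bar> \<le> C * e" if "e > 0" for e
    proof -
      \<comment> \<open>A point of the axis at distance \<open>e\<close> from \<open>y\<close>, on
        the side away from the segment, where \<open>v\<close> is 0 by its support
        condition.\<close>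
      define z :: "real ^ 2" where "z = vector [if y $ 1 \<le> am then y $ 1 - e else y $ 1 + e, 0]"
      have "z \<in> axis_line - segment_between am ap"
        using y \<open>e > 0\<close> assms by (auto simp: z_def axis_line_def segment_between_def outer_axis_def)
      then have "v z = 0" by (intro test_functionsD(4)[OF even_testsD(1)[OF v]]) auto
      moreover have "norm (y - z) \<le> e"
      proof -
        have "norm (y - z) \<le> \<bar>y $ 1 - z $ 1\<bar> + \<bar>y $ 2 - z $ 2\<bar>" using norm_le_l1_cart[of "y - z"] by (simp add: sum_2)
        then show ?thesis using y \<open>e > 0\<close> by (auto simp: z_def outer_axis_def split: if_splits)
      qed
      then have "C * norm (y - z) \<le> C * e" using C(1) by (intro mult_left_mono) auto
      ultimately show ?thesis using C(2)[of y z] by simp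
    qed
    note small = this
    show "v y = 0"
    proof (rule ccontr)
      assume "v y \<noteq> 0"
      then show False using small[of "\<bar>v y\<bar> / (2 * C)"] C(1) by (simp add: field_simps)
    qed
  qed
  have "?U - outer_axis am ap = \<Omega> - outer_axis am ap"
    by (auto simp: axis_line_def segment_between_def outer_axis_def)
  moreover have "H_DND \<Omega> am ap = friedrichs_extension (L2_sym \<Omega>) (L2_inner_real \<Omega>) (even_tests ?U) neg_laplacian"
    by (simp add: H_DND_def even_tests_def)
  moreover have "friedrichs_extension (L2_sym \<Omega>) (L2_inner_real \<Omega>) (even_tests ?U) neg_laplacian
    = friedrichs_extension (L2_sym \<Omega>) (L2_inner_real \<Omega>) (even_tests (?U - outer_axis am ap)) neg_laplacian"
  proof (rule friedrichs_extension_cut_off)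
    fix v :: "real ^ 2 \<Rightarrow> real" and y assume "v \<in> even_tests ?U" "y \<in> outer_axis am ap"
    then show "v y = 0" by (rule zero)
  qed (use exists_cutoffs_near_outer_axis in auto)
  ultimately show ?thesis by simp
qed

end

section \<open>Decomposition under a pair of gauges\<close>

context gauge
begin

abbreviation "W \<equiv> gauge_square am ap"
abbreviation "S \<equiv> magnetic_laplacian (AB_potential am ap)"
abbreviation "ip \<equiv> L2_inner_complex \<Omega>"
abbreviation "DA \<equiv> test_functions (\<Omega> - {pole am, pole ap}) :: (real ^ 2 \<Rightarrow> complex) set"

lemma open_N: "open (- N)" using closed_N by auto

lemma magnetic_form_poles: "magnetic_form \<Omega> (\<Omega> - {pole am, pole ap}) (AB_potential am ap)"
proof unfold_locales
  show "open (\<Omega> - {pole am, pole ap})" using open_\<Omega> by (intro open_Diff finite_imp_closed) auto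
  show "smooth_on (\<Omega> - {pole am, pole ap}) (\<lambda>x. AB_potential am ap x $ j)" for j
    by (rule smooth_on_subset[OF smooth_on_AB_potential]) auto
qed auto

lemma magnetic_form_N: "magnetic_form \<Omega> (\<Omega> - N) (AB_potential am ap)"
proof unfold_locales
  show "open (\<Omega> - N)" using open_\<Omega> closed_N by (rule open_Diff)
  show "smooth_on (\<Omega> - N) (\<lambda>x. AB_potential am ap x $ j)" for j
    using poles_N by (intro smooth_on_subset[OF smooth_on_AB_potential]) auto
qed auto

sublocale poles: magnetic_form \<Omega> "\<Omega> - {pole am, pole ap}" "AB_potential am ap"
  by (rule magnetic_form_poles)

sublocale off: magnetic_form \<Omega> "\<Omega> - N" "AB_potential am ap"
  by (rule magnetic_form_N)

lemma \<sigma>_N: "\<sigma> x \<in> N \<longleftrightarrow> x \<in> N"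
proof -
  have "\<sigma> x = x" if "x \<in> axis_line" for x using that by (simp add: vec2_eq_iff axis_line_def)
  then show ?thesis using N_axis by (metis \<sigma>_\<sigma> subsetD)
qed

lemma G_cnj: "x \<notin> N \<Longrightarrow> G x * cnj (G x) = 1"
  using norm_G[of x] by (simp add: complex_norm_square[symmetric])

lemma norm_G_le: "norm (G x) \<le> 1"
  using norm_G[of x] G_N[of x] by (cases "x \<in> N") auto

lemma ss: "complex_of_real s * of_real s = 1" "complex_of_real s * (of_real s * z) = z"
  using s by auto

lemma AE_N: "AE x in lebesgue_on \<Omega>. x \<notin> N"
  using AE_off_axis by eventually_elim (use N_axis in \<open>auto simp: axis_line_def\<close>)

lemma measurable_G: "G \<in> borel_measurable (lebesgue_on \<Omega>)"
proof -
  have "(\<lambda>x. indicator (- N) x *\<^sub>R G x) \<in> borel_measurable borel"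
    using smooth_on_continuous[OF smooth_G] open_N by (intro borel_measurable_continuous_on_indicator) auto
  also have "(\<lambda>x. indicator (- N) x *\<^sub>R G x) = G" using G_N by (auto simp: fun_eq_iff indicator_def)
  finally have "G \<in> borel_measurable lebesgue" by (simp add: measurable_completion)
  then show ?thesis by (rule measurable_restrict_space1)
qed

lemma L2_G:
  assumes "u \<in> L2 \<Omega>"
  shows "(\<lambda>x. G x * u x) \<in> L2 \<Omega>" "(\<lambda>x. cnj (G x) * u x) \<in> L2 \<Omega>"
proof -
  have u: "u \<in> borel_measurable (lebesgue_on \<Omega>)" using assms by (simp add: L2_def)
  have le: "norm (G x) * norm (u x) \<le> norm (u x)" for x
    using norm_G_le[of x] by (simp add: mult_left_le_one_le)
  have cG: "(\<lambda>x. cnj (G x)) \<in> borel_measurable (lebesgue_on \<Omega>)"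
    using measurable_compose[OF measurable_G borel_measurable_continuous_onI[OF continuous_on_cnj[OF continuous_on_id]]] by simp
  show "(\<lambda>x. G x * u x) \<in> L2 \<Omega>"
    using measurable_G u le by (intro L2_norm_le[OF assms]) (auto simp: norm_mult)
  show "(\<lambda>x. cnj (G x) * u x) \<in> L2 \<Omega>"
    using cG u le by (intro L2_norm_le[OF assms]) (auto simp: norm_mult)
qed

lemma gauge_test:
  assumes "h \<in> test_functions (\<Omega> - N)"
  shows "(\<lambda>x. G x * h x) \<in> test_functions (\<Omega> - N)" "(\<lambda>x. cnj (G x) * h x) \<in> test_functions (\<Omega> - N)"
  using smooth_G smooth_on_cnj[OF open_N smooth_G]
  by (intro test_functions_mult[OF assms open_N]; auto)+

lemma test_functions_off_N: "h \<in> test_functions (\<Omega> - N) \<Longrightarrow> h \<in> DA"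
  using poles_N by (elim test_functions_mono[rotated]) auto

text \<open>Differentiating \<open>G\<close> produces \<i> * \<i> A G = - A G, which cancels the
  potential term.\<close>

lemma gauge_magnetic_deriv:
  assumes h: "h \<in> test_functions (\<Omega> - N)"
  shows "magnetic_deriv (AB_potential am ap) j (\<lambda>x. G x * h x) = (\<lambda>x. G x * magnetic_deriv (\<lambda>_. 0) j h x)"
proof
  fix x
  show "magnetic_deriv (AB_potential am ap) j (\<lambda>x. G x * h x) x = G x * magnetic_deriv (\<lambda>_. 0) j h x"
  proof (cases "x \<in> N")
    case True
    \<comment> \<open>On the cut no derivative of \<open>G\<close> is available: the left side is 0
      by its support, the right side by the convention for \<open>G\<close>.\<close>
    then have "magnetic_deriv (AB_potential am ap) j (\<lambda>x. G x * h x) x = 0"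
      by (intro test_functionsD(4)[OF off.magnetic_deriv_test[OF gauge_test(1)[OF h]]]) auto
    then show ?thesis using True by (simp add: G_N)
  next
    case False
    have "G differentiable (at x)" "h differentiable (at x)"
      using smooth_on_differentiable[OF smooth_G] smooth_on_differentiable[OF test_functionsD(1)[OF h]] False by auto
    then show ?thesis
      using False by (simp add: magnetic_deriv_def partial_deriv_mult partial_G algebra_simps)
  qed
qed

lemma gauge_laplacian:
  assumes h: "h \<in> test_functions (\<Omega> - N)"
  shows "S (\<lambda>x. G x * h x) = (\<lambda>x. G x * complex_laplacian h x)"
proof -
  have "magnetic_deriv (\<lambda>_. 0) j h \<in> test_functions (\<Omega> - N)" for j
    by (rule magnetic_deriv_test_function[OF h off.open_U]) (simp add: off.open_U)
  then show ?thesis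
    by (simp add: magnetic_laplacian_def[abs_def] gauge_magnetic_deriv h sum_distrib_left)
qed

lemma laplacian_test:
  assumes "h \<in> test_functions U" "open U"
  shows "complex_laplacian h \<in> test_functions U"
  by (rule magnetic_laplacian_test_function[OF assms]) (simp add: assms(2))

text \<open>The function is cut off near \<open>N\<close> before it is divided by \<open>G\<close>;
  in the other order a kink along \<open>N\<close> would have to be handled.\<close>

lemma gauge_dense:
  assumes v: "v \<in> DA" and sym: "\<And>x. of_real s * W x * v (\<sigma> x) = v x"
  shows "\<exists>h. (\<forall>n. h n \<in> even_tests (\<Omega> - N)) \<and>
     (\<lambda>n. ip (\<lambda>x. v x - G x * h n x) (\<lambda>x. v x - G x * h n x)) \<longlonglongrightarrow> 0 \<and>
     (\<lambda>n. ip (S (\<lambda>x. v x - G x * h n x)) (\<lambda>x. v x - G x * h n x)) \<longlonglongrightarrow> 0"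
proof -
  obtain \<eta> where \<eta>: "cutoffs_near N \<eta>" using cutoffs by blast
  have s\<eta>: "smooth_on UNIV (\<lambda>x. complex_of_real (\<eta> n x))" for n
    using \<eta> by (intro smooth_on_bounded_linear[OF bounded_linear_of_real]) (auto simp: cutoffs_near_def cutoff_seq_def)
  have zero: "v y = 0" if y: "y \<in> N" for y
  proof (cases "y = pole am \<or> y = pole ap")
    case True
    then show ?thesis by (intro test_functionsD(4)[OF v]) auto
  next
    case False
    \<comment> \<open>A point of the cut is fixed by \<sigma> and \<open>s * W\<close> is -1 there,
      so the symmetry reads v y = - v y.\<close>
    have "\<sigma> y = y" using y N_axis by (auto simp: vec2_eq_iff axis_line_def)
    then show ?thesis using sym[of y] W_N[OF y] False by simp
  qed
  define g where "g n x = v x - of_real (\<eta> n x) * v x" for n x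
  have g: "g n \<in> test_functions (\<Omega> - N)" for n
  proof -
    have "\<exists>V. open V \<and> N \<subseteq> V \<and> (\<forall>x\<in>V. \<eta> n x = 1)" using \<eta> by (simp add: cutoffs_near_def)
    then obtain V where V: "open V" "N \<subseteq> V" "\<And>x. x \<in> V \<Longrightarrow> \<eta> n x = 1" by auto
    have "g n \<in> test_functions ((\<Omega> - {pole am, pole ap}) - V)"
      unfolding g_def[abs_def] by (rule test_functions_cut_off[OF v s\<eta> V(1)]) (simp add: V(3))
    then show ?thesis using V(2) by (elim test_functions_mono[rotated]) auto
  qed
  define h where "h n x = cnj (G x) * g n x" for n x
  have Gh: "G x * h n x = g n x" for n x
  proof (cases "x \<in> N")
    case True
    then have "g n x = 0" by (intro test_functionsD(4)[OF g]) auto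
    then show ?thesis by (simp add: h_def)
  next
    case False
    then show ?thesis using G_cnj[OF False] by (simp add: h_def mult.assoc[symmetric])
  qed
  have "h n \<in> even_tests (\<Omega> - N)" for n
  proof (rule even_testsI)
    show "h n \<in> test_functions (\<Omega> - N)" unfolding h_def[abs_def] by (rule gauge_test(2)[OF g])
    fix x
    show "h n (\<sigma> x) = h n x"
    proof (cases "x \<in> N")
      case True
      then show ?thesis using \<sigma>_N by (simp add: h_def G_N)
    next
      case False
      \<comment> \<open>Replacing W by the square of \<open>G\<close> turns
        \<open>cnj (G x) * g n x\<close> into \<open>s * G x * g n (\<sigma> x)\<close>, which is
        the same expression at \<open>\<sigma> x\<close>.\<close>
      have "g n x = of_real s * W x * g n (\<sigma> x)"
        using sym[of x] \<eta> by (simp add: g_def cutoffs_near_def algebra_simps)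
      then have "h n x = of_real s * (G x * cnj (G x)) * G x * g n (\<sigma> x)"
        using G_square[OF False, symmetric] by (simp add: h_def mult_ac)
      then show ?thesis using G_cnj[OF False] by (simp add: h_def G_\<sigma>)
    qed
  qed
  moreover have "(\<lambda>x. v x - G x * h n x) = (\<lambda>x. of_real (\<eta> n x) * v x)" for n
    by (simp add: Gh g_def)
  ultimately show ?thesis
    using poles.cutoff_form_tendsto_0[OF v \<eta> zero AE_off_axis] by (intro exI[where x = h]) simp
qed

text \<open>The even part of \<open>cnj (G x) * u x\<close>, because \<open>s * G x\<close> is the
  conjugate of \<open>G (\<sigma> x)\<close>. It recovers the even factor of the component of
  \<open>u\<close> that belongs to this gauge.\<close>

definition proj :: "(real ^ 2 \<Rightarrow> complex) \<Rightarrow> real ^ 2 \<Rightarrow> complex" where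
  "proj u x = (cnj (G x) * u x + of_real s * G x * u (\<sigma> x)) / 2"

lemma proj_\<sigma>: "proj u (\<sigma> x) = proj u x"
  by (simp add: proj_def G_\<sigma> ss mult.assoc)

lemma L2_proj: "u \<in> L2 \<Omega> \<Longrightarrow> proj u \<in> L2 \<Omega>"
proof -
  assume u: "u \<in> L2 \<Omega>"
  have "(\<lambda>x. (1 / 2) * (cnj (G x) * u x + of_real s * (G x * u (\<sigma> x)))) \<in> L2 \<Omega>"
    by (intro L2_cmult L2_add L2_G u L2_\<sigma>)
  then show ?thesis by (simp add: proj_def[abs_def] mult.assoc)
qed

lemma proj_diff: "proj (\<lambda>x. u x - v x) x = proj u x - proj v x"
  by (simp add: proj_def algebra_simps diff_divide_distrib)

text \<open>Convexity of the square bounds the integrand by the mean of two squared norms, and these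
  have equal integrals by reflection.\<close>

lemma integral_norm_proj:
  assumes u: "u \<in> L2 \<Omega>"
  shows "(LINT x|lebesgue_on \<Omega>. (norm (proj u x))\<^sup>2) \<le> (LINT x|lebesgue_on \<Omega>. (norm (u x))\<^sup>2)"
proof -
  have i: "integrable (lebesgue_on \<Omega>) (\<lambda>x. (norm (u x))\<^sup>2)" "integrable (lebesgue_on \<Omega>) (\<lambda>x. (norm (u (\<sigma> x)))\<^sup>2)"
    "integrable (lebesgue_on \<Omega>) (\<lambda>x. (norm (proj u x))\<^sup>2)"
    using u L2_\<sigma>[OF u] L2_proj[OF u] by (simp_all add: L2_def)
  have le: "(norm (proj u x))\<^sup>2 \<le> ((norm (u x))\<^sup>2 + (norm (u (\<sigma> x)))\<^sup>2) / 2" for x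
  proof -
    have "norm (cnj (G x) * u x + of_real s * G x * u (\<sigma> x)) \<le> norm (G x) * norm (u x) + norm (G x) * norm (u (\<sigma> x))"
      using s by (intro order_trans[OF norm_triangle_ineq]) (auto simp: norm_mult)
    also have "\<dots> \<le> norm (u x) + norm (u (\<sigma> x))"
      using norm_G_le[of x] by (intro add_mono mult_left_le_one_le) auto
    finally have "norm (proj u x) \<le> (norm (u x) + norm (u (\<sigma> x))) / 2" by (simp add: proj_def norm_divide)
    then have "(norm (proj u x))\<^sup>2 \<le> ((norm (u x) + norm (u (\<sigma> x))) / 2)\<^sup>2" by (intro power_mono) auto
    also have "\<dots> \<le> ((norm (u x))\<^sup>2 + (norm (u (\<sigma> x)))\<^sup>2) / 2"
      using sum_squares_bound[of "norm (u x)" "norm (u (\<sigma> x))"] by (simp add: power2_eq_square algebra_simps)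
    finally show ?thesis .
  qed
  have "(LINT x|lebesgue_on \<Omega>. (norm (proj u x))\<^sup>2) \<le> (LINT x|lebesgue_on \<Omega>. ((norm (u x))\<^sup>2 + (norm (u (\<sigma> x)))\<^sup>2) / 2)"
    using i le by (intro integral_mono) auto
  also have "\<dots> = ((LINT x|lebesgue_on \<Omega>. (norm (u x))\<^sup>2) + (LINT x|lebesgue_on \<Omega>. (norm (u (\<sigma> x)))\<^sup>2)) / 2"
    using i by simp
  also have "(LINT x|lebesgue_on \<Omega>. (norm (u (\<sigma> x)))\<^sup>2) = (LINT x|lebesgue_on \<Omega>. (norm (u x))\<^sup>2)"
    using i(1) by (intro integral_\<sigma> borel_measurable_integrable)
  finally show ?thesis by simp
qed

text \<open>Averaging the integrand over the reflection keeps its integral and turns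
  \<open>cnj (G x) * u x\<close> into its even part. Thus \<open>proj\<close> acts as the adjoint of
  multiplication by \<open>G\<close> on even functions.\<close>

lemma ip_proj:
  assumes u: "u \<in> L2 \<Omega>" and b: "b \<in> L2 \<Omega>" and even: "\<And>x. b (\<sigma> x) = b x"
  shows "ip u (\<lambda>x. G x * b x) = ip (proj u) b"
proof -
  define F where "F x = cnj (G x) * u x * cnj (b x)" for x
  have F: "integrable (lebesgue_on \<Omega>) F"
    using L2_inner_complex_integrable[OF L2_G(2)[OF u] b] by (simp add: F_def[abs_def])
  then have Fm: "F \<in> borel_measurable (lebesgue_on \<Omega>)" by (rule borel_measurable_integrable)
  have F\<sigma>: "integrable (lebesgue_on \<Omega>) (\<lambda>x. F (\<sigma> x))"
    by (rule integrable_distr[OF measurable_\<sigma>]) (simp add: distr_\<sigma> F)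
  have "ip (proj u) b = (LINT x|lebesgue_on \<Omega>. (F x + F (\<sigma> x)) / 2)"
    unfolding L2_inner_complex_def by (simp add: F_def proj_def G_\<sigma> even algebra_simps add_divide_distrib)
  also have "\<dots> = ((LINT x|lebesgue_on \<Omega>. F x) + (LINT x|lebesgue_on \<Omega>. F (\<sigma> x))) / 2"
    using F F\<sigma> by simp
  also have "\<dots> = (LINT x|lebesgue_on \<Omega>. F x)" using integral_\<sigma>[OF Fm] by simp
  also have "\<dots> = ip u (\<lambda>x. G x * b x)" unfolding L2_inner_complex_def by (simp add: F_def mult_ac)
  finally show ?thesis ..
qed

lemma ip_gauge:
  assumes "a \<in> L2 \<Omega>" "b \<in> L2 \<Omega>"
  shows "ip (\<lambda>x. G x * a x) (\<lambda>x. G x * b x) = ip a b"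
  unfolding L2_inner_complex_def
proof (rule integral_cong_AE)
  show "AE x in lebesgue_on \<Omega>. G x * a x * cnj (G x * b x) = a x * cnj (b x)"
    using AE_N
  proof eventually_elim
    case (elim x)
    have "G x * a x * cnj (G x * b x) = (G x * cnj (G x)) * (a x * cnj (b x))" by (simp add: mult_ac)
    then show ?case using G_cnj[OF elim] by simp
  qed
  show "(\<lambda>x. G x * a x * cnj (G x * b x)) \<in> borel_measurable (lebesgue_on \<Omega>)"
    by (rule borel_measurable_integrable[OF L2_inner_complex_integrable[OF L2_G(1)[OF assms(1)] L2_G(1)[OF assms(2)]]])
  show "(\<lambda>x. a x * cnj (b x)) \<in> borel_measurable (lebesgue_on \<Omega>)"
    by (rule borel_measurable_integrable[OF L2_inner_complex_integrable[OF assms]])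
qed

end

context gauge
begin

lemma even_tests_L2:
  assumes "h \<in> even_tests (\<Omega> - N)"
  shows "h \<in> L2 \<Omega>" "complex_laplacian h \<in> L2 \<Omega>" "complex_laplacian h (\<sigma> x) = complex_laplacian h x"
  using assms even_testsD[OF assms] test_functions_L2 laplacian_test[OF _ off.open_U]
    complex_laplacian_\<sigma>[OF test_functionsD(1)[OF even_testsD(1)[OF assms]]] by blast+

text \<open>The real part of a product with a conjugate is the sum of the products of the real and
  of the imaginary parts. Both resulting real forms are nonnegative, so each is controlled by the
  complex one.\<close>

lemma Re_laplacian_form:
  assumes h: "h \<in> even_tests (\<Omega> - N)"
  shows "Re (ip (complex_laplacian h) h) = L2_inner_real \<Omega> (neg_laplacian (\<lambda>x. Re (h x))) (\<lambda>x. Re (h x))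
     + L2_inner_real \<Omega> (neg_laplacian (\<lambda>x. Im (h x))) (\<lambda>x. Im (h x))"
proof -
  have t: "h \<in> test_functions (\<Omega> - N)" using even_testsD(1)[OF h] .
  have lap: "Re (complex_laplacian h x) = neg_laplacian (\<lambda>x. Re (h x)) x"
    "Im (complex_laplacian h x) = neg_laplacian (\<lambda>x. Im (h x)) x" for x
    using bounded_linear_complex_laplacian[OF test_functionsD(1)[OF t]] bounded_linear_Re bounded_linear_Im by blast+
  have tests: "(\<lambda>x. Re (h x)) \<in> test_functions (\<Omega> - N)" "(\<lambda>x. Im (h x)) \<in> test_functions (\<Omega> - N)"
    by (rule test_functions_bounded_linear[OF bounded_linear_Re t] test_functions_bounded_linear[OF bounded_linear_Im t])+
  have i: "integrable (lebesgue_on \<Omega>) (\<lambda>x. neg_laplacian (\<lambda>x. Re (h x)) x * Re (h x))"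
    "integrable (lebesgue_on \<Omega>) (\<lambda>x. neg_laplacian (\<lambda>x. Im (h x)) x * Im (h x))"
    by (rule L2_mult_integrable[OF test_functions_L2[OF neg_laplacian_test[OF tests(1)]] test_functions_L2[OF tests(1)]]
        L2_mult_integrable[OF test_functions_L2[OF neg_laplacian_test[OF tests(2)]] test_functions_L2[OF tests(2)]])+
  have "Re (ip (complex_laplacian h) h) = (LINT x|lebesgue_on \<Omega>. Re (complex_laplacian h x * cnj (h x)))"
    unfolding L2_inner_complex_def
    using L2_inner_complex_integrable[OF even_tests_L2(2)[OF h] even_tests_L2(1)[OF h]] by (rule integral_Re[symmetric])
  also have "\<dots> = (LINT x|lebesgue_on \<Omega>. neg_laplacian (\<lambda>x. Re (h x)) x * Re (h x) + neg_laplacian (\<lambda>x. Im (h x)) x * Im (h x))"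
    by (simp add: lap)
  finally show ?thesis using i by (simp add: L2_inner_real_def)
qed

lemma real_form_nonneg_N:
  assumes "h \<in> even_tests (\<Omega> - N)" "bounded_linear \<rho>"
  shows "0 \<le> L2_inner_real \<Omega> (neg_laplacian (\<lambda>x. \<rho> (h x))) (\<lambda>x. \<rho> (h x))"
  by (rule real_form_nonneg[OF test_functions_mono[OF Diff_subset test_functions_bounded_linear[OF assms(2) even_testsD(1)[OF assms(1)]]]])

text \<open>As W has modulus 1 off the poles and is conjugated by reflection, v \<mapsto> s W (v
  \<circ> \<sigma>) is an involution on test functions supported off the poles; the mean of
  \<open>v\<close> and its image is fixed by it.\<close>

lemma symmetric_part:
  assumes v: "v \<in> DA"
  shows "(\<lambda>x. (1 / 2) * (v x + of_real s * (W x * v (\<sigma> x)))) \<in> DA"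
    and "of_real s * W x * ((1 / 2) * (v (\<sigma> x) + of_real s * (W (\<sigma> x) * v (\<sigma> (\<sigma> x))))) = (1 / 2) * (v x + of_real s * (W x * v (\<sigma> x)))"
proof -
  have p: "\<sigma> (pole a) = pole a" for a by (simp add: vec2_eq_iff pole_def)
  have "\<sigma> ` (\<Omega> - {pole am, pole ap}) = \<sigma> ` \<Omega> - \<sigma> ` {pole am, pole ap}"
    by (rule image_set_diff) (metis \<sigma>_\<sigma> injI)
  then have U: "\<sigma> ` (\<Omega> - {pole am, pole ap}) = \<Omega> - {pole am, pole ap}" using p \<sigma>_\<Omega> by simp
  have "(\<lambda>x. W x * v (\<sigma> x)) \<in> DA"
    by (rule test_functions_mult[OF test_functions_\<sigma>[OF v U] open_minus_pole(2) _ smooth_on_gauge_square]) auto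
  then show "(\<lambda>x. (1 / 2) * (v x + of_real s * (W x * v (\<sigma> x)))) \<in> DA"
    by (intro test_functions_cmult test_functions_add v)
  show "of_real s * W x * ((1 / 2) * (v (\<sigma> x) + of_real s * (W (\<sigma> x) * v (\<sigma> (\<sigma> x))))) = (1 / 2) * (v x + of_real s * (W x * v (\<sigma> x)))"
  proof (cases "x = pole am \<or> x = pole ap")
    case True
    then have "v x = 0" by (intro test_functionsD(4)[OF v]) auto
    then show ?thesis using True by auto
  next
    case False
    then have W: "W x * cnj (W x) = 1" using norm_gauge_square[of x am ap] by (simp add: complex_norm_square[symmetric])
    have "of_real s * W x * ((1 / 2) * (v (\<sigma> x) + of_real s * (W (\<sigma> x) * v (\<sigma> (\<sigma> x)))))
      = (1 / 2) * (of_real s * W x * v (\<sigma> x) + (of_real s * of_real s) * (W x * cnj (W x)) * v x)"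
      by (simp add: gauge_square_\<sigma> algebra_simps)
    then show ?thesis unfolding W ss by (simp add: algebra_simps)
  qed
qed

end

section \<open>Splitting by two gauges of opposite sign\<close>

definition gauge_core :: "(real ^ 2) set \<Rightarrow> (real ^ 2) set \<Rightarrow> (real ^ 2 \<Rightarrow> complex) \<Rightarrow> (real ^ 2) set \<Rightarrow>
    (real ^ 2 \<Rightarrow> complex) \<Rightarrow> (real ^ 2 \<Rightarrow> complex) set" where
  "gauge_core \<Omega> N G N' G' =
     {\<lambda>x. G x * h x + G' x * k x | h k. h \<in> even_tests (\<Omega> - N) \<and> k \<in> even_tests (\<Omega> - N')}"

lemma gauge_core_commute: "gauge_core \<Omega> N G N' G' = gauge_core \<Omega> N' G' N G"
  unfolding gauge_core_def by (auto simp: add.commute; metis add.commute)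

text \<open>For even h and k, the functions G h and G' k are off the cuts eigenfunctions of u
  \<mapsto> W (u \<circ> \<sigma>) for the eigenvalues \<open>s\<close> and \<open>s'\<close>; the
  opposite signs make the two families complementary.\<close>

locale gauge_pair = gauge \<Omega> am ap N G s + other: gauge \<Omega> am ap N' G' s'
  for \<Omega> am ap N G s N' G' s' +
  assumes opposite: "s' = - s"
begin

abbreviation "core \<equiv> gauge_core \<Omega> N G N' G'"

text \<open>For z = G cnj G' both z * z and z * cnj z equal 1, so z is its own conjugate.\<close>

lemma cross_real:
  assumes "x \<notin> N" "x \<notin> N'"
  shows "G x * cnj (G' x) = cnj (G x) * G' x"
proof -
  have W: "W x * cnj (W x) = 1"
  proof -
    have "x \<noteq> pole am" "x \<noteq> pole ap" using assms poles_N by auto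
    from norm_gauge_square[OF this] show ?thesis by (simp add: complex_norm_square[symmetric])
  qed
  let ?z = "G x * cnj (G' x)"
  have "?z * (?z - cnj (G x) * G' x) = (G x * G x) * cnj (G' x * G' x) - (G x * cnj (G x)) * (G' x * cnj (G' x))"
    by (simp add: algebra_simps)
  also have "\<dots> = 0"
    using W G_square[OF assms(1)] other.G_square[OF assms(2)] G_cnj[OF assms(1)] other.G_cnj[OF assms(2)] by simp
  finally have "?z * (?z - cnj (G x) * G' x) = 0" .
  moreover have "?z \<noteq> 0" using norm_G[OF assms(1)] other.norm_G[OF assms(2)] by auto
  ultimately show ?thesis by simp
qed

text \<open>The integrand is odd almost everywhere: reflection contributes the sign
  \<open>s * s' = -1\<close> and conjugates the real factor G cnj G'.\<close>

lemma ip_orthogonal: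
  assumes a: "a \<in> L2 \<Omega>" "AE x in lebesgue_on \<Omega>. a (\<sigma> x) = a x"
    and b: "b \<in> L2 \<Omega>" "AE x in lebesgue_on \<Omega>. b (\<sigma> x) = b x"
  shows "ip (\<lambda>x. G x * a x) (\<lambda>x. G' x * b x) = 0"
proof -
  define F where "F x = G x * a x * cnj (G' x * b x)" for x
  have F: "integrable (lebesgue_on \<Omega>) F"
    using L2_inner_complex_integrable[OF L2_G(1)[OF a(1)] other.L2_G(1)[OF b(1)]] by (simp add: F_def[abs_def])
  have F\<sigma>: "integrable (lebesgue_on \<Omega>) (\<lambda>x. F (\<sigma> x))"
    by (rule integrable_distr[OF measurable_\<sigma>]) (simp add: distr_\<sigma> F)
  have "AE x in lebesgue_on \<Omega>. F (\<sigma> x) = - F x"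
    using a(2) b(2) AE_N other.AE_N
  proof eventually_elim
    case (elim x)
    have "F (\<sigma> x) = of_real (s * s') * (cnj (G x) * G' x) * a x * cnj (b x)"
      using elim by (simp add: F_def G_\<sigma> other.G_\<sigma> mult_ac)
    also have "s * s' = -1" using s opposite by auto
    finally show ?case using cross_real[OF elim(3,4)] by (simp add: F_def mult_ac)
  qed
  then have "(LINT x|lebesgue_on \<Omega>. F (\<sigma> x)) = (LINT x|lebesgue_on \<Omega>. - F x)"
    using F F\<sigma> by (intro integral_cong_AE) auto
  then have "(LINT x|lebesgue_on \<Omega>. F x) = - (LINT x|lebesgue_on \<Omega>. F x)"
    using integral_\<sigma>[OF borel_measurable_integrable[OF F]] by simp
  then show ?thesis unfolding L2_inner_complex_def F_def[abs_def, symmetric] by simp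
qed

lemma ip_orthogonal':
  assumes "a \<in> L2 \<Omega>" "AE x in lebesgue_on \<Omega>. a (\<sigma> x) = a x"
    and "b \<in> L2 \<Omega>" "AE x in lebesgue_on \<Omega>. b (\<sigma> x) = b x"
  shows "ip (\<lambda>x. G' x * b x) (\<lambda>x. G x * a x) = 0"
  by (subst L2_inner_complex_commute) (simp add: ip_orthogonal[OF assms])

text \<open>The reflected term doubles the contribution of \<open>G\<close> and cancels that of
  \<open>G'\<close>, since \<open>s * s'\<close> is -1 and the cross factor is real.\<close>

lemma proj_gauge:
  assumes "x \<notin> N" "x \<notin> N'" "h (\<sigma> x) = h x" "k (\<sigma> x) = k x"
  shows "proj (\<lambda>x. G x * h x + G' x * k x) x = h x"
proof -
  have s': "complex_of_real s * of_real s' = -1" using s opposite by auto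
  have "proj (\<lambda>x. G x * h x + G' x * k x) x =
     ((G x * cnj (G x)) * h x + cnj (G x) * G' x * k x
      + (of_real s * of_real s) * (G x * cnj (G x)) * h x + (of_real s * of_real s') * (G x * cnj (G' x)) * k x) / 2"
    by (simp add: proj_def G_\<sigma> other.G_\<sigma> assms algebra_simps)
  then show ?thesis using G_cnj[OF assms(1)] cross_real[OF assms(1,2)] by (simp add: ss s')
qed

text \<open>\<open>G\<close> and \<open>G'\<close> have the same square W, so with
  \<open>s' = - s\<close> the reflected values of \<open>u\<close> cancel.\<close>

lemma proj_reconstruct:
  assumes "x \<notin> N" "x \<notin> N'"
  shows "G x * proj u x + G' x * other.proj u x = u x"
proof -
  have "G x * proj u x + G' x * other.proj u x = ((G x * cnj (G x)) * u x + of_real s * (G x * G x) * u (\<sigma> x)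
     + (G' x * cnj (G' x)) * u x + of_real s' * (G' x * G' x) * u (\<sigma> x)) / 2"
    by (simp add: proj_def other.proj_def algebra_simps add_divide_distrib)
  then show ?thesis
    using G_cnj[OF assms(1)] other.G_cnj[OF assms(2)] G_square[OF assms(1)] other.G_square[OF assms(2)] opposite by simp
qed

lemma core_laplacian:
  assumes h: "h \<in> even_tests (\<Omega> - N)" and k: "k \<in> even_tests (\<Omega> - N')"
  shows "S (\<lambda>x. G x * h x + G' x * k x) = (\<lambda>x. G x * complex_laplacian h x + G' x * complex_laplacian k x)"
  using poles.magnetic_laplacian_add[OF test_functions_off_N[OF gauge_test(1)] other.test_functions_off_N[OF other.gauge_test(1)]]
    gauge_laplacian other.gauge_laplacian even_testsD(1)[OF h] even_testsD(1)[OF k] by simp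

lemma ip_pair:
  assumes "a \<in> L2 \<Omega>" "AE x in lebesgue_on \<Omega>. a (\<sigma> x) = a x" "b \<in> L2 \<Omega>" "AE x in lebesgue_on \<Omega>. b (\<sigma> x) = b x"
    and "c \<in> L2 \<Omega>" "AE x in lebesgue_on \<Omega>. c (\<sigma> x) = c x" "d \<in> L2 \<Omega>" "AE x in lebesgue_on \<Omega>. d (\<sigma> x) = d x"
  shows "ip (\<lambda>x. G x * a x + G' x * b x) (\<lambda>x. G x * c x + G' x * d x) = ip a c + ip b d"
proof -
  have L: "(\<lambda>x. G x * a x) \<in> L2 \<Omega>" "(\<lambda>x. G' x * b x) \<in> L2 \<Omega>" "(\<lambda>x. G x * c x) \<in> L2 \<Omega>" "(\<lambda>x. G' x * d x) \<in> L2 \<Omega>"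
    using L2_G(1) other.L2_G(1) assms by blast+
  show ?thesis
    using assms ip_orthogonal[OF assms(1,2,7,8)] ip_orthogonal'[OF assms(5,6,3,4)]
    by (simp add: L2_inner_complex_add_left L2_inner_complex_add_right L2_add L ip_gauge other.ip_gauge)
qed

text \<open>The Laplacian preserves evenness, so orthogonality also removes the mixed terms that
  contain a Laplacian.\<close>

lemma core_form:
  assumes h: "h \<in> even_tests (\<Omega> - N)" and k: "k \<in> even_tests (\<Omega> - N')"
  shows "ip (S (\<lambda>x. G x * h x + G' x * k x)) (\<lambda>x. G x * h x + G' x * k x) = ip (complex_laplacian h) h + ip (complex_laplacian k) k"
  unfolding core_laplacian[OF assms]
  using even_tests_L2[OF h] other.even_tests_L2[OF k] even_testsD(2)[OF h] even_testsD(2)[OF k]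
  by (intro ip_pair AE_I2) auto

text \<open>Four nonnegative real forms add up to the form on the core, so each is bounded by it.
  Form-Cauchy sequences in the core therefore have form-Cauchy components.\<close>

lemma real_form_le:
  assumes h: "h \<in> even_tests (\<Omega> - N)" and k: "k \<in> even_tests (\<Omega> - N')" and \<rho>: "\<rho> = Re \<or> \<rho> = Im"
  shows "norm (L2_inner_real \<Omega> (neg_laplacian (\<lambda>x. \<rho> (h x))) (\<lambda>x. \<rho> (h x)))
    \<le> norm (ip (S (\<lambda>x. G x * h x + G' x * k x)) (\<lambda>x. G x * h x + G' x * k x))"
proof -
  note nn = real_form_nonneg_N[OF h bounded_linear_Re] real_form_nonneg_N[OF h bounded_linear_Im]
    other.real_form_nonneg_N[OF k bounded_linear_Re] other.real_form_nonneg_N[OF k bounded_linear_Im]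
  have "norm (L2_inner_real \<Omega> (neg_laplacian (\<lambda>x. \<rho> (h x))) (\<lambda>x. \<rho> (h x))) \<le> Re (ip (complex_laplacian h) h)"
    using \<rho> nn unfolding Re_laplacian_form[OF h] by auto
  also have "\<dots> \<le> Re (ip (complex_laplacian h) h + ip (complex_laplacian k) k)"
    using nn by (simp add: other.Re_laplacian_form[OF k])
  also have "\<dots> \<le> norm (ip (complex_laplacian h) h + ip (complex_laplacian k) k)" by (rule complex_Re_le_cmod)
  finally show ?thesis by (simp only: core_form[OF h k])
qed

lemma core_subset: "core \<subseteq> DA"
proof
  fix v assume "v \<in> core"
  then obtain h k where v: "v = (\<lambda>x. G x * h x + G' x * k x)" and h: "h \<in> even_tests (\<Omega> - N)" and k: "k \<in> even_tests (\<Omega> - N')"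
    unfolding gauge_core_def by blast
  show "v \<in> DA" unfolding v
    by (intro test_functions_add test_functions_off_N[OF gauge_test(1)[OF even_testsD(1)[OF h]]]
       other.test_functions_off_N[OF other.gauge_test(1)[OF even_testsD(1)[OF k]]])
qed

text \<open>Each half of a test function under the involution matches one of the two gauges and is
  approximated there by \<open>gauge_dense\<close>.\<close>

lemma friedrichs_extension_core_eq:
  "friedrichs_extension (L2 \<Omega>) ip DA S = friedrichs_extension (L2 \<Omega>) ip core S"
proof -
  interpret F: symmetric_form "L2 \<Omega>" ip DA S by (rule poles.symmetric_form_magnetic)
  show ?thesis
  proof (rule F.friedrichs_extension_core[OF core_subset])
    fix v assume v: "v \<in> DA"
    define vp where "vp x = (1 / 2) * (v x + of_real s * (W x * v (\<sigma> x)))" for x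
    \<comment> \<open>The minus sign makes \<open>v\<close> the difference \<open>vp - vm\<close>,
      as the triangle inequalities require.\<close>
    define vm where "vm x = - 1 * ((1 / 2) * (v x + of_real s' * (W x * v (\<sigma> x))))" for x
    have vp: "vp \<in> DA" "\<And>x. of_real s * W x * vp (\<sigma> x) = vp x"
      using symmetric_part[OF v] by (simp_all add: vp_def[abs_def])
    have vm: "vm \<in> DA" unfolding vm_def[abs_def] by (rule test_functions_cmult[OF other.symmetric_part(1)[OF v]])
    have vm': "of_real s' * W x * vm (\<sigma> x) = vm x" for x
      using arg_cong[OF other.symmetric_part(2)[OF v, of x], of "(*) (-1)"] unfolding vm_def by (simp only: mult_ac)
    have vpm: "v x = vp x - vm x" for x by (simp add: vp_def vm_def opposite field_simps)
    obtain h where h: "\<And>n. h n \<in> even_tests (\<Omega> - N)"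
      "(\<lambda>n. F.ip_norm (\<lambda>x. vp x - G x * h n x)) \<longlonglongrightarrow> 0" "(\<lambda>n. F.form_norm (\<lambda>x. vp x - G x * h n x)) \<longlonglongrightarrow> 0"
      using gauge_dense[OF vp] unfolding F.ip_norm_tendsto_0_iff F.form_norm_tendsto_0_iff by blast
    obtain k where k: "\<And>n. k n \<in> even_tests (\<Omega> - N')"
      "(\<lambda>n. F.ip_norm (\<lambda>x. vm x - G' x * k n x)) \<longlonglongrightarrow> 0" "(\<lambda>n. F.form_norm (\<lambda>x. vm x - G' x * k n x)) \<longlonglongrightarrow> 0"
      using other.gauge_dense[OF vm vm'] unfolding F.ip_norm_tendsto_0_iff F.form_norm_tendsto_0_iff by blast
    define g where "g n x = G x * h n x + G' x * (- 1 * k n x)" for n x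
    have g: "g n \<in> core" for n
      unfolding g_def[abs_def] gauge_core_def
      by (intro CollectI exI[where x = "h n"] exI[where x = "\<lambda>x. - 1 * k n x"] conjI refl h(1)
          even_tests_bounded_linear[OF bounded_linear_mult_right k(1)])
    have d: "(\<lambda>x. v x - g n x) = (\<lambda>x. (vp x - G x * h n x) - (vm x - G' x * k n x))" for n
      by (simp add: vpm g_def algebra_simps)
    have D: "(\<lambda>x. vp x - G x * h n x) \<in> DA" "(\<lambda>x. vm x - G' x * k n x) \<in> DA" for n
      by (intro test_functions_diff vp vm test_functions_off_N[OF gauge_test(1)[OF even_testsD(1)[OF h(1)]]]
       other.test_functions_off_N[OF other.gauge_test(1)[OF even_testsD(1)[OF k(1)]]])+
    have "(\<lambda>n. F.ip_norm (\<lambda>x. v x - g n x)) \<longlonglongrightarrow> 0"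
    proof (rule Lim_null_comparison[OF always_eventually[OF allI]])
      show "norm (F.ip_norm (\<lambda>x. v x - g n x)) \<le> F.ip_norm (\<lambda>x. vp x - G x * h n x) + F.ip_norm (\<lambda>x. vm x - G' x * k n x)" for n
        using F.ip_norm_triangle[of "\<lambda>x. vp x - G x * h n x" "\<lambda>x. vm x - G' x * k n x"] D F.D_H unfolding d by (auto simp: F.ip_norm_def)
      show "(\<lambda>n. F.ip_norm (\<lambda>x. vp x - G x * h n x) + F.ip_norm (\<lambda>x. vm x - G' x * k n x)) \<longlonglongrightarrow> 0"
        using tendsto_add[OF h(2) k(2)] by simp
    qed
    moreover have "(\<lambda>n. F.form_norm (\<lambda>x. v x - g n x)) \<longlonglongrightarrow> 0"
    proof (rule Lim_null_comparison[OF always_eventually[OF allI]])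
      show "norm (F.form_norm (\<lambda>x. v x - g n x)) \<le> F.form_norm (\<lambda>x. vp x - G x * h n x) + F.form_norm (\<lambda>x. vm x - G' x * k n x)" for n
        using F.form_norm_triangle[of "\<lambda>x. vp x - G x * h n x" "\<lambda>x. vm x - G' x * k n x"] D unfolding d by (auto simp: F.form_norm_def)
      show "(\<lambda>n. F.form_norm (\<lambda>x. vp x - G x * h n x) + F.form_norm (\<lambda>x. vm x - G' x * k n x)) \<longlonglongrightarrow> 0"
        using tendsto_add[OF h(3) k(3)] by simp
    qed
    ultimately show "\<exists>g. (\<forall>n. g n \<in> core) \<and> (\<lambda>n. ip (\<lambda>x. v x - g n x) (\<lambda>x. v x - g n x)) \<longlonglongrightarrow> 0 \<and>
        (\<lambda>n. ip (S (\<lambda>x. v x - g n x)) (\<lambda>x. v x - g n x)) \<longlonglongrightarrow> 0"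
      unfolding F.ip_norm_tendsto_0_iff F.form_norm_tendsto_0_iff using g by blast
  qed
qed

end

section \<open>Transfer of eigenfunctions between the magnetic and the mixed operators\<close>

lemma Re_or_Im:
  assumes "\<rho> = Re \<or> \<rho> = Im"
  shows "bounded_linear \<rho>" "\<bar>\<rho> z\<bar> \<le> norm z" "\<rho> (z * complex_of_real r) = \<rho> z * r" "\<rho> (z - w) = \<rho> z - \<rho> w"
  using assms bounded_linear_Re bounded_linear_Im abs_Re_le_cmod abs_Im_le_cmod by auto

lemma integral_Re_or_Im:
  assumes "\<rho> = Re \<or> \<rho> = Im" "integrable M f"
  shows "(LINT x|M. \<rho> (f x)) = \<rho> (LINT x|M. f x)"
  using assms by auto

lemma L2_inner_of_real_right:
  assumes "\<rho> = Re \<or> \<rho> = Im" "u \<in> L2 \<Omega>" "g \<in> L2 \<Omega>"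
  shows "\<rho> (L2_inner_complex \<Omega> u (\<lambda>x. of_real (g x))) = L2_inner_real \<Omega> (\<lambda>x. \<rho> (u x)) g"
proof -
  have "integrable (lebesgue_on \<Omega>) (\<lambda>x. u x * cnj (of_real (g x)))"
    by (rule L2_inner_complex_integrable[OF assms(2) L2_of_real[OF assms(3)]])
  from integral_Re_or_Im[OF assms(1) this] show ?thesis
    by (simp add: L2_inner_complex_def L2_inner_real_def Re_or_Im(3)[OF assms(1)])
qed

lemma L2_inner_of_real_left:
  assumes "f \<in> L2 \<Omega>" "v \<in> L2 \<Omega>"
  shows "L2_inner_complex \<Omega> (\<lambda>x. of_real (f x)) v
    = Complex (L2_inner_real \<Omega> f (\<lambda>x. Re (v x))) (- L2_inner_real \<Omega> f (\<lambda>x. Im (v x)))"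
proof -
  have i: "integrable (lebesgue_on \<Omega>) (\<lambda>x. of_real (f x) * cnj (v x))"
    by (rule L2_inner_complex_integrable[OF L2_of_real[OF assms(1)] assms(2)])
  show ?thesis
    using integral_Re[OF i] integral_Im[OF i]
    by (simp add: complex_eq_iff L2_inner_complex_def L2_inner_real_def)
qed

context gauge_pair
begin

text \<open>Since \<open>proj\<close> is adjoint to multiplication by \<open>G\<close>, testing the
  equation for \<open>u\<close> against \<open>G * g\<close> gives the weak equation for
  \<open>proj u\<close>. With \<open>g\<close> and \<open>t\<close> real, its real and imaginary
  parts satisfy the equation separately.\<close>

lemma core_eigen_projection:
  assumes u: "u \<in> eigenspace (friedrichs_extension (L2 \<Omega>) ip core S) (of_real t)" and \<rho>: "\<rho> = Re \<or> \<rho> = Im"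
  shows "(\<lambda>x. \<rho> (proj u x)) \<in> eigenspace (friedrichs_extension (L2_sym \<Omega>) (L2_inner_real \<Omega>) (even_tests (\<Omega> - N)) neg_laplacian) t"
proof -
  let ?DN = "even_tests (\<Omega> - N) :: (real ^ 2 \<Rightarrow> real) set"
  let ?f = "\<lambda>x. \<rho> (proj u x)"
  have \<rho>m: "\<rho> \<in> borel_measurable borel" using \<rho> by auto
  have uL: "u \<in> L2 \<Omega>" and ufd: "u \<in> form_domain (L2 \<Omega>) ip core S"
    and eq: "\<And>v. v \<in> core \<Longrightarrow> ip u (S v) = ip (\<lambda>x. of_real t * u x) v"
    using u by (auto simp: eigenspace_def friedrichs_extension_def form_domain_def)
  have pL: "proj u \<in> L2 \<Omega>" by (rule L2_proj[OF uL])
  have L2\<rho>: "(\<lambda>x. \<rho> (w x)) \<in> L2 \<Omega>" if "w \<in> L2 \<Omega>" for w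
  proof (rule L2_norm_le[OF that])
    have "w \<in> borel_measurable (lebesgue_on \<Omega>)" using that by (simp add: L2_def)
    then show "(\<lambda>x. \<rho> (w x)) \<in> borel_measurable (lebesgue_on \<Omega>)" by (rule measurable_compose[OF _ \<rho>m])
  qed (simp add: Re_or_Im(2)[OF \<rho>])
  have f: "?f \<in> L2_sym \<Omega>" "(\<lambda>x. t * ?f x) \<in> L2_sym \<Omega>"
    using L2\<rho>[OF pL] by (auto simp: L2_sym_def proj_\<sigma> intro: L2_cmult)
  have fd: "?f \<in> form_domain (L2_sym \<Omega>) (L2_inner_real \<Omega>) ?DN neg_laplacian"
  proof -
    obtain w where w: "\<And>n. w n \<in> core" "(\<lambda>n. ip (\<lambda>x. w n x - u x) (\<lambda>x. w n x - u x)) \<longlonglongrightarrow> 0"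
      "\<forall>e>0. \<exists>M. \<forall>m\<ge>M. \<forall>n\<ge>M. norm (ip (S (\<lambda>x. w m x - w n x)) (\<lambda>x. w m x - w n x)) < e"
      using ufd unfolding form_domain_def by auto
    have "\<exists>h k. w n = (\<lambda>x. G x * h x + G' x * k x) \<and> h \<in> even_tests (\<Omega> - N) \<and> k \<in> even_tests (\<Omega> - N')" for n
      using w(1)[of n] unfolding gauge_core_def by blast
    then obtain h k where hk: "\<And>n. w n = (\<lambda>x. G x * h n x + G' x * k n x)"
      "\<And>n. h n \<in> even_tests (\<Omega> - N)" "\<And>n. k n \<in> even_tests (\<Omega> - N')" by metis
    have wL: "w n \<in> L2 \<Omega>" for n using w(1) core_subset poles.test_L2 by blast
    have h\<rho>: "(\<lambda>x. \<rho> (h n x)) \<in> ?DN" for n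
      by (rule even_tests_bounded_linear[OF Re_or_Im(1)[OF \<rho>] hk(2)])
    have lim: "(\<lambda>n. L2_inner_real \<Omega> (\<lambda>x. \<rho> (h n x) - ?f x) (\<lambda>x. \<rho> (h n x) - ?f x)) \<longlonglongrightarrow> 0"
    proof (rule Lim_null_comparison[OF always_eventually[OF allI]])
      fix n
      have dL: "(\<lambda>x. w n x - u x) \<in> L2 \<Omega>" using wL uL by (rule L2_diff)
      have hL: "(\<lambda>x. \<rho> (h n x) - ?f x) \<in> L2 \<Omega>"
        by (rule L2_diff[OF L2\<rho>[OF even_tests_L2(1)[OF hk(2)]] L2\<rho>[OF pL]])
      have i: "integrable (lebesgue_on \<Omega>) (\<lambda>x. (\<rho> (h n x) - ?f x) * (\<rho> (h n x) - ?f x))"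
        using L2_mult_integrable[OF hL hL] .
      \<comment> \<open>Off the cuts \<open>proj\<close> maps \<open>w n\<close> to
        \<open>h n\<close>, so the contraction property of \<open>proj\<close> bounds the distance
        to the limit.\<close>
      have "AE x in lebesgue_on \<Omega>. (\<rho> (h n x) - ?f x) * (\<rho> (h n x) - ?f x) \<le> (norm (proj (\<lambda>x. w n x - u x) x))\<^sup>2"
        using AE_N other.AE_N
      proof eventually_elim
        case (elim x)
        have "proj (\<lambda>x. w n x - u x) x = h n x - proj u x"
          unfolding proj_diff hk(1) using proj_gauge[of x "h n" "k n", OF elim even_testsD(2)[OF hk(2)] even_testsD(2)[OF hk(3)]] by simp
        then have "\<bar>\<rho> (h n x) - ?f x\<bar> \<le> norm (proj (\<lambda>x. w n x - u x) x)"
          using Re_or_Im(2)[OF \<rho>, of "h n x - proj u x"] by (simp add: Re_or_Im(4)[OF \<rho>])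
        then have "\<bar>\<rho> (h n x) - ?f x\<bar>\<^sup>2 \<le> (norm (proj (\<lambda>x. w n x - u x) x))\<^sup>2" by (intro power_mono) auto
        then show ?case by (simp add: power2_eq_square)
      qed
      then have "L2_inner_real \<Omega> (\<lambda>x. \<rho> (h n x) - ?f x) (\<lambda>x. \<rho> (h n x) - ?f x)
        \<le> (LINT x|lebesgue_on \<Omega>. (norm (proj (\<lambda>x. w n x - u x) x))\<^sup>2)"
        unfolding L2_inner_real_def using L2_proj[OF dL] i by (intro integral_mono_AE) (auto simp: L2_def)
      also have "\<dots> \<le> (LINT x|lebesgue_on \<Omega>. (norm (w n x - u x))\<^sup>2)" by (rule integral_norm_proj[OF dL])
      also have "\<dots> \<le> norm (ip (\<lambda>x. w n x - u x) (\<lambda>x. w n x - u x))"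
        unfolding L2_inner_complex_self norm_of_real by (rule abs_ge_self)
      finally have "L2_inner_real \<Omega> (\<lambda>x. \<rho> (h n x) - ?f x) (\<lambda>x. \<rho> (h n x) - ?f x) \<le> norm (ip (\<lambda>x. w n x - u x) (\<lambda>x. w n x - u x))" .
      moreover have "0 \<le> L2_inner_real \<Omega> (\<lambda>x. \<rho> (h n x) - ?f x) (\<lambda>x. \<rho> (h n x) - ?f x)"
        unfolding L2_inner_real_def by (intro integral_nonneg_AE) auto
      ultimately show "norm (L2_inner_real \<Omega> (\<lambda>x. \<rho> (h n x) - ?f x) (\<lambda>x. \<rho> (h n x) - ?f x)) \<le> norm (ip (\<lambda>x. w n x - u x) (\<lambda>x. w n x - u x))"
        by simp
    next
      show "(\<lambda>n. norm (ip (\<lambda>x. w n x - u x) (\<lambda>x. w n x - u x))) \<longlonglongrightarrow> 0" using w(2) by (rule tendsto_norm_zero)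
    qed
    have le: "norm (L2_inner_real \<Omega> (neg_laplacian (\<lambda>x. \<rho> (h m x) - \<rho> (h n x))) (\<lambda>x. \<rho> (h m x) - \<rho> (h n x)))
        \<le> norm (ip (S (\<lambda>x. w m x - w n x)) (\<lambda>x. w m x - w n x))" for m n
    proof -
      have "(\<lambda>x. w m x - w n x) = (\<lambda>x. G x * (h m x - h n x) + G' x * (k m x - k n x))"
        by (simp add: hk(1) algebra_simps)
      then show ?thesis
        using real_form_le[OF even_tests_diff[OF hk(2) hk(2)] even_tests_diff[OF hk(3) hk(3)] \<rho>, of m n m n]
        by (simp add: Re_or_Im(4)[OF \<rho>])
    qed
    have "\<exists>M. \<forall>m\<ge>M. \<forall>n\<ge>M. norm (L2_inner_real \<Omega> (neg_laplacian (\<lambda>x. \<rho> (h m x) - \<rho> (h n x))) (\<lambda>x. \<rho> (h m x) - \<rho> (h n x))) < e"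
      if "e > 0" for e using w(3)[rule_format, OF that] le le_less_trans by meson
    then show ?thesis unfolding form_domain_def
      using f(1) h\<rho> lim by (intro CollectI conjI exI[where x = "\<lambda>n x. \<rho> (h n x)"]) auto
  qed
  have "L2_inner_real \<Omega> ?f (neg_laplacian g) = L2_inner_real \<Omega> (\<lambda>x. t * ?f x) g" if g: "g \<in> ?DN" for g
  proof -
    have gt: "g \<in> test_functions (\<Omega> - N)" by (rule even_testsD(1)[OF g])
    have gc: "(\<lambda>x. complex_of_real (g x)) \<in> even_tests (\<Omega> - N)"
      by (rule even_tests_bounded_linear[OF bounded_linear_of_real g])
    have gL: "g \<in> L2 \<Omega>" "neg_laplacian g \<in> L2 \<Omega>"
      by (rule test_functions_L2[OF gt] test_functions_L2[OF neg_laplacian_test[OF gt]])+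
    have lap: "complex_laplacian (\<lambda>x. of_real (g x)) = (\<lambda>x. of_real (neg_laplacian g x))"
      by (rule complex_laplacian_of_real[OF test_functionsD(1)[OF gt]])
    have core: "(\<lambda>x. G x * of_real (g x)) \<in> core"
    proof -
      have "(\<lambda>x. G x * of_real (g x) + G' x * 0) \<in> core"
        unfolding gauge_core_def
        by (intro CollectI exI[where x = "\<lambda>x. of_real (g x)"] exI[where x = "\<lambda>x. 0"] conjI refl gc even_tests_zero)
      then show ?thesis by simp
    qed
    have even: "neg_laplacian g (\<sigma> x) = neg_laplacian g x" for x
      using even_tests_L2(3)[OF gc, of x] unfolding lap by simp
    have "ip (proj u) (\<lambda>x. of_real (neg_laplacian g x)) = ip u (\<lambda>x. G x * of_real (neg_laplacian g x))"
      by (rule ip_proj[symmetric, OF uL L2_of_real[OF gL(2)]]) (simp add: even)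
    also have "\<dots> = ip u (S (\<lambda>x. G x * of_real (g x)))"
      unfolding gauge_laplacian[OF even_testsD(1)[OF gc]] lap ..
    also have "\<dots> = of_real t * ip u (\<lambda>x. G x * of_real (g x))"
      using eq[OF core] by (simp add: L2_inner_complex_cmult_left)
    also have "ip u (\<lambda>x. G x * of_real (g x)) = ip (proj u) (\<lambda>x. of_real (g x))"
      by (rule ip_proj[OF uL L2_of_real[OF gL(1)]]) (simp add: even_testsD(2)[OF g])
    finally have "\<rho> (ip (proj u) (\<lambda>x. of_real (neg_laplacian g x))) = \<rho> (ip (proj u) (\<lambda>x. of_real (g x)) * of_real t)"
      by (simp only: mult.commute)
    then have "L2_inner_real \<Omega> ?f (neg_laplacian g) = L2_inner_real \<Omega> ?f g * t"
      by (simp only: Re_or_Im(3)[OF \<rho>] L2_inner_of_real_right[OF \<rho> pL] gL)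
    moreover have "L2_inner_real \<Omega> (\<lambda>x. t * ?f x) g = t * L2_inner_real \<Omega> ?f g"
      by (simp add: L2_inner_real_def mult.assoc)
    ultimately show ?thesis by (simp add: mult.commute)
  qed
  then show ?thesis using fd f by (simp add: eigenspace_def friedrichs_extension_def)
qed

text \<open>Tested against \<open>G * h + G' * k\<close>, the second part drops out by
  orthogonality. As \<open>h\<close> is complex, the real weak equation is used once for its real
  and once for its imaginary part.\<close>

lemma core_eigen_lift:
  assumes f: "f \<in> eigenspace (friedrichs_extension (L2_sym \<Omega>) (L2_inner_real \<Omega>) (even_tests (\<Omega> - N)) neg_laplacian) t"
  shows "(\<lambda>x. G x * of_real (f x)) \<in> eigenspace (friedrichs_extension (L2 \<Omega>) ip core S) (of_real t)"
proof -
  let ?DN = "even_tests (\<Omega> - N) :: (real ^ 2 \<Rightarrow> real) set"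
  have fS: "f \<in> L2_sym \<Omega>" and ffd: "f \<in> form_domain (L2_sym \<Omega>) (L2_inner_real \<Omega>) ?DN neg_laplacian"
    and eq: "\<And>g. g \<in> ?DN \<Longrightarrow> L2_inner_real \<Omega> f (neg_laplacian g) = L2_inner_real \<Omega> (\<lambda>x. t * f x) g"
    using f by (auto simp: eigenspace_def friedrichs_extension_def form_domain_def)
  have fL: "f \<in> L2 \<Omega>" and feven: "AE x in lebesgue_on \<Omega>. complex_of_real (f (\<sigma> x)) = of_real (f x)"
    using fS by (auto simp: L2_sym_def)
  have fcL: "(\<lambda>x. complex_of_real (f x)) \<in> L2 \<Omega>" by (rule L2_of_real[OF fL])
  let ?u = "\<lambda>x. G x * complex_of_real (f x)"
  have uL: "?u \<in> L2 \<Omega>" "(\<lambda>x. of_real t * ?u x) \<in> L2 \<Omega>"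
    using L2_G(1)[OF fcL] by (auto intro: L2_cmult)
  have core: "(\<lambda>x. G x * of_real (g x)) \<in> core" if g: "g \<in> ?DN" for g
  proof -
    have "(\<lambda>x. G x * of_real (g x) + G' x * 0) \<in> core"
      unfolding gauge_core_def
      by (intro CollectI exI[where x = "\<lambda>x. of_real (g x)"] exI[where x = "\<lambda>x. 0"] conjI refl even_tests_zero
          even_tests_bounded_linear[OF bounded_linear_of_real g])
    then show ?thesis by simp
  qed
  have fd: "?u \<in> form_domain (L2 \<Omega>) ip core S"
  proof -
    obtain w where w: "\<And>n. w n \<in> ?DN" "(\<lambda>n. L2_inner_real \<Omega> (\<lambda>x. w n x - f x) (\<lambda>x. w n x - f x)) \<longlonglongrightarrow> 0"
      "\<forall>e>0. \<exists>M. \<forall>m\<ge>M. \<forall>n\<ge>M. norm (L2_inner_real \<Omega> (neg_laplacian (\<lambda>x. w m x - w n x)) (\<lambda>x. w m x - w n x)) < e"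
      using ffd unfolding form_domain_def by auto
    let ?w = "\<lambda>n x. G x * complex_of_real (w n x)"
    have wL: "w n \<in> L2 \<Omega>" for n by (rule test_functions_L2[OF even_testsD(1)[OF w(1)]])
    \<comment> \<open>Multiplication by \<open>G\<close> is isometric and intertwines the
      Laplacians, so the lifted sequence has exactly the inner products and form values of the
      original one.\<close>
    have 1: "ip (\<lambda>x. ?w n x - ?u x) (\<lambda>x. ?w n x - ?u x) = of_real (L2_inner_real \<Omega> (\<lambda>x. w n x - f x) (\<lambda>x. w n x - f x))" for n
    proof -
      have "(\<lambda>x. ?w n x - ?u x) = (\<lambda>x. G x * of_real (w n x - f x))" by (simp add: algebra_simps)
      then show ?thesis
        using ip_gauge[OF L2_of_real[OF L2_diff[OF wL fL]] L2_of_real[OF L2_diff[OF wL fL]]]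
        by (simp only: L2_inner_of_real)
    qed
    have 2: "ip (S (\<lambda>x. ?w m x - ?w n x)) (\<lambda>x. ?w m x - ?w n x)
       = of_real (L2_inner_real \<Omega> (neg_laplacian (\<lambda>x. w m x - w n x)) (\<lambda>x. w m x - w n x))" for m n
    proof -
      have d: "(\<lambda>x. w m x - w n x) \<in> ?DN" by (rule even_tests_diff[OF w(1) w(1)])
      have dt: "(\<lambda>x. w m x - w n x) \<in> test_functions (\<Omega> - N)" by (rule even_testsD(1)[OF d])
      have "(\<lambda>x. ?w m x - ?w n x) = (\<lambda>x. G x * of_real (w m x - w n x))" by (simp add: algebra_simps)
      moreover have "ip (S (\<lambda>x. G x * of_real (w m x - w n x))) (\<lambda>x. G x * of_real (w m x - w n x))
        = ip (complex_laplacian (\<lambda>x. of_real (w m x - w n x))) (\<lambda>x. of_real (w m x - w n x))"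
        unfolding gauge_laplacian[OF of_real_test[OF dt]]
        by (rule ip_gauge) (rule test_functions_L2[OF laplacian_test[OF of_real_test[OF dt] off.open_U]] test_functions_L2[OF of_real_test[OF dt]])+
      ultimately show ?thesis using real_form_eq[OF dt, of "\<lambda>x. w m x - w n x"] by simp
    qed
    have "\<exists>M. \<forall>m\<ge>M. \<forall>n\<ge>M. norm (ip (S (\<lambda>x. ?w m x - ?w n x)) (\<lambda>x. ?w m x - ?w n x)) < e" if "e > 0" for e
      using w(3)[rule_format, OF that] unfolding 2 norm_of_real real_norm_def .
    moreover have "(\<lambda>n. ip (\<lambda>x. ?w n x - ?u x) (\<lambda>x. ?w n x - ?u x)) \<longlonglongrightarrow> 0"
      unfolding 1 using tendsto_of_real[OF w(2)] by simp
    ultimately show ?thesis unfolding form_domain_def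
      using uL(1) core[OF w(1)] by (intro CollectI conjI exI[where x = ?w]) auto
  qed
  have "ip ?u (S v) = ip (\<lambda>x. of_real t * ?u x) v" if "v \<in> core" for v
  proof -
    obtain h k where v: "v = (\<lambda>x. G x * h x + G' x * k x)" and h: "h \<in> even_tests (\<Omega> - N)" and k: "k \<in> even_tests (\<Omega> - N')"
      using \<open>v \<in> core\<close> unfolding gauge_core_def by blast
    have split: "ip ?u (\<lambda>x. G x * a x + G' x * b x) = ip (\<lambda>x. of_real (f x)) a"
      if "a \<in> L2 \<Omega>" "b \<in> L2 \<Omega>" "\<And>x. b (\<sigma> x) = b x" for a b
      using ip_orthogonal[OF fcL feven that(2)] that
      by (simp add: L2_inner_complex_add_right uL L2_G(1) other.L2_G(1) ip_gauge fcL)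
    have ht: "h \<in> test_functions (\<Omega> - N)" by (rule even_testsD(1)[OF h])
    have lap: "\<rho> (complex_laplacian h x) = neg_laplacian (\<lambda>x. \<rho> (h x)) x" if "\<rho> = Re \<or> \<rho> = Im" for \<rho> x
      by (rule bounded_linear_complex_laplacian[OF test_functionsD(1)[OF ht] Re_or_Im(1)[OF that]])
    have real: "L2_inner_real \<Omega> f (neg_laplacian (\<lambda>x. \<rho> (h x))) = t * L2_inner_real \<Omega> f (\<lambda>x. \<rho> (h x))"
      if "\<rho> = Re \<or> \<rho> = Im" for \<rho>
      using eq[OF even_tests_bounded_linear[OF Re_or_Im(1)[OF that] h]] by (simp add: L2_inner_real_def mult.assoc)
    have "ip ?u (S v) = ip (\<lambda>x. of_real (f x)) (complex_laplacian h)"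
      unfolding v core_laplacian[OF h k]
      by (rule split[OF even_tests_L2(2)[OF h] other.even_tests_L2(2)[OF k] other.even_tests_L2(3)[OF k]])
    also have "\<dots> = of_real t * ip (\<lambda>x. of_real (f x)) h"
      unfolding L2_inner_of_real_left[OF fL even_tests_L2(2)[OF h]] L2_inner_of_real_left[OF fL even_tests_L2(1)[OF h]]
      using real[of Re] real[of Im] lap[of Re] lap[of Im] by (simp add: complex_eq_iff)
    also have "ip (\<lambda>x. of_real (f x)) h = ip ?u v"
      unfolding v by (rule split[symmetric, OF even_tests_L2(1)[OF h] other.even_tests_L2(1)[OF k] even_testsD(2)[OF k]])
    finally show ?thesis by (simp add: L2_inner_complex_cmult_left)
  qed
  then show ?thesis using fd uL by (simp add: eigenspace_def friedrichs_extension_def)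
qed

end

section \<open>Multiplicities\<close>

text \<open>Gaussian elimination: a pivot \<open>p\<close> removes one equation together with one
  unknown.\<close>

lemma homogeneous_system_nontrivial_solution:
  fixes M :: "'i \<Rightarrow> 'j \<Rightarrow> 's::field"
  assumes "finite J" "finite I" "card J < card I"
  shows "\<exists>c. (\<exists>i\<in>I. c i \<noteq> 0) \<and> (\<forall>j\<in>J. (\<Sum>i\<in>I. c i * M i j) = 0)"
  using assms
proof (induction J arbitrary: I M rule: finite_induct)
  case empty
  then obtain i where "i \<in> I" by fastforce
  then show ?case by (intro exI[where x = "\<lambda>_. 1"]) auto
next
  case (insert j J)
  show ?case
  proof (cases "\<forall>i\<in>I. M i j = 0")
    case True
    then show ?thesis using insert.IH[of I M] insert.prems insert.hyps by auto
  next
    case False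
    then obtain p where p: "p \<in> I" "M p j \<noteq> 0" by blast
    have "card J < card (I - {p})" using insert.prems insert.hyps p by simp
    then obtain c where c: "\<exists>i\<in>I - {p}. c i \<noteq> 0"
      "\<forall>k\<in>J. (\<Sum>i\<in>I - {p}. c i * (M i k - M i j / M p j * M p k)) = 0"
      using insert.IH[of "I - {p}" "\<lambda>i k. M i k - M i j / M p j * M p k"] insert.prems by auto
    \<comment> \<open>The pivot value is dictated by equation \<open>j\<close>; with it the other
      equations become the reduced ones solved by \<open>c\<close>.\<close>
    define e where "e i = (if i = p then - (\<Sum>i\<in>I - {p}. c i * (M i j / M p j)) else c i)" for i
    have e: "(\<Sum>i\<in>I. e i * M i k) = (\<Sum>i\<in>I - {p}. c i * (M i k - M i j / M p j * M p k))" for k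
    proof -
      have "(\<Sum>i\<in>I. e i * M i k) = e p * M p k + (\<Sum>i\<in>I - {p}. e i * M i k)"
        using insert.prems p by (simp add: sum.remove)
      also have "(\<Sum>i\<in>I - {p}. e i * M i k) = (\<Sum>i\<in>I - {p}. c i * M i k)"
        by (intro sum.cong) (auto simp: e_def)
      also have "e p * M p k = - (\<Sum>i\<in>I - {p}. c i * (M i j / M p j * M p k))"
        unfolding e_def by (simp add: sum_distrib_right mult.assoc)
      finally show ?thesis by (simp only: right_diff_distrib sum_subtractf) simp
    qed
    have "(\<Sum>i\<in>I. e i * M i k) = 0" if "k \<in> insert j J" for k
      unfolding e using that c(2) p(2) by (cases "k = j") simp_all
    moreover obtain i where "i \<in> I - {p}" "c i \<noteq> 0" using c(1) by blast
    then have "i \<in> I" "e i \<noteq> 0" by (simp_all add: e_def)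
    ultimately show ?thesis by (intro exI[where x = e] conjI ballI bexI[where x = i])
  qed
qed

lemma has_dimensionE:
  fixes E :: "(real ^ 'n::finite \<Rightarrow> 's::real_normed_field) set"
  assumes "has_dimension \<Omega> E n"
  obtains b :: "nat \<Rightarrow> real ^ 'n \<Rightarrow> 's" where "\<And>i. i < n \<Longrightarrow> b i \<in> E"
    "\<And>c. AE x in lebesgue_on \<Omega>. (\<Sum>i<n. c i * b i x) = 0 \<Longrightarrow> \<forall>i<n. c i = 0"
    "\<And>u. u \<in> E \<Longrightarrow> \<exists>c. AE x in lebesgue_on \<Omega>. u x = (\<Sum>i<n. c i * b i x)"
proof -
  from assms[unfolded has_dimension_def] obtain b :: "nat \<Rightarrow> real ^ 'n \<Rightarrow> 's" where
    b: "(\<forall>i<n. b i \<in> E) \<and> (\<forall>c. (AE x in lebesgue_on \<Omega>. (\<Sum>i<n. c i * b i x) = 0) \<longrightarrow> (\<forall>i<n. c i = 0)) \<and>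
        (\<forall>u\<in>E. \<exists>c. AE x in lebesgue_on \<Omega>. u x = (\<Sum>i<n. c i * b i x))" ..
  show thesis
  proof (rule that[of b])
    show "b i \<in> E" if "i < n" for i by (rule b[THEN conjunct1, rule_format, OF that])
    show "\<forall>i<n. c i = 0" if "AE x in lebesgue_on \<Omega>. (\<Sum>i<n. c i * b i x) = 0" for c
      by (rule b[THEN conjunct2, THEN conjunct1, THEN spec, THEN mp, OF that])
    show "\<exists>c. AE x in lebesgue_on \<Omega>. u x = (\<Sum>i<n. c i * b i x)" if "u \<in> E" for u
      by (rule b[THEN conjunct2, THEN conjunct2, THEN bspec, OF that])
  qed
qed

text \<open>A longer second family would have a coordinate matrix with more rows than columns, hence
  a nontrivial relation almost everywhere, against its independence.\<close>

lemma has_dimension_le: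
  fixes E :: "(real ^ 'n::finite \<Rightarrow> 's::real_normed_field) set"
  assumes "has_dimension \<Omega> E n" "has_dimension \<Omega> E m"
  shows "m \<le> n"
proof (rule ccontr)
  assume "\<not> m \<le> n"
  obtain b :: "nat \<Rightarrow> real ^ 'n \<Rightarrow> 's" where b: "\<And>i. i < n \<Longrightarrow> b i \<in> E"
    "\<And>c. AE x in lebesgue_on \<Omega>. (\<Sum>i<n. c i * b i x) = 0 \<Longrightarrow> \<forall>i<n. c i = 0"
    "\<And>u. u \<in> E \<Longrightarrow> \<exists>c. AE x in lebesgue_on \<Omega>. u x = (\<Sum>i<n. c i * b i x)"
    by (rule has_dimensionE[OF assms(1)], rule that)
  obtain b' where b': "\<And>i. i < m \<Longrightarrow> b' i \<in> E"
    "\<And>c. AE x in lebesgue_on \<Omega>. (\<Sum>i<m. c i * b' i x) = 0 \<Longrightarrow> \<forall>i<m. c i = 0"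
    "\<And>u. u \<in> E \<Longrightarrow> \<exists>c. AE x in lebesgue_on \<Omega>. u x = (\<Sum>i<m. c i * b' i x)"
    by (rule has_dimensionE[OF assms(2)], rule that)
  have "\<forall>i. \<exists>c. i < m \<longrightarrow> (AE x in lebesgue_on \<Omega>. b' i x = (\<Sum>j<n. c j * b j x))"
    using b(3)[OF b'(1)] by simp
  then obtain M where M: "\<And>i. i < m \<Longrightarrow> AE x in lebesgue_on \<Omega>. b' i x = (\<Sum>j<n. M i j * b j x)" by metis
  obtain c where c: "\<exists>i\<in>{..<m}. c i \<noteq> 0" "\<forall>j\<in>{..<n}. (\<Sum>i<m. c i * M i j) = 0"
    using homogeneous_system_nontrivial_solution[of "{..<n}" "{..<m}" M] \<open>\<not> m \<le> n\<close> by auto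
  have "AE x in lebesgue_on \<Omega>. \<forall>i\<in>{..<m}. b' i x = (\<Sum>j<n. M i j * b j x)"
    using M by (intro AE_finite_allI) auto
  then have "AE x in lebesgue_on \<Omega>. (\<Sum>i<m. c i * b' i x) = 0"
  proof eventually_elim
    case (elim x)
    have "(\<Sum>i<m. c i * b' i x) = (\<Sum>i<m. \<Sum>j<n. c i * M i j * b j x)"
      using elim by (intro sum.cong) (auto simp: sum_distrib_left mult.assoc)
    also have "\<dots> = (\<Sum>j<n. \<Sum>i<m. c i * M i j * b j x)" by (rule sum.swap)
    also have "\<dots> = (\<Sum>j<n. (\<Sum>i<m. c i * M i j) * b j x)" by (simp add: sum_distrib_right)
    also have "\<dots> = 0" using c(2) by (intro sum.neutral) auto
    finally show ?case .
  qed
  then show False using b'(2) c(1) by blast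
qed

lemma has_dimension_unique: "has_dimension \<Omega> E n \<Longrightarrow> has_dimension \<Omega> E m \<Longrightarrow> n = m"
  using has_dimension_le by (metis le_antisym)

lemma eigenspace_friedrichs_subset: "eigenspace (friedrichs_extension H ip D S) z \<subseteq> H"
  by (auto simp: eigenspace_def friedrichs_extension_def form_domain_def)

context gauge_pair
begin

abbreviation "real_eigenspace t \<equiv> eigenspace (friedrichs_extension (L2_sym \<Omega>) (L2_inner_real \<Omega>) (even_tests (\<Omega> - N)) neg_laplacian) t"

text \<open>Applying \<open>proj\<close> to the vanishing sum isolates \<open>a\<close>. This uses
  the relation at a point and at its reflection, whence \<open>AE_\<sigma>\<close>.\<close>

lemma gauge_part_zero:
  assumes a: "AE x in lebesgue_on \<Omega>. a (\<sigma> x) = a x" and b: "AE x in lebesgue_on \<Omega>. b (\<sigma> x) = b x"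
    and zero: "AE x in lebesgue_on \<Omega>. G x * a x + G' x * b x = 0"
  shows "AE x in lebesgue_on \<Omega>. a x = 0"
  using AE_N other.AE_N a b zero AE_\<sigma>[OF zero]
proof eventually_elim
  case (elim x)
  have "a x = proj (\<lambda>x. G x * a x + G' x * b x) x" using proj_gauge[of x a b, OF elim(1-4)] by simp
  also have "\<dots> = 0" unfolding proj_def elim(5,6) by simp
  finally show ?case .
qed

lemma projection_expansion:
  assumes u: "u \<in> eigenspace (friedrichs_extension (L2 \<Omega>) ip core S) (of_real t)"
    and b: "\<And>f. f \<in> real_eigenspace t \<Longrightarrow> \<exists>c. AE x in lebesgue_on \<Omega>. f x = (\<Sum>i<n. c i * b i x)"
  shows "\<exists>c. AE x in lebesgue_on \<Omega>. proj u x = (\<Sum>i<n. c i * of_real (b i x))"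
proof -
  obtain c where c: "AE x in lebesgue_on \<Omega>. Re (proj u x) = (\<Sum>i<n. c i * b i x)"
    using b[OF core_eigen_projection[OF u, of Re]] by auto
  obtain d where d: "AE x in lebesgue_on \<Omega>. Im (proj u x) = (\<Sum>i<n. d i * b i x)"
    using b[OF core_eigen_projection[OF u, of Im]] by auto
  have "AE x in lebesgue_on \<Omega>. proj u x = (\<Sum>i<n. Complex (c i) (d i) * of_real (b i x))"
    using c d by eventually_elim (simp add: complex_eq_iff)
  then show ?thesis by (rule exI[where x = "\<lambda>i. Complex (c i) (d i)"])
qed

end

text \<open>The real and imaginary parts of a complex relation among real functions are real
  relations.\<close>

lemma complex_independent:
  fixes b :: "nat \<Rightarrow> real ^ 'n::finite \<Rightarrow> real"
  assumes b: "\<And>c. AE x in lebesgue_on \<Omega>. (\<Sum>i<n. c i * b i x) = 0 \<Longrightarrow> \<forall>i<n. c i = 0"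
    and c: "AE x in lebesgue_on \<Omega>. (\<Sum>i<n. c i * complex_of_real (b i x)) = 0"
  shows "\<forall>i<n. c i = 0"
proof -
  have "AE x in lebesgue_on \<Omega>. (\<Sum>i<n. Re (c i) * b i x) = 0"
    using c by eventually_elim (drule arg_cong[where f = Re], simp)
  moreover have "AE x in lebesgue_on \<Omega>. (\<Sum>i<n. Im (c i) * b i x) = 0"
    using c by eventually_elim (drule arg_cong[where f = Im], simp)
  ultimately show ?thesis using b[of "\<lambda>i. Re (c i)"] b[of "\<lambda>i. Im (c i)"] by (simp add: complex_eq_iff)
qed

lemma sum_lessThan_add: "(\<Sum>k<n + m. f k) = (\<Sum>k<n. f k) + (\<Sum>k<m. f (n + k))"
  for f :: "nat \<Rightarrow> 'a::comm_monoid_add"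
  by (induction m) (auto simp: add.assoc)

context gauge_pair
begin

lemma gauge_pair_swap: "gauge_pair \<Omega> am ap N' G' s' N G s"
  by unfold_locales (simp add: opposite)

text \<open>The lifted bases of the two real eigenspaces together form one complex basis: the
  projections separate a relation into its two halves, and \<open>u\<close> is rebuilt from its two
  projections. In this way real multiplicities become complex ones.\<close>

lemma has_dimension_core:
  assumes n: "has_dimension \<Omega> (real_eigenspace t) n"
    and m: "has_dimension \<Omega> (eigenspace (friedrichs_extension (L2_sym \<Omega>) (L2_inner_real \<Omega>) (even_tests (\<Omega> - N')) neg_laplacian) t) m"
  shows "has_dimension \<Omega> (eigenspace (friedrichs_extension (L2 \<Omega>) ip core S) (of_real t)) (n + m)"
proof -
  \<comment> \<open>Exchanging the gauges supplies every lemma for the second component;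
    \<open>comm\<close> identifies the two cores.\<close>
  interpret swap: gauge_pair \<Omega> am ap N' G' s' N G s by (rule gauge_pair_swap)
  let ?E = "eigenspace (friedrichs_extension (L2 \<Omega>) ip core S) (of_real t)"
  have comm: "gauge_core \<Omega> N' G' N G = core" by (rule gauge_core_commute)
  obtain b where b: "\<And>i. i < n \<Longrightarrow> b i \<in> real_eigenspace t"
    "\<And>c. AE x in lebesgue_on \<Omega>. (\<Sum>i<n. c i * b i x) = 0 \<Longrightarrow> \<forall>i<n. c i = 0"
    "\<And>f. f \<in> real_eigenspace t \<Longrightarrow> \<exists>c. AE x in lebesgue_on \<Omega>. f x = (\<Sum>i<n. c i * b i x)"
    by (rule has_dimensionE[OF n], rule that)
  obtain b' where b': "\<And>i. i < m \<Longrightarrow> b' i \<in> swap.real_eigenspace t"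
    "\<And>c. AE x in lebesgue_on \<Omega>. (\<Sum>i<m. c i * b' i x) = 0 \<Longrightarrow> \<forall>i<m. c i = 0"
    "\<And>f. f \<in> swap.real_eigenspace t \<Longrightarrow> \<exists>c. AE x in lebesgue_on \<Omega>. f x = (\<Sum>i<m. c i * b' i x)"
    by (rule has_dimensionE[OF m], rule that)
  define B where "B k x = (if k < n then G x * complex_of_real (b k x) else G' x * complex_of_real (b' (k - n) x))" for k x
  have sumB: "(\<Sum>k<n + m. c k * B k x) = G x * (\<Sum>i<n. c i * of_real (b i x)) + G' x * (\<Sum>i<m. c (n + i) * of_real (b' i x))" for c x
    unfolding sum_lessThan_add by (simp add: B_def sum_distrib_left mult_ac)
  have inE: "B k \<in> ?E" if "k < n + m" for k
  proof (cases "k < n")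
    case True
    then show ?thesis using core_eigen_lift[OF b(1)] by (simp add: B_def[abs_def])
  next
    case False
    then show ?thesis using that swap.core_eigen_lift[OF b'(1), of "k - n"] unfolding comm by (simp add: B_def[abs_def])
  qed
  have indep: "\<forall>k<n + m. c k = 0" if c: "AE x in lebesgue_on \<Omega>. (\<Sum>k<n + m. c k * B k x) = 0" for c
  proof -
    let ?a = "\<lambda>x. \<Sum>i<n. c i * complex_of_real (b i x)" and ?d = "\<lambda>x. \<Sum>i<m. c (n + i) * complex_of_real (b' i x)"
    have "b i \<in> L2_sym \<Omega>" if "i < n" for i using b(1)[OF that] eigenspace_friedrichs_subset by blast
    then have "AE x in lebesgue_on \<Omega>. \<forall>i\<in>{..<n}. b i (\<sigma> x) = b i x"
      by (intro AE_finite_allI) (auto simp: L2_sym_def)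
    then have a: "AE x in lebesgue_on \<Omega>. ?a (\<sigma> x) = ?a x" by eventually_elim (auto intro!: sum.cong)
    have "b' i \<in> L2_sym \<Omega>" if "i < m" for i using b'(1)[OF that] eigenspace_friedrichs_subset by blast
    then have "AE x in lebesgue_on \<Omega>. \<forall>i\<in>{..<m}. b' i (\<sigma> x) = b' i x"
      by (intro AE_finite_allI) (auto simp: L2_sym_def)
    then have d: "AE x in lebesgue_on \<Omega>. ?d (\<sigma> x) = ?d x" by eventually_elim (auto intro!: sum.cong)
    have z: "AE x in lebesgue_on \<Omega>. G x * ?a x + G' x * ?d x = 0" using c unfolding sumB .
    then have z': "AE x in lebesgue_on \<Omega>. G' x * ?d x + G x * ?a x = 0" by (simp add: add.commute)
    have "\<forall>i<n. c i = 0" by (rule complex_independent[OF b(2) gauge_part_zero[OF a d z]])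
    moreover have "\<forall>i<m. c (n + i) = 0" by (rule complex_independent[OF b'(2) swap.gauge_part_zero[OF d a z']])
    ultimately show ?thesis by (metis add_diff_inverse_nat nat_add_left_cancel_less)
  qed
  have span: "\<exists>c. AE x in lebesgue_on \<Omega>. u x = (\<Sum>k<n + m. c k * B k x)" if u: "u \<in> ?E" for u
  proof -
    obtain c where c: "AE x in lebesgue_on \<Omega>. proj u x = (\<Sum>i<n. c i * of_real (b i x))"
      using projection_expansion[OF u b(3)] ..
    obtain d where d: "AE x in lebesgue_on \<Omega>. other.proj u x = (\<Sum>i<m. d i * of_real (b' i x))"
      using swap.projection_expansion[OF u[folded comm] b'(3)] ..
    have "AE x in lebesgue_on \<Omega>. u x = (\<Sum>k<n + m. (if k < n then c k else d (k - n)) * B k x)"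
      using c d AE_N other.AE_N
    proof eventually_elim
      case (elim x)
      show ?case unfolding sumB using proj_reconstruct[OF elim(3,4), of u] elim(1,2) by simp
    qed
    then show ?thesis by (rule exI[where x = "\<lambda>k. if k < n then c k else d (k - n)"])
  qed
  show ?thesis
    unfolding has_dimension_def
  proof (rule exI[where x = B], intro conjI)
    show "\<forall>i<n + m. B i \<in> ?E" using inE by simp
    show "\<forall>c. (AE x in lebesgue_on \<Omega>. (\<Sum>i<n + m. c i * B i x) = 0) \<longrightarrow> (\<forall>i<n + m. c i = 0)"
      by (intro allI[OF impI] indep)
    show "\<forall>u\<in>?E. \<exists>c. AE x in lebesgue_on \<Omega>. u x = (\<Sum>i<n + m. c i * B i x)"
      by (intro ballI span)
  qed
qed

end

text \<open>Over each value the two fibres are finite of equal size; bijections chosen fibre by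
  fibre glue to a global one.\<close>

lemma union_with_multiplicitiesI:
  assumes "\<And>t. finite {k. lam k = t}" "\<And>t. finite {k. mu k = t}" "\<And>t. finite {k. nu k = t}"
    and card: "\<And>t. card {k. lam k = t} = card {k. mu k = t} + card {k. nu k = t}"
  shows "union_with_multiplicities lam mu nu"
proof -
  let ?p = "case_sum mu nu :: nat + nat \<Rightarrow> real"
  have fib: "{y. ?p y = t} = Inl ` {k. mu k = t} \<union> Inr ` {k. nu k = t}" for t
  proof (rule set_eqI)
    fix y :: "nat + nat"
    show "y \<in> {y. ?p y = t} \<longleftrightarrow> y \<in> Inl ` {k. mu k = t} \<union> Inr ` {k. nu k = t}"
      by (cases y) auto
  qed
  have "\<exists>h. bij_betw h {k. lam k = t} {y. ?p y = t}" for t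
  proof (rule finite_same_card_bij)
    show "card {k. lam k = t} = card {y. ?p y = t}"
      unfolding fib using assms by (subst card_Un_disjoint) (auto simp: card_image)
  qed (use assms in \<open>auto simp: fib\<close>)
  then obtain H where H: "\<And>t. bij_betw (H t) {k. lam k = t} {y. ?p y = t}" by metis
  define h where "h k = H (lam k) k" for k
  have p: "?p (h k) = lam k" for k using bij_betwE[OF H[of "lam k"]] by (auto simp: h_def)
  have "inj h"
  proof (rule injI)
    fix k l assume e: "h k = h l"
    then have "lam k = lam l" using p by metis
    then show "k = l" using e bij_betw_imp_inj_on[OF H[of "lam k"]] by (auto simp: h_def dest: inj_onD)
  qed
  moreover have "y \<in> range h" for y
  proof -
    have "y \<in> H (?p y) ` {k. lam k = ?p y}" using bij_betw_imp_surj_on[OF H[of "?p y"]] by simp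
    then obtain k where "lam k = ?p y" "y = H (?p y) k" by blast
    then have "y = h k" by (simp add: h_def)
    then show ?thesis by blast
  qed
  ultimately have "bij h" by (auto simp: bij_def)
  then show ?thesis unfolding union_with_multiplicities_def using p by metis
qed

theorem corollary3p10:
  fixes \<Omega> :: "(real ^ 2) set"
    and am ap :: real
    and lam lam_NDN lam_DND :: "nat \<Rightarrow> real"
  assumes "open \<Omega>" and "bounded \<Omega>" and "connected \<Omega>"
    and "\<sigma> ` \<Omega> = \<Omega>"
    and "am < ap"
    and "eigenvalue_sequence \<Omega> (H_A \<Omega> am ap) lam"
    and "eigenvalue_sequence \<Omega> (H_NDN \<Omega> am ap) lam_NDN"
    and "eigenvalue_sequence \<Omega> (H_DND \<Omega> am ap) lam_DND"
  shows "union_with_multiplicities lam lam_NDN lam_DND"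
proof -
  interpret symmetric_domain \<Omega> using assms by unfold_locales
  \<comment> \<open>The cut of a gauge carries the Dirichlet condition: the segment gives
    \<open>H_NDN\<close>, the outer axis \<open>H_DND\<close>.\<close>
  interpret P: gauge_pair \<Omega> am ap "segment_between am ap" "gauge_root am ap (segment_between am ap) 1" 1
    "outer_axis am ap" "gauge_root am ap (outer_axis am ap) \<i>" "-1"
    using gauge_segment[OF symmetric_domain_axioms assms(5)] gauge_outer_axis[OF symmetric_domain_axioms assms(5)]
    by (simp add: gauge_pair_def gauge_pair_axioms_def)
  have HA: "H_A \<Omega> am ap = friedrichs_extension (L2 \<Omega>) (L2_inner_complex \<Omega>) P.core (magnetic_laplacian (AB_potential am ap))"
    unfolding H_A_def by (rule P.friedrichs_extension_core_eq)
  \<comment> \<open>All listed eigenvalues are real, so multiplicities are compared at real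
    \<open>t\<close>, embedded into the complex numbers for \<open>H_A\<close>.\<close>
  have dims: "finite {k. lam k = t}" "has_dimension \<Omega> (eigenspace (H_A \<Omega> am ap) (of_real t)) (card {k. lam k = t})"
    "finite {k. lam_NDN k = t}" "has_dimension \<Omega> (eigenspace (H_NDN \<Omega> am ap) t) (card {k. lam_NDN k = t})"
    "finite {k. lam_DND k = t}" "has_dimension \<Omega> (eigenspace (H_DND \<Omega> am ap) t) (card {k. lam_DND k = t})" for t
    using assms(6)[unfolded eigenvalue_sequence_def, THEN conjunct2, rule_format, of "of_real t"]
      assms(7)[unfolded eigenvalue_sequence_def, THEN conjunct2, rule_format, of t]
      assms(8)[unfolded eigenvalue_sequence_def, THEN conjunct2, rule_format, of t] by simp_all
  show ?thesis
  proof (rule union_with_multiplicitiesI)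
    fix t
    have "has_dimension \<Omega> (eigenspace (H_A \<Omega> am ap) (of_real t)) (card {k. lam_NDN k = t} + card {k. lam_DND k = t})"
      unfolding HA
      using dims(4,6)[of t] P.has_dimension_core[of t] unfolding H_NDN_eq H_DND_eq[OF assms(5)] by simp
    then show "card {k. lam k = t} = card {k. lam_NDN k = t} + card {k. lam_DND k = t}"
      using dims(2) has_dimension_unique by blast
  qed (use dims in auto)
qed

end
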